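(* Let $\{u_1,\dots,u_k\}$ be a Gauss paragraph consisting of $2n$ letters ($n\geq 1$) that cannot be split into a disjoint union of two non-empty Gauss subparagraphs, and let $W$ be any Gauss code associated to $\{u_1,\dots,u_k\}$ by the doubling-and-inserting construction described in the context. Then $\{u_1,\dots,u_k\}$ encodes the plane diagram (with classical crossings only) of a classical $k$-component link if and only if $\alpha_i(W)=0$ and $\beta_{ij}(W)=0$ for all $i,j\in\{1,\dots,n\}$.
   Context: Gauss paragraph: given $n\ge1$, fix the alphabet $\{i,\,i^+,\,i^- : i=1,\dots,n\}$. A Gauss paragraph is an unordered collection $\{u_1,\dots,u_k\}$ of words, considered up to cyclic rotation of each word, such that every word has even length and, for each $i\in\{1,\dots,n\}$, the letter $i$ occurs exactly once in total in $u_1,\dots,u_k$, and exactly one of the letters $i^+$, $i^-$ occurs, exactly once in total. It is splittable if the collection of words can be divided into two non-empty subcollections such that for every index $i$ both letters with index $i$ lie in the same subcollection. Encoding: a plane link diagram is a generic smooth immersion of $k$ oriented circles into the oriented plane with finitely many transversal double points (crossings), with an over-branch and an under-branch specified at every crossing (no virtual crossings). The sign of a crossing is $+$ if (tangent of over-branch, tangent of under-branch) is a positively oriented basis, and $-$ otherwise. Numbering the crossings by $1,\dots,n$ in any order, associate to each circle the cyclic word obtained by travelling once along it and writing $i$ when passing crossing $i$ along the over-branch and $i^{\varepsilon}$ when passing it along the under-branch, where $\varepsilon$ is the sign of the crossing. A Gauss paragraph encodes the diagram if it is the resulting collection of cyclic words for some numbering. Gauss code: given a finite index set $I$, a Gauss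 code $W$ is a permutation of the symbols $i^{+1}, i^{-1}$ ($i\in I$), considered as a cyclic word. For $i\in I$ let $S_i$ be the set of symbols of the subword of $W$ between $i^{+1}$ and $i^{-1}$ (reading $W$ cyclically forward from $i^{+1}$ to $i^{-1}$), not including $i^{\pm1}$. Let $\alpha_i(W)$ be the sum of the superscripts of the symbols of $S_i$. Let $S_i^{-1}$ be the set of the symbols of $S_i$ with all superscripts reversed, and $\bar S_i=S_i\cup\{i^{+1},i^{-1}\}$. For $i,j\in I$ let $\beta_{ij}(W)$ be the sum of the superscripts of the symbols of $\bar S_i\cap S_j^{-1}$. Gauss code associated to a non-splittable Gauss paragraph $\{u_1,\dots,u_k\}$: if there is more than one word, choose two different words $u,v$ of the current collection and an index $i$ such that $u$ contains the letter $i$ and $v$ contains $i^{\varepsilon}$ with $\varepsilon\in\{+,-\}$. Rotate $v$ cyclically so that $i^{\varepsilon}$ is its last letter. Introduce a new index $\tilde i$; replace in $u$ the letter $i$ by the two letters $i\,\tilde i^{\,\varepsilon}$, and replace in $v$ the letter $i^{\varepsilon}$ by the two letters $i^{\varepsilon}\,\tilde i$. Then insert the word $v$, now ending with $i^{\varepsilon}\tilde i$, into $u$ right after $i\,\tilde i^{\,\varepsilon}$; this replaces the two words $u,v$ by one word of length $|u|+|v|+2$. Repeat until a single cyclic word, of length $2n+2k-2$, remains. Finally replace the letters for every index $i$ (original or new) as follows: $i^+\mapsto i^{+1}$, $i^-\mapsto i^{-1}$, and $i\mapsto i^{-\varepsilon}$, where $\varepsilon$ is the superscript of the other letter with the same index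 $i$. The result is a Gauss code $W$ whose index set $I$ consists of $1,\dots,n$ and the $k-1$ new indices. It depends on the choices made. *)

theory Defs
  imports "HOL-Analysis.Analysis" "HOL-Library.Multiset"
begin

section \<open>Gauss paragraphs\<close>

datatype sign = Plus | Minus

fun sign_val :: "sign \<Rightarrow> int" where
  "sign_val Plus = 1"
| "sign_val Minus = - 1"

text \<open>\<open>Over i\<close> is the letter \<open>i\<close>; \<open>Under i \<epsilon>\<close> is the letter \<open>i\<close> with superscript \<open>\<epsilon>\<close>.\<close>

datatype letter = Over nat | Under nat sign

fun letter_index :: "letter \<Rightarrow> nat" where
  "letter_index (Over i) = i"
| "letter_index (Under i e) = i"

text \<open>
  A cyclic word is given by any list representing it; \<open>cyclic_eq\<close> says that two lists
  represent the same cyclic word.  An unordered collection of words is a multiset.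
\<close>

definition cyclic_eq :: "'a list \<Rightarrow> 'a list \<Rightarrow> bool" where
  "cyclic_eq u v \<longleftrightarrow> (\<exists>m. v = rotate m u)"

definition letters :: "letter list multiset \<Rightarrow> letter multiset" where
  "letters P = (\<Sum>u\<in>#P. mset u)"

definition indices :: "letter list multiset \<Rightarrow> nat set" where
  "indices P = letter_index ` set_mset (letters P)"

definition gauss_paragraph :: "nat \<Rightarrow> letter list multiset \<Rightarrow> bool" where
  "gauss_paragraph n P \<longleftrightarrow>
     indices P \<subseteq> {1..n} \<and>
     (\<forall>u\<in>#P. even (length u)) \<and>
     (\<forall>i\<in>{1..n}. count (letters P) (Over i) = 1 \<and>
        count (letters P) (Under i Plus) + count (letters P) (Under i Minus) = 1)"

definition splittable :: "letter list multiset \<Rightarrow> bool" where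
  "splittable P \<longleftrightarrow>
     (\<exists>A B. P = A + B \<and> A \<noteq> {#} \<and> B \<noteq> {#} \<and>
        (\<forall>i\<in>indices P. i \<notin> indices A \<or> i \<notin> indices B))"


section \<open>Plane link diagrams\<close>

definition smooth_curve :: "(real \<Rightarrow> complex) \<Rightarrow> bool" where
  "smooth_curve g \<longleftrightarrow>
     (\<exists>D :: nat \<Rightarrow> real \<Rightarrow> complex. D 0 = g \<and>
        (\<forall>m t. (D m has_vector_derivative D (Suc m) t) (at t)))"

text \<open>
  The oriented plane is \<open>complex\<close> with the positive basis \<open>(1, \<i>)\<close>; oriented circles are
  copies of the reals modulo 1, so that an immersed circle is a 1-periodic curve.
  Component \<open>j\<close> is \<open>curve D j\<close> for \<open>j < ncomp D\<close>.
  A branch is a pair (component, parameter in \<open>[0, 1)\<close>), and \<open>over_branch D p\<close> is the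
  over-branch at the crossing \<open>p\<close>; its values at other points are irrelevant.
\<close>

record diagram =
  ncomp :: nat
  curve :: "nat \<Rightarrow> real \<Rightarrow> complex"
  over_branch :: "complex \<Rightarrow> nat \<times> real"

definition branches :: "diagram \<Rightarrow> complex \<Rightarrow> (nat \<times> real) set" where
  "branches D p = {(j, t). j < ncomp D \<and> 0 \<le> t \<and> t < 1 \<and> curve D j t = p}"

definition crossings :: "diagram \<Rightarrow> complex set" where
  "crossings D = {p. \<exists>a\<in>branches D p. \<exists>b\<in>branches D p. a \<noteq> b}"

definition tangent :: "diagram \<Rightarrow> nat \<times> real \<Rightarrow> complex" where
  "tangent D b = vector_derivative (curve D (fst b)) (at (snd b))"

definition det2 :: "complex \<Rightarrow> complex \<Rightarrow> real" where
  "det2 v w = Re v * Im w - Im v * Re w"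

definition under_branch :: "diagram \<Rightarrow> complex \<Rightarrow> nat \<times> real" where
  "under_branch D p = (THE b. b \<in> branches D p \<and> b \<noteq> over_branch D p)"

definition link_diagram :: "diagram \<Rightarrow> bool" where
  "link_diagram D \<longleftrightarrow>
     (\<forall>j<ncomp D. smooth_curve (curve D j) \<and>
        (\<forall>t. curve D j (t + 1) = curve D j t) \<and>
        (\<forall>t. vector_derivative (curve D j) (at t) \<noteq> 0)) \<and>
     finite (crossings D) \<and>
     (\<forall>p\<in>crossings D.
        card (branches D p) = 2 \<and>
        (\<forall>a\<in>branches D p. \<forall>b\<in>branches D p. a \<noteq> b \<longrightarrow> det2 (tangent D a) (tangent D b) \<noteq> 0) \<and>
        over_branch D p \<in> branches D p)"

definition crossing_sign :: "diagram \<Rightarrow> complex \<Rightarrow> sign" where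
  "crossing_sign D p =
     (if det2 (tangent D (over_branch D p)) (tangent D (under_branch D p)) > 0
      then Plus else Minus)"

definition branch_letter :: "diagram \<Rightarrow> (complex \<Rightarrow> nat) \<Rightarrow> nat \<times> real \<Rightarrow> letter" where
  "branch_letter D num b =
     (let p = curve D (fst b) (snd b) in
      if b = over_branch D p then Over (num p) else Under (num p) (crossing_sign D p))"

definition component_word :: "diagram \<Rightarrow> (complex \<Rightarrow> nat) \<Rightarrow> nat \<Rightarrow> letter list" where
  "component_word D num j =
     map (\<lambda>t. branch_letter D num (j, t))
       (sorted_list_of_set {t. 0 \<le> t \<and> t < 1 \<and> curve D j t \<in> crossings D})"

definition encodes :: "letter list multiset \<Rightarrow> diagram \<Rightarrow> bool" where
  "encodes P D \<longleftrightarrow>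
     (\<exists>num. bij_betw num (crossings D) {1..card (crossings D)} \<and>
        rel_mset cyclic_eq P (image_mset (component_word D num) (mset_set {..<ncomp D})))"


section \<open>Gauss codes\<close>

text \<open>The pair \<open>(i, e)\<close> with \<open>e \<in> {1, -1}\<close> is the symbol \<open>i\<close> with superscript \<open>e\<close>.
  A Gauss code is a list representing a cyclic word; in it every such symbol occurs exactly
  once for each index \<open>i\<close> that is used.\<close>

type_synonym symbol = "nat \<times> int"

text \<open>\<open>code_S W i\<close> consists of the symbols strictly between \<open>(i, 1)\<close> and \<open>(i, -1)\<close>, reading
  \<open>W\<close> cyclically forward from \<open>(i, 1)\<close>.\<close>

definition rotate_to :: "'a \<Rightarrow> 'a list \<Rightarrow> 'a list" where
  "rotate_to x xs = dropWhile (\<lambda>y. y \<noteq> x) xs @ takeWhile (\<lambda>y. y \<noteq> x) xs"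

definition code_S :: "symbol list \<Rightarrow> nat \<Rightarrow> symbol set" where
  "code_S W i = set (takeWhile (\<lambda>s. s \<noteq> (i, -1)) (tl (rotate_to (i, 1) W)))"

definition code_S_inv :: "symbol list \<Rightarrow> nat \<Rightarrow> symbol set" where
  "code_S_inv W i = (\<lambda>(l, e). (l, - e)) ` code_S W i"

definition code_S_bar :: "symbol list \<Rightarrow> nat \<Rightarrow> symbol set" where
  "code_S_bar W i = code_S W i \<union> {(i, 1), (i, -1)}"

definition code_alpha :: "symbol list \<Rightarrow> nat \<Rightarrow> int" where
  "code_alpha W i = (\<Sum>s\<in>code_S W i. snd s)"

definition code_beta :: "symbol list \<Rightarrow> nat \<Rightarrow> nat \<Rightarrow> int" where
  "code_beta W i j = (\<Sum>s\<in>code_S_bar W i \<inter> code_S_inv W j. snd s)"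

text \<open>
  One doubling-and-inserting step.  The word \<open>v = v1 @ [Under i \<epsilon>] @ v2\<close>, rotated so that
  \<open>Under i \<epsilon>\<close> comes last, is \<open>v2 @ v1 @ [Under i \<epsilon>]\<close>.  The two words are distinct members
  of the collection.
\<close>

inductive merge_step :: "letter list multiset \<Rightarrow> letter list multiset \<Rightarrow> bool" where
  merge: "u = u1 @ [Over i] @ u2 \<Longrightarrow> v = v1 @ [Under i e] @ v2 \<Longrightarrow>
    j \<notin> indices ({#u, v#} + M) \<Longrightarrow>
    merge_step ({#u, v#} + M)
      (add_mset (u1 @ [Over i, Under j e] @ (v2 @ v1 @ [Under i e, Over j]) @ u2) M)"

fun to_symbol :: "letter list \<Rightarrow> letter \<Rightarrow> symbol" where
  "to_symbol w (Under i e) = (i, sign_val e)"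
| "to_symbol w (Over i) = (i, - sign_val (THE e. Under i e \<in> set w))"

definition associated_gauss_code :: "letter list multiset \<Rightarrow> symbol list \<Rightarrow> bool" where
  "associated_gauss_code P W \<longleftrightarrow>
     (\<exists>w. merge_step\<^sup>*\<^sup>* P {#w#} \<and> cyclic_eq (map (to_symbol w) w) W)"

end

theory Submission
  imports Defs
begin

text \<open>
  Normalise the letters so that \<open>(i, 1)\<close> and \<open>(i, -1)\<close> are the two passages through crossing \<open>i\<close>
  and the tangents of \<open>(i, -1)\<close> and \<open>(i, 1)\<close>, in this order, form a positive basis, whichever of them
  is over.  The words then describe a 4-valent graph with a cyclic order at each vertex, that is, a
  graph on a closed oriented surface, and the middle notion of the proof is: the intersection form of
  the surface vanishes on the cycles of the graph.

  For a single word the cycles are spanned by the whole word and the loops at its crossings, whose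
  intersection numbers are \<open>\<alpha>\<^sub>i\<close> and \<open>\<beta>\<^sub>i\<^sub>j\<close> up to a factor 2.  A doubling-and-inserting
  step embeds the cycles of the old graph isometrically into those of the new one, as the cycles
  that do not turn at the new crossing.

  For a plane diagram the form vanishes because of the argument of \<open>A s - B t\<close> for two arcs
  \<open>A\<close>, \<open>B\<close> between consecutive crossings: its total change around the unit square is \<open>0\<close>.  Summed with
  the coefficients of two cycles, the changes along the sides cancel, and the jumps at the corners
  add up to a multiple of the intersection number.

  Conversely, start at one vertex of the connected graph and absorb the others one by one into a
  growing disc, recording the half-edges on its boundary as a word.  When all vertices are absorbed, the
  vanishing of the form says that the edges still open pair up without crossing, so they can be capped
  off.  This process is a sequence of minima, crossings and maxima placed in consecutive horizontal
  strips, and smooth strands drawn in these strips give the diagram.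
\<close>

section \<open>Flows on the words of a paragraph\<close>

text \<open>Vanishing of a bilinear form stands for genus zero in both directions; no surface is
  constructed. The contribution of two cycles at one crossing is half-integral in general; counting
  it once on the leaving and once on the entering edges keeps the form integral and is the origin of
  the factor 2. Only \<open>i\<close>, \<open>j\<close> up to \<open>n\<close> are tested because
  the loop at a new index turns at a crossing that the paragraph does not have; the flows going
  straight through all new crossings are spanned by the whole word and the loops at the old ones.
  For a given diagram the corner angles are unknown reals. Conservation at a crossing makes them
  cancel, and what survives is the difference between the angle of a vector and that of its
  opposite, which is plus or minus pi. In the drawing every strand is a vertical line near the ends
  of its strip, so that pieces fit smoothly. A turning strand stays in the half of the strip next to
  its ends, because the strands on its right move over by two places in the same strip.\<close>

definition cyclic_flow :: "('a \<Rightarrow> int) \<Rightarrow> ('a \<Rightarrow> int) \<Rightarrow> 'a list \<Rightarrow> bool" where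
  "cyclic_flow p c u \<longleftrightarrow> map c u = rotate1 (map p u)"

text \<open>
  \<open>c m\<close> and \<open>p m\<close> are the coefficients of a cycle on the edges leaving and entering the passage \<open>m\<close>;
  \<open>inter\<close> is twice the intersection number.
\<close>

definition flow :: "symbol list multiset \<Rightarrow> nat set \<Rightarrow> (symbol \<Rightarrow> int) \<Rightarrow> (symbol \<Rightarrow> int) \<Rightarrow> bool" where
  "flow Q I p c \<longleftrightarrow> (\<forall>u\<in>#Q. cyclic_flow p c u) \<and>
     (\<forall>i\<in>I. c (i, 1) + c (i, -1) = p (i, 1) + p (i, -1))"

definition inter :: "nat set \<Rightarrow> (symbol \<Rightarrow> int) \<Rightarrow> (symbol \<Rightarrow> int) \<Rightarrow> (symbol \<Rightarrow> int) \<Rightarrow> (symbol \<Rightarrow> int) \<Rightarrow> int" where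
  "inter I p c q d = (\<Sum>i\<in>I. c (i, 1) * d (i, -1) - c (i, -1) * d (i, 1)
      + p (i, 1) * q (i, -1) - p (i, -1) * q (i, 1))"

definition planar :: "symbol list multiset \<Rightarrow> nat set \<Rightarrow> bool" where
  "planar Q I \<longleftrightarrow> (\<forall>p c q d. flow Q I p c \<longrightarrow> flow Q I q d \<longrightarrow> inter I p c q d = 0)"

text \<open>\<open>rotate\<close> commutes with \<open>rotate1\<close>, so both sides of the
  defining equation may be rotated together. Hence only the cyclic word matters.\<close>

lemma cyclic_flow_append_swap: "cyclic_flow p c (x @ y) \<longleftrightarrow> cyclic_flow p c (y @ x)"
proof -
  have *: "cyclic_flow p c (y @ x)" if "cyclic_flow p c (x @ y)" for x y :: "'a list"
  proof -
    have "map c (y @ x) = rotate (length x) (map c (x @ y))"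
      using rotate_append[of "map c x" "map c y"] by simp
    also have "\<dots> = rotate (length x) (rotate1 (map p (x @ y)))"
      using that by (simp add: cyclic_flow_def)
    also have "\<dots> = rotate1 (rotate (length x) (map p x @ map p y))"
      by (simp add: rotate1_rotate_swap)
    also have "\<dots> = rotate1 (map p (y @ x))"
      using rotate_append[of "map p x" "map p y"] by simp
    finally show ?thesis by (simp add: cyclic_flow_def)
  qed
  show ?thesis using * by blast
qed

lemma cyclic_flow_rotate: "cyclic_flow p c (rotate m u) \<longleftrightarrow> cyclic_flow p c u"
  by (metis append_take_drop_id cyclic_flow_append_swap rotate_drop_take)

lemma cyclic_flow_cong:
  "(\<And>x. x \<in> set u \<Longrightarrow> p x = p' x \<and> c x = c' x) \<Longrightarrow> cyclic_flow p c u \<longleftrightarrow> cyclic_flow p' c' u"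
  unfolding cyclic_flow_def by (metis map_cong)

lemma cyclic_flow_linear:
  assumes "cyclic_flow p c u" and "cyclic_flow q d u"
  shows "cyclic_flow (\<lambda>x. p x + a * q x) (\<lambda>x. c x + a * d x) u"
proof (cases u)
  case (Cons x v)
  have *: "map (\<lambda>x. f x + a * g x) w = map2 (\<lambda>y z. y + a * z) (map f w) (map g w)" for f g :: "'a \<Rightarrow> int" and w
    by (induction w) auto
  from Cons assms have 1: "c x # map c v = map p v @ [p x]" "d x # map d v = map q v @ [q x]"
    by (auto simp: cyclic_flow_def)
  have "map (\<lambda>x. c x + a * d x) u = map2 (\<lambda>y z. y + a * z) (map p v @ [p x]) (map q v @ [q x])"
    using 1 Cons * by (metis list.simps(9))
  also have "\<dots> = rotate1 (map (\<lambda>x. p x + a * q x) u)"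
    using Cons *[of p q v] by simp
  finally show ?thesis by (simp add: cyclic_flow_def)
qed (simp add: cyclic_flow_def)

lemma cyclic_flow_sum:
  assumes "cyclic_flow p c u" and "\<And>i. i \<in> I \<Longrightarrow> cyclic_flow (q i) (d i) u" and "finite I"
  shows "cyclic_flow (\<lambda>x. p x + (\<Sum>i\<in>I. a i * q i x)) (\<lambda>x. c x + (\<Sum>i\<in>I. a i * d i x)) u"
  using assms(3,2)
proof (induction I rule: finite_induct)
  case empty
  then show ?case using assms(1) by simp
next
  case (insert i I)
  then have "cyclic_flow (\<lambda>x. p x + (\<Sum>i\<in>I. a i * q i x)) (\<lambda>x. c x + (\<Sum>i\<in>I. a i * d i x)) u" by simp
  from cyclic_flow_linear[OF this, of "q i" "d i" "a i"] insert show ?case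
    by (simp add: algebra_simps)
qed

text \<open>With \<open>c = p\<close> the coefficient does not change at any passage: the list of
  coefficients is fixed by every rotation, and each entry can be rotated to the head.\<close>

lemma cyclic_flow_const:
  assumes "cyclic_flow p p u" and "x \<in> set u" and "y \<in> set u"
  shows "p x = p y"
proof -
  have r: "rotate1 (map p u) = map p u" using assms(1) by (simp add: cyclic_flow_def)
  have all: "rotate m (map p u) = map p u" for m
    by (induction m) (simp_all add: r)
  have "p z = hd (map p u)" if "z \<in> set u" for z
  proof -
    from that obtain k where k: "k < length u" "u ! k = z" by (metis in_set_conv_nth)
    have "hd (rotate k (map p u)) = map p u ! k"
      using k by (subst hd_rotate_conv_nth) auto
    with all k show ?thesis by simp
  qed
  with assms show ?thesis by metis
qed

text \<open>The loop at crossing \<open>i\<close> starts on the edge leaving \<open>(i, 1)\<close>,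
  runs along \<open>W\<close> and closes up on the edge entering \<open>(i, -1)\<close>. The symbols
  of \<open>code_S W i\<close> are passed straight, so they occur both among the leaving and among
  the entering edges.\<close>

definition chord_out :: "symbol list \<Rightarrow> nat \<Rightarrow> symbol \<Rightarrow> int" where
  "chord_out W i x = of_bool (x \<in> insert (i, 1) (code_S W i))"

definition chord_in :: "symbol list \<Rightarrow> nat \<Rightarrow> symbol \<Rightarrow> int" where
  "chord_in W i x = of_bool (x \<in> insert (i, -1) (code_S W i))"

lemma rotate_to_split:
  assumes "distinct W" and "x \<in> set W"
  obtains A B where "W = A @ x # B" and "rotate_to x W = x # B @ A"
proof -
  from assms(2) obtain A B where W: "W = A @ x # B" by (meson split_list)
  with assms(1) have "x \<notin> set A" by auto
  then have "takeWhile (\<lambda>y. y \<noteq> x) W = A" "dropWhile (\<lambda>y. y \<noteq> x) W = x # B"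
    unfolding W by (induction A) auto
  with W that show ?thesis by (simp add: rotate_to_def)
qed

section \<open>A single word: its flows are spanned by the constant flow and the loops\<close>

locale gauss_code =
  fixes W :: "symbol list" and I :: "nat set"
  assumes distinct: "distinct W" and set_W: "set W = I \<times> {1, -1}" and finite: "finite I"
begin

lemma chord_split:
  assumes "i \<in> I"
  obtains A B where "\<And>p c. cyclic_flow p c W \<longleftrightarrow> cyclic_flow p c ((i, 1) # A @ (i, -1) # B)"
    and "code_S W i = set A" and "distinct ((i, 1) # A @ (i, -1) # B)"
    and "set ((i, 1) # A @ (i, -1) # B) = set W"
proof -
  from assms have "(i, 1) \<in> set W" using set_W by auto
  from rotate_to_split[OF distinct this] obtain A0 B0 where
    W: "W = A0 @ (i, 1) # B0" and r: "rotate_to (i, 1) W = (i, 1) # B0 @ A0" .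
  have "(i, -1) \<in> set W" using assms set_W by auto
  with W have "(i, -1) \<in> set (B0 @ A0)" by auto
  then obtain A B where AB: "B0 @ A0 = A @ (i, -1) # B" by (meson split_list)
  have d: "distinct ((i, 1) # A @ (i, -1) # B)" using distinct W AB[symmetric] by auto
  then have "(i, -1) \<notin> set A" by auto
  then have "takeWhile (\<lambda>s. s \<noteq> (i, -1)) (A @ (i, -1) # B) = A"
    by (induction A) auto
  with r AB have S: "code_S W i = set A" by (simp add: code_S_def)
  show ?thesis
  proof (rule that[OF _ S d])
    show "cyclic_flow p c W \<longleftrightarrow> cyclic_flow p c ((i, 1) # A @ (i, -1) # B)" for p c
      using cyclic_flow_append_swap[of p c A0 "(i, 1) # B0"] AB W by simp
    show "set ((i, 1) # A @ (i, -1) # B) = set W" using W AB[symmetric] by auto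
  qed
qed

lemma code_S_subset: "i \<in> I \<Longrightarrow> code_S W i \<subseteq> I \<times> {1, -1} - {(i, 1), (i, -1)}"
proof -
  assume i: "i \<in> I"
  obtain A B where A: "code_S W i = set A" "distinct ((i, 1) # A @ (i, -1) # B)"
    "set ((i, 1) # A @ (i, -1) # B) = set W" by (rule chord_split[OF i]) blast
  have "set A \<subseteq> set W" using A(3) by auto
  then show ?thesis using A(1,2) set_W by auto
qed

lemma chord_cyclic_flow:
  assumes "i \<in> I"
  shows "cyclic_flow (chord_in W i) (chord_out W i) W"
proof -
  obtain A B where
    cf: "\<And>p c. cyclic_flow p c W \<longleftrightarrow> cyclic_flow p c ((i, 1) # A @ (i, -1) # B)"
    and S: "code_S W i = set A" and d: "distinct ((i, 1) # A @ (i, -1) # B)" by (rule chord_split[OF assms]) blast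
  have 1: "map (chord_out W i) A = replicate (length A) 1"
    by (auto simp: chord_out_def S map_replicate_const[symmetric] intro!: map_cong)
  have 2: "map (chord_in W i) A = replicate (length A) 1"
    by (auto simp: chord_in_def S map_replicate_const[symmetric] intro!: map_cong)
  have 3: "map (chord_out W i) B = replicate (length B) 0"
    using d by (auto simp: chord_out_def S map_replicate_const[symmetric] intro!: map_cong)
  have 4: "map (chord_in W i) B = replicate (length B) 0"
    using d by (auto simp: chord_in_def S map_replicate_const[symmetric] intro!: map_cong)
  have 5: "chord_out W i (i, 1) = 1" "chord_in W i (i, -1) = 1"
    by (auto simp: chord_in_def chord_out_def)
  have 6: "chord_out W i (i, -1) = 0" "chord_in W i (i, 1) = 0"
    using d by (auto simp: chord_in_def chord_out_def S)
  show ?thesis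
    unfolding cf unfolding cyclic_flow_def
    by (simp add: 1 2 3 4 5 6) (simp add: replicate_append_same)
qed

text \<open>The two indicator functions differ only at the end points of the loop. Loops are thus
  dual to the jumps \<open>c (i, 1) - p (i, 1)\<close>, which is why these jumps are the
  coefficients in \<open>flow_decomp\<close>.\<close>

lemma chord_diff:
  assumes "i \<in> I" and "m \<in> I \<times> {1, -1}"
  shows "chord_out W i m - chord_in W i m = (if fst m = i then snd m else 0)"
  using code_S_subset[OF assms(1)] assms(2) by (auto simp: chord_out_def chord_in_def)

lemma chord_flow:
  assumes "i \<in> I"
  shows "flow {#W#} I (chord_in W i) (chord_out W i)"
proof -
  have "chord_out W i (j, 1) + chord_out W i (j, -1) = chord_in W i (j, 1) + chord_in W i (j, -1)" if "j \<in> I" for j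
    using chord_diff[OF assms, of "(j, 1)"] chord_diff[OF assms, of "(j, -1)"] that by (auto split: if_splits)
  with chord_cyclic_flow[OF assms] show ?thesis by (simp add: flow_def)
qed

text \<open>Conservation makes the jumps of a flow at \<open>(i, 1)\<close> and
  \<open>(i, -1)\<close> opposite, as they are for the loop at \<open>i\<close>. Subtracting the
  loops with the jumps as coefficients leaves a flow without jumps, which is constant along the
  single word.\<close>

lemma flow_decomp:
  assumes "flow {#W#} I p c"
  obtains a where "\<And>m. m \<in> I \<times> {1, -1} \<Longrightarrow> c m = a + (\<Sum>i\<in>I. (c (i, 1) - p (i, 1)) * chord_out W i m)"
    and "\<And>m. m \<in> I \<times> {1, -1} \<Longrightarrow> p m = a + (\<Sum>i\<in>I. (c (i, 1) - p (i, 1)) * chord_in W i m)"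
proof -
  define k where "k i = c (i, 1) - p (i, 1)" for i
  define c0 where "c0 m = c m + (\<Sum>i\<in>I. - k i * chord_out W i m)" for m
  define p0 where "p0 m = p m + (\<Sum>i\<in>I. - k i * chord_in W i m)" for m
  have cf: "cyclic_flow p0 c0 W"
    unfolding c0_def p0_def
    by (rule cyclic_flow_sum) (use assms chord_cyclic_flow finite in \<open>auto simp: flow_def\<close>)
  have eq: "c0 m = p0 m" if "m \<in> I \<times> {1, -1}" for m
  proof -
    have "c0 m - p0 m = c m - p m - (\<Sum>i\<in>I. k i * (chord_out W i m - chord_in W i m))"
      by (simp add: c0_def p0_def sum_subtractf sum_negf right_diff_distrib)
    also have "(\<Sum>i\<in>I. k i * (chord_out W i m - chord_in W i m)) = (\<Sum>i\<in>I. if fst m = i then k i * snd m else 0)"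
      by (rule sum.cong) (use chord_diff that in auto)
    also have "\<dots> = k (fst m) * snd m"
      using that finite by (auto simp: sum.delta')
    also have "c m - p m - k (fst m) * snd m = 0"
      using that assms by (auto simp: k_def flow_def algebra_simps)
    finally show ?thesis by simp
  qed
  have "cyclic_flow p0 p0 W"
    using cf by (rule cyclic_flow_cong[THEN iffD1, rotated]) (use eq set_W in auto)
  then have const: "p0 x = p0 y" if "x \<in> I \<times> {1, -1}" "y \<in> I \<times> {1, -1}" for x y
    using cyclic_flow_const that set_W by metis
  \<comment> \<open>For empty \<open>I\<close> this is an arbitrary value, and both claims are
    vacuous.\<close>
  define a where "a = p0 (SOME x. x \<in> I \<times> {1, -1})"
  have a: "p0 m = a" if "m \<in> I \<times> {1, -1}" for m
    unfolding a_def by (rule const[OF that]) (use that in \<open>rule someI\<close>)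
  show ?thesis
  proof (rule that[of a])
    fix m :: symbol assume m: "m \<in> I \<times> {1, -1}"
    show "c m = a + (\<Sum>i\<in>I. (c (i, 1) - p (i, 1)) * chord_out W i m)"
      using a[OF m] eq[OF m] by (simp add: c0_def k_def left_diff_distrib sum_subtractf)
    show "p m = a + (\<Sum>i\<in>I. (c (i, 1) - p (i, 1)) * chord_in W i m)"
      using a[OF m] by (simp add: p0_def k_def left_diff_distrib sum_subtractf)
  qed
qed

end

text \<open>Written as a sum over symbols weighted by their superscripts, the form can be compared
  with \<open>code_alpha\<close> and \<open>code_beta\<close>, which sum superscripts over sets of
  symbols.\<close>

lemma inter_symbols:
  assumes "finite I"
  shows "inter I p c q d = (\<Sum>m\<in>I \<times> {1, -1}. snd m * (c m * d (fst m, - snd m) + p m * q (fst m, - snd m)))"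
proof -
  have "(\<Sum>m\<in>I \<times> {1, -1}. snd m * (c m * d (fst m, - snd m) + p m * q (fst m, - snd m)))
    = (\<Sum>i\<in>I. \<Sum>e\<in>{1, -1}. e * (c (i, e) * d (i, - e) + p (i, e) * q (i, - e)))"
    by (subst sum.cartesian_product) (auto intro!: sum.cong)
  also have "\<dots> = inter I p c q d"
    unfolding inter_def by (rule sum.cong) (auto simp: algebra_simps)
  finally show ?thesis by simp
qed

lemma inter_antisym: "inter I p c q d = - inter I q d p c"
  unfolding inter_def sum_negf[symmetric] by (rule sum.cong) (auto simp: algebra_simps)

lemma inter_expand:
  assumes "finite J"
    and "\<And>m. m \<in> I \<times> {1, -1} \<Longrightarrow> c m = a + (\<Sum>i\<in>J. k i * C i m)"
    and "\<And>m. m \<in> I \<times> {1, -1} \<Longrightarrow> p m = a + (\<Sum>i\<in>J. k i * D i m)"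
  shows "inter I p c q d = a * inter I (\<lambda>_. 1) (\<lambda>_. 1) q d + (\<Sum>i\<in>J. k i * inter I (D i) (C i) q d)"
proof -
  have "inter I p c q d = (\<Sum>l\<in>I. a * (d (l, -1) - d (l, 1) + q (l, -1) - q (l, 1)) + (\<Sum>i\<in>J. k i *
     (C i (l, 1) * d (l, -1) - C i (l, -1) * d (l, 1) + D i (l, 1) * q (l, -1) - D i (l, -1) * q (l, 1))))"
    unfolding inter_def
  proof (rule sum.cong[OF refl])
    fix l assume "l \<in> I"
    then have "c (l, 1) = a + (\<Sum>i\<in>J. k i * C i (l, 1))" "c (l, -1) = a + (\<Sum>i\<in>J. k i * C i (l, -1))"
      "p (l, 1) = a + (\<Sum>i\<in>J. k i * D i (l, 1))" "p (l, -1) = a + (\<Sum>i\<in>J. k i * D i (l, -1))"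
      using assms by auto
    then show "c (l, 1) * d (l, -1) - c (l, -1) * d (l, 1) + p (l, 1) * q (l, -1) - p (l, -1) * q (l, 1) =
      a * (d (l, -1) - d (l, 1) + q (l, -1) - q (l, 1)) + (\<Sum>i\<in>J. k i *
     (C i (l, 1) * d (l, -1) - C i (l, -1) * d (l, 1) + D i (l, 1) * q (l, -1) - D i (l, -1) * q (l, 1)))"
      by (simp add: algebra_simps sum.distrib sum_subtractf sum_distrib_left sum_distrib_right)
  qed
  also have "\<dots> = a * inter I (\<lambda>_. 1) (\<lambda>_. 1) q d + (\<Sum>l\<in>I. \<Sum>i\<in>J. k i *
     (C i (l, 1) * d (l, -1) - C i (l, -1) * d (l, 1) + D i (l, 1) * q (l, -1) - D i (l, -1) * q (l, 1)))"
    by (simp add: sum.distrib inter_def sum_distrib_left)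
  also have "(\<Sum>l\<in>I. \<Sum>i\<in>J. k i *
     (C i (l, 1) * d (l, -1) - C i (l, -1) * d (l, 1) + D i (l, 1) * q (l, -1) - D i (l, -1) * q (l, 1)))
     = (\<Sum>i\<in>J. k i * inter I (D i) (C i) q d)"
    by (subst sum.swap) (simp add: inter_def sum_distrib_left)
  finally show ?thesis .
qed

section \<open>Intersection numbers of loops\<close>

context gauss_code
begin

text \<open>Against the constant flow the form sums the superscripts once over the leaving and once
  over the entering edges of the loop. Each sum is \<open>code_alpha W i\<close> up to the end
  points \<open>(i, 1)\<close> and \<open>(i, -1)\<close>, which cancel.\<close>

lemma alpha_inter:
  assumes "i \<in> I"
  shows "inter I (chord_in W i) (chord_out W i) (\<lambda>_. 1) (\<lambda>_. 1) = 2 * code_alpha W i"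
proof -
  note S = code_S_subset[OF assms]
  have "finite (I \<times> {1, -1 :: int})" using finite by simp
  have sub: "(\<Sum>m\<in>I \<times> {1, -1}. snd m * of_bool (m \<in> T)) = (\<Sum>m\<in>T. snd m)" if "T \<subseteq> I \<times> {1, -1 :: int}" for T
    using that \<open>finite (I \<times> {1, -1 :: int})\<close> by (intro sum.mono_neutral_cong_right) auto
  have fS: "finite (code_S W i)" using S \<open>finite (I \<times> {1, -1 :: int})\<close> by (meson finite_Diff finite_subset)
  have "inter I (chord_in W i) (chord_out W i) (\<lambda>_. 1) (\<lambda>_. 1) =
    (\<Sum>m\<in>I \<times> {1, -1}. snd m * of_bool (m \<in> insert (i, 1) (code_S W i))) +
    (\<Sum>m\<in>I \<times> {1, -1}. snd m * of_bool (m \<in> insert (i, -1) (code_S W i)))"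
    using finite by (subst inter_symbols) (auto simp: chord_in_def chord_out_def sum.distrib algebra_simps)
  also have "\<dots> = (\<Sum>m\<in>insert (i, 1) (code_S W i). snd m) + (\<Sum>m\<in>insert (i, -1) (code_S W i). snd m)"
    using S assms by (intro arg_cong2[where f = plus] sub) auto
  also have "\<dots> = 2 * code_alpha W i"
    using S fS by (subst (1 2) sum.insert) (auto simp: code_alpha_def)
  finally show ?thesis .
qed

text \<open>On the stretch from \<open>(i, 1)\<close> to \<open>(i, -1)\<close> the coefficient of
  the loop at \<open>j\<close> changes only at the symbols of \<open>j\<close>. The sum of these
  jumps telescopes to the difference between the coefficients on the last and the first edge of the
  stretch.\<close>

lemma interlacing:
  assumes "i \<in> I" and "j \<in> I"
  shows "of_bool ((j, 1) \<in> code_S W i) - of_bool ((j, -1) \<in> code_S W i) =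
    (of_bool ((i, -1) \<in> code_S W j) - of_bool ((i, 1) \<in> code_S W j) :: int)"
proof (cases "i = j")
  case True
  have "(i, 1) \<notin> code_S W i" "(i, -1) \<notin> code_S W i" using code_S_subset[OF assms(1)] by blast+
  with True show ?thesis by simp
next
  case False
  obtain A B where
    cf: "\<And>p c. cyclic_flow p c W \<longleftrightarrow> cyclic_flow p c ((i, 1) # A @ (i, -1) # B)"
    and S: "code_S W i = set A" and d: "distinct ((i, 1) # A @ (i, -1) # B)"
    and sW: "set ((i, 1) # A @ (i, -1) # B) = set W" by (rule chord_split[OF assms(1)]) blast
  let ?c = "chord_out W j" and ?p = "chord_in W j"
  have "cyclic_flow ?p ?c ((i, 1) # A @ (i, -1) # B)"
    using chord_cyclic_flow[OF assms(2)] cf by simp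
  then have "(?c (i, 1) # map ?c A) @ map ?c ((i, -1) # B) = (map ?p A @ [?p (i, -1)]) @ (map ?p B @ [?p (i, 1)])"
    unfolding cyclic_flow_def by simp
  then have "?c (i, 1) # map ?c A = map ?p A @ [?p (i, -1)]"
    by (subst (asm) append_eq_append_conv) simp_all
  then have "?c (i, 1) + sum_list (map ?c A) = sum_list (map ?p A) + ?p (i, -1)"
    by (metis sum_list.Cons sum_list_append sum_list.Nil add.right_neutral)
  moreover have "sum_list (map f A) = sum f (set A)" for f :: "symbol \<Rightarrow> int"
    using d by (simp add: sum_list_distinct_conv_sum_set)
  ultimately have "?p (i, -1) - ?c (i, 1) = (\<Sum>m\<in>set A. ?c m - ?p m)"
    by (simp add: sum_subtractf)
  also have "\<dots> = (\<Sum>m\<in>set A. if fst m = j then snd m else 0)"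
    by (rule sum.cong[OF refl], rule chord_diff[OF assms(2)]) (use sW set_W in auto)
  also have "\<dots> = (\<Sum>m\<in>set A \<inter> {(j, 1), (j, -1)}. snd m)"
    using sW set_W by (intro sum.mono_neutral_cong_right) auto
  also have "\<dots> = of_bool ((j, 1) \<in> set A) - of_bool ((j, -1) \<in> set A)"
    by (cases "(j, 1) \<in> set A"; cases "(j, -1) \<in> set A") (auto simp: Int_insert_right)
  finally show ?thesis using False S by (simp add: chord_out_def chord_in_def)
qed

text \<open>Expanding the products of indicator functions gives twice the sum that defines
  \<open>code_beta\<close>, plus terms in which an end point of one loop is tested for membership in
  the other. By \<open>interlacing\<close> the latter add up to 0.\<close>

lemma beta_inter:
  assumes "i \<in> I" and "j \<in> I"
  shows "inter I (chord_in W i) (chord_out W i) (chord_in W j) (chord_out W j) = 2 * code_beta W i j"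
proof -
  define M where "M = I \<times> {1, -1 :: int}"
  have fM: "finite M" using finite by (simp add: M_def)
  define s where "s m = (of_bool (m \<in> code_S W i) :: int)" for m
  define t where "t m = (of_bool ((fst m, - snd m) \<in> code_S W j) :: int)" for m
  define \<delta> where "\<delta> x m = (of_bool (m = x) :: int)" for x m :: symbol
  note S = code_S_subset[OF assms(1)] code_S_subset[OF assms(2)]
  have co: "chord_out W i m = s m + \<delta> (i, 1) m" "chord_in W i m = s m + \<delta> (i, -1) m" for m
    using S(1) by (auto simp: chord_out_def chord_in_def s_def \<delta>_def)
  have cj: "chord_out W j (fst m, - snd m) = t m + \<delta> (j, -1) m"
    "chord_in W j (fst m, - snd m) = t m + \<delta> (j, 1) m" for m
    using S(2) by (cases m; auto simp: chord_out_def chord_in_def t_def \<delta>_def)+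
  have D: "(\<Sum>m\<in>M. \<delta> x m * f m) = f x" if "x \<in> M" for x and f :: "symbol \<Rightarrow> int"
  proof -
    have "(\<Sum>m\<in>M. \<delta> x m * f m) = (\<Sum>m\<in>M. if m = x then f m else 0)"
      by (rule sum.cong) (auto simp: \<delta>_def)
    then show ?thesis using that by (simp add: sum.delta[OF fM])
  qed
  have inM: "(i, 1) \<in> M" "(i, -1) \<in> M" "(j, 1) \<in> M" "(j, -1) \<in> M" using assms by (auto simp: M_def)
  \<comment> \<open>\<open>a\<close>, \<open>b\<close> stand for the end points of the loop at
    \<open>i\<close>, and \<open>a'\<close>, \<open>b'\<close> for those of the loop at
    \<open>j\<close>. Only the former are put into the leading term; this is the asymmetry of
    \<open>code_beta\<close>, which has \<open>code_S_bar\<close> on one side only.\<close>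
  have "x * ((y + a) * (z + a') + (y + b) * (z + b')) =
     2 * (x * ((y + a + b) * z)) + b' * (x * y) + a' * (x * y) - a * (x * z) - b * (x * z) + x * (a * a') + x * (b * b')"
    for a a' b b' x y z :: int
    by (simp add: algebra_simps)
  note pt_aux = this
  have pt: "snd m * ((s m + \<delta> (i, 1) m) * (t m + \<delta> (j, -1) m) + (s m + \<delta> (i, -1) m) * (t m + \<delta> (j, 1) m))
     = 2 * (snd m * ((s m + \<delta> (i, 1) m + \<delta> (i, -1) m) * t m))
      + \<delta> (j, 1) m * (snd m * s m) + \<delta> (j, -1) m * (snd m * s m)
      - \<delta> (i, 1) m * (snd m * t m) - \<delta> (i, -1) m * (snd m * t m)" for m
  proof -
    have "\<delta> (i, 1) m * \<delta> (j, -1) m = 0" "\<delta> (i, -1) m * \<delta> (j, 1) m = 0"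
      by (auto simp: \<delta>_def)
    then show ?thesis
      unfolding pt_aux by auto
  qed
  have "inter I (chord_in W i) (chord_out W i) (chord_in W j) (chord_out W j) =
    (\<Sum>m\<in>M. snd m * ((s m + \<delta> (i, 1) m) * (t m + \<delta> (j, -1) m) + (s m + \<delta> (i, -1) m) * (t m + \<delta> (j, 1) m)))"
    using finite by (subst inter_symbols) (auto simp: M_def co cj)
  also have "\<dots> = 2 * (\<Sum>m\<in>M. snd m * ((s m + \<delta> (i, 1) m + \<delta> (i, -1) m) * t m))
     + (s (j, 1) - s (j, -1) - t (i, 1) + t (i, -1))"
    unfolding pt sum.distrib sum_subtractf sum_distrib_left[symmetric] D[OF inM(1)] D[OF inM(2)] D[OF inM(3)] D[OF inM(4)]
    by simp
  also have "s (j, 1) - s (j, -1) - t (i, 1) + t (i, -1) = 0"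
    using interlacing[OF assms] by (simp add: s_def t_def)
  also have "(\<Sum>m\<in>M. snd m * ((s m + \<delta> (i, 1) m + \<delta> (i, -1) m) * t m)) =
     (\<Sum>m\<in>M. if m \<in> code_S_bar W i \<inter> code_S_inv W j then snd m else 0)"
  proof (rule sum.cong[OF refl])
    fix m assume "m \<in> M"
    obtain l e where m: "m = (l, e)" by (cases m)
    have "(l, e) \<in> code_S_inv W j \<longleftrightarrow> (l, - e) \<in> code_S W j"
      by (force simp: code_S_inv_def image_iff)
    then show "snd m * ((s m + \<delta> (i, 1) m + \<delta> (i, -1) m) * t m) =
      (if m \<in> code_S_bar W i \<inter> code_S_inv W j then snd m else 0)"
      using S by (auto simp: m s_def t_def \<delta>_def code_S_bar_def)
  qed
  also have "\<dots> = code_beta W i j"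
    unfolding code_beta_def using S assms fM
    by (subst sum.inter_restrict[symmetric]) (auto simp: M_def code_S_bar_def intro!: sum.cong)
  finally show ?thesis by (simp add: algebra_simps)
qed

text \<open>
  The flows of one word are spanned by the constant flow and the chord flows; \<open>c (i, 1) - p (i, 1)\<close> is
  the coefficient of the chord flow at \<open>i\<close>.  The condition on \<open>I - J\<close> will say that a flow comes
  from the words before merging.
\<close>

theorem planar_lifts_iff:
  assumes "J \<subseteq> I"
  shows "(\<forall>i\<in>J. \<forall>j\<in>J. code_alpha W i = 0 \<and> code_beta W i j = 0) \<longleftrightarrow>
    (\<forall>p c q d. flow {#W#} I p c \<and> flow {#W#} I q d \<and> (\<forall>i\<in>I - J. c (i, 1) = p (i, 1) \<and> d (i, 1) = q (i, 1)) \<longrightarrow>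
       inter I p c q d = 0)" (is "?L \<longleftrightarrow> ?R")
proof
  assume L: ?L
  show ?R
  proof (intro allI impI)
    fix p c q d
    assume A: "flow {#W#} I p c \<and> flow {#W#} I q d \<and> (\<forall>i\<in>I - J. c (i, 1) = p (i, 1) \<and> d (i, 1) = q (i, 1))"
    have fJ: "finite J" using assms finite finite_subset by blast
    have red: "\<exists>a k. (\<forall>m\<in>I \<times> {1, -1}. c m = a + (\<Sum>i\<in>J. k i * chord_out W i m)) \<and>
       (\<forall>m\<in>I \<times> {1, -1}. p m = a + (\<Sum>i\<in>J. k i * chord_in W i m))"
      if f: "flow {#W#} I p c" and z: "\<forall>i\<in>I - J. c (i, 1) = p (i, 1)" for p c
    proof -
      have *: "(\<Sum>i\<in>I. (c (i, 1) - p (i, 1)) * h i) = (\<Sum>i\<in>J. (c (i, 1) - p (i, 1)) * h i)" for h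
        by (rule sum.mono_neutral_right) (use finite assms z in auto)
      obtain a
        where "\<And>m. m \<in> I \<times> {1, -1} \<Longrightarrow> c m = a + (\<Sum>i\<in>I. (c (i, 1) - p (i, 1)) * chord_out W i m)"
          "\<And>m. m \<in> I \<times> {1, -1} \<Longrightarrow> p m = a + (\<Sum>i\<in>I. (c (i, 1) - p (i, 1)) * chord_in W i m)" by (rule flow_decomp[OF f]) blast
      then show ?thesis unfolding * by (intro exI[of _ a] exI[of _ "\<lambda>i. c (i, 1) - p (i, 1)"]) auto
    qed
    from red A obtain a k where ak: "\<forall>m\<in>I \<times> {1, -1}. c m = a + (\<Sum>i\<in>J. k i * chord_out W i m)"
       "\<forall>m\<in>I \<times> {1, -1}. p m = a + (\<Sum>i\<in>J. k i * chord_in W i m)" by blast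
    from red A obtain b l where bl: "\<forall>m\<in>I \<times> {1, -1}. d m = b + (\<Sum>i\<in>J. l i * chord_out W i m)"
       "\<forall>m\<in>I \<times> {1, -1}. q m = b + (\<Sum>i\<in>J. l i * chord_in W i m)" by blast
    have one: "inter I (\<lambda>_. 1) (\<lambda>_. 1) (\<lambda>_. 1) (\<lambda>_. 1) = 0" by (simp add: inter_def)
    have al: "inter I (chord_in W i) (chord_out W i) (\<lambda>_. 1) (\<lambda>_. 1) = 0" if "i \<in> J" for i
      using alpha_inter[of i] L that assms by auto
    have be: "inter I (chord_in W i) (chord_out W i) (chord_in W j) (chord_out W j) = 0" if "i \<in> J" "j \<in> J" for i j
      using beta_inter[of i j] L that assms by auto
    have e2: "inter I q d x y = b * inter I (\<lambda>_. 1) (\<lambda>_. 1) x y + (\<Sum>i\<in>J. l i * inter I (chord_in W i) (chord_out W i) x y)" for x y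
      by (rule inter_expand[OF fJ]) (use bl in auto)
    have z1: "inter I (\<lambda>_. 1) (\<lambda>_. 1) q d = 0"
      by (subst inter_antisym, subst e2) (simp add: one al)
    have z2: "inter I (chord_in W i) (chord_out W i) q d = 0" if "i \<in> J" for i
    proof (subst inter_antisym, subst e2)
      show "- (b * inter I (\<lambda>_. 1) (\<lambda>_. 1) (chord_in W i) (chord_out W i) +
        (\<Sum>ia\<in>J. l ia * inter I (chord_in W ia) (chord_out W ia) (chord_in W i) (chord_out W i))) = 0"
        using that by (subst inter_antisym) (simp add: al be)
    qed
    have "inter I p c q d = a * inter I (\<lambda>_. 1) (\<lambda>_. 1) q d + (\<Sum>i\<in>J. k i * inter I (chord_in W i) (chord_out W i) q d)"
      by (rule inter_expand[OF fJ]) (use ak in auto)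
    then show "inter I p c q d = 0" by (simp add: z1 z2)
  qed
next
  assume R: ?R
  have one: "flow {#W#} I (\<lambda>_. 1) (\<lambda>_. 1)"
    by (simp add: flow_def cyclic_flow_def map_replicate_const rotate1_replicate)
  have k: "chord_out W i (l, 1) = chord_in W i (l, 1)" if "i \<in> J" "l \<in> I - J" for i l
    using chord_diff[of i "(l, 1)"] that assms by (auto split: if_splits)
  show ?L
  proof (intro ballI conjI)
    fix i j assume ij: "i \<in> J" "j \<in> J"
    then have "inter I (chord_in W i) (chord_out W i) (\<lambda>_. 1) (\<lambda>_. 1) = 0"
      using assms by (intro R[rule_format] conjI ballI chord_flow k one) auto
    then show "code_alpha W i = 0" using alpha_inter[of i] ij assms by auto
    have "inter I (chord_in W i) (chord_out W i) (chord_in W j) (chord_out W j) = 0"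
      using ij assms by (intro R[rule_format] conjI ballI chord_flow k) auto
    then show "code_beta W i j = 0" using beta_inter[of i j] ij assms by auto
  qed
qed

end

section \<open>Merging words\<close>

text \<open>This is \<open>to_symbol\<close> with the signs supplied by a function instead of being
  read off one word, so that it applies to all stages of the merging alike.\<close>

fun lsym :: "(nat \<Rightarrow> sign) \<Rightarrow> letter \<Rightarrow> symbol" where
  "lsym e (Under i s) = (i, sign_val s)"
| "lsym e (Over i) = (i, - sign_val (e i))"

definition flat :: "(nat \<Rightarrow> sign) \<Rightarrow> letter list multiset \<Rightarrow> symbol list multiset" where
  "flat e P = image_mset (map (lsym e)) P"

text \<open>The condition on the letters for an arbitrary finite index set, so that it survives the
  introduction of new indices; \<open>e i\<close> is the sign of crossing \<open>i\<close>.\<close>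

definition well :: "(nat \<Rightarrow> sign) \<Rightarrow> nat set \<Rightarrow> letter list multiset \<Rightarrow> bool" where
  "well e I P \<longleftrightarrow> finite I \<and> (\<forall>x. count (letters P) x = of_bool (x \<in> Over ` I \<union> (\<lambda>i. Under i (e i)) ` I))"

lemma letters_add_mset [simp]: "letters (add_mset u P) = mset u + letters P"
  and letters_empty [simp]: "letters {#} = {#}"
  and letters_plus [simp]: "letters (P + P') = letters P + letters P'"
  by (simp_all add: letters_def)

lemma in_letters_iff: "x \<in># letters P \<longleftrightarrow> (\<exists>u\<in>#P. x \<in> set u)"
  by (auto simp: letters_def)

lemma indices_letters: "i \<in> indices P \<longleftrightarrow> (\<exists>x\<in>#letters P. letter_index x = i)"
  by (auto simp: indices_def)

lemma well_letters: "well e I P \<Longrightarrow> set_mset (letters P) = Over ` I \<union> (\<lambda>i. Under i (e i)) ` I"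
  by (auto simp: well_def set_mset_def)

lemma well_indices: "well e I P \<Longrightarrow> indices P = I"
  by (auto simp: indices_def well_letters image_Un image_image)

text \<open>
  A step merges at an index that is not \<open>together\<close>.  Since the two letters of a new index stay in one
  word for ever, later steps merge at original indices only.
\<close>

definition together :: "(nat \<Rightarrow> sign) \<Rightarrow> letter list multiset \<Rightarrow> nat \<Rightarrow> bool" where
  "together e P k \<longleftrightarrow> (\<forall>u\<in>#P. Over k \<in> set u \<longleftrightarrow> Under k (e k) \<in> set u)"

lemma merge_step_letters: "merge_step P P' \<Longrightarrow> letters P \<subseteq># letters P'"
  by (induction rule: merge_step.induct) (auto simp: subseteq_mset_def)

text \<open>With both words rotated to begin at \<open>i\<close>, the step replaces the cyclic words
  \<open>a U\<close> and \<open>b V\<close> by \<open>a a' V b b' U\<close>, where \<open>a\<close>,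
  \<open>b\<close> are the symbols of \<open>i\<close> and \<open>a'\<close>, \<open>b'\<close>
  those of \<open>j\<close>. Nothing else about the step is used for flows.\<close>

lemma merge_step_flat:
  assumes "merge_step P P'" and "well e I P" and cons: "\<And>i s. Under i s \<in># letters P' \<Longrightarrow> s = e i"
  obtains i j U V M where "i \<in> I" and "j \<notin> I" and "e j = e i" and "well e (insert j I) P'"
    and "\<not> together e P i" and "together e P' j"
    and "\<And>k. together e P k \<Longrightarrow> together e P' k"
    and "\<And>p c. (\<forall>u\<in>#flat e P. cyclic_flow p c u) \<longleftrightarrow> cyclic_flow p c ((i, - sign_val (e i)) # U) \<and>
          cyclic_flow p c ((i, sign_val (e i)) # V) \<and> (\<forall>u\<in>#M. cyclic_flow p c u)"
    and "\<And>p c. (\<forall>u\<in>#flat e P'. cyclic_flow p c u) \<longleftrightarrow> cyclic_flow p c ((i, - sign_val (e i)) # (j, sign_val (e i))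
          # V @ (i, sign_val (e i)) # (j, - sign_val (e i)) # U) \<and> (\<forall>u\<in>#M. cyclic_flow p c u)"
    and "\<And>x. x \<in> set U \<union> set V \<union> \<Union> (set ` set_mset M) \<Longrightarrow> x \<in> (I - {i}) \<times> {1, -1}"
  using assms(1)
proof cases
  case (merge u u1 i u2 v v1 s v2 j M)
  have "Under i s \<in># letters P'" "Under j s \<in># letters P'" by (simp_all add: merge)
  then have s: "s = e i" and ej: "e j = s" using cons by auto
  have ind: "indices P = I" using well_indices[OF assms(2)] .
  have jI: "j \<notin> I" using merge(5) ind merge(1) by simp
  have cnt: "count (letters P) x = of_bool (x \<in> Over ` I \<union> (\<lambda>i. Under i (e i)) ` I)" for x
    using assms(2) by (simp add: well_def)
  have lP: "letters P = mset u1 + mset u2 + {#Over i#} + mset v1 + mset v2 + {#Under i s#} + letters M"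
    by (simp add: merge)
  have iI: "i \<in> I" using ind lP by (auto simp: indices_def)
  have "count (mset u1 + mset u2 + mset v1 + mset v2 + letters M) (Over i) = 0"
    using cnt[of "Over i"] lP iI by simp
  then have O: "Over i \<notin> set u1" "Over i \<notin> set u2" "Over i \<notin> set v1" "Over i \<notin> set v2" "Over i \<notin># letters M"
    by (simp_all add: count_eq_zero_iff count_mset_0_iff)
  have "count (mset u1 + mset u2 + mset v1 + mset v2 + letters M) (Under i s) = 0"
    using cnt[of "Under i s"] lP iI s by simp
  then have Uu: "Under i s \<notin> set v1" "Under i s \<notin> set v2" "Under i s \<notin> set u1" "Under i s \<notin> set u2" "Under i s \<notin># letters M"
    by (simp_all add: count_eq_zero_iff count_mset_0_iff)
  define U where "U = map (lsym e) (u2 @ u1)"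
  define V where "V = map (lsym e) (v2 @ v1)"
  let ?a = "(i, - sign_val (e i))" and ?b = "(i, sign_val (e i))"
  have sl: "set_mset (letters P) = Over ` I \<union> (\<lambda>i. Under i (e i)) ` I" using well_letters[OF assms(2)] .
  have rest: "lsym e x \<in> (I - {i}) \<times> {1, -1}" if "x \<in> set u1 \<union> set u2 \<union> set v1 \<union> set v2 \<or> x \<in># letters M" for x
  proof -
    from that have "x \<in># letters P" using lP by auto
    then have "x \<in> Over ` I \<union> (\<lambda>i. Under i (e i)) ` I" using sl by simp
    moreover have "x \<noteq> Over i" "x \<noteq> Under i (e i)" using O Uu that s by auto
    moreover have "sign_val y \<in> {1, -1}" "- sign_val y \<in> {1, -1}" for y by (cases y; simp)+
    ultimately show ?thesis by auto
  qed
  show ?thesis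
  proof (rule that[of i j U V "flat e M"])
    show "i \<in> I" "j \<notin> I" "e j = e i" by fact+ (use ej s in simp)
    show "well e (insert j I) P'"
      unfolding well_def
    proof (intro conjI allI)
      show "finite (insert j I)" using assms(2) by (simp add: well_def)
      fix x
      have "count (letters P') x = count (letters P) x + of_bool (x = Over j) + of_bool (x = Under j s)"
        by (simp add: merge)
      then show "count (letters P') x = of_bool (x \<in> Over ` insert j I \<union> (\<lambda>i. Under i (e i)) ` insert j I)"
        using cnt[of x] jI ej by auto
    qed
    show "\<not> together e P i" using Uu s by (simp add: together_def merge)
    have nj: "x \<notin> set w" if "w \<in># P" "letter_index x = j" for x w
      using jI ind that by (metis in_letters_iff indices_letters)
    show "together e P' j"
      using nj[of _ "Over j"] nj[of _ "Under j s"] ej by (auto simp: together_def merge)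
    show "together e P' k" if k: "together e P k" for k
    proof (cases "k = j")
      case False
      then show ?thesis using k s by (auto simp: together_def merge)
    qed (use \<open>together e P' j\<close> in simp)
    show "(\<forall>u\<in>#flat e P. cyclic_flow p c u) \<longleftrightarrow> cyclic_flow p c (?a # U) \<and>
          cyclic_flow p c (?b # V) \<and> (\<forall>u\<in>#flat e M. cyclic_flow p c u)" for p c
    proof -
      have "cyclic_flow p c (map (lsym e) u) \<longleftrightarrow> cyclic_flow p c (?a # U)"
        using cyclic_flow_append_swap[of p c "map (lsym e) u1" "?a # map (lsym e) u2"] by (simp add: U_def merge)
      moreover have "cyclic_flow p c (map (lsym e) v) \<longleftrightarrow> cyclic_flow p c (?b # V)"
        using cyclic_flow_append_swap[of p c "map (lsym e) v1" "?b # map (lsym e) v2"] s by (simp add: V_def merge)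
      ultimately show ?thesis by (simp add: flat_def merge)
    qed
    show "(\<forall>u\<in>#flat e P'. cyclic_flow p c u) \<longleftrightarrow> cyclic_flow p c (?a # (j, sign_val (e i)) # V @ ?b #
        (j, - sign_val (e i)) # U) \<and> (\<forall>u\<in>#flat e M. cyclic_flow p c u)" for p c
      using cyclic_flow_append_swap[of p c "map (lsym e) u1" "?a # (j, sign_val (e i)) # V @ ?b #
        (j, - sign_val (e i)) # map (lsym e) u2"] s ej by (simp add: U_def V_def flat_def merge)
    show "x \<in> (I - {i}) \<times> {1, -1}" if "x \<in> set U \<union> set V \<union> \<Union> (set ` set_mset (flat e M))" for x
      using that rest unfolding U_def V_def flat_def by (auto simp: in_letters_iff)
  qed
qed

text \<open>Geometrically the two edges leaving crossing \<open>i\<close> are made to cross once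
  more, at \<open>j\<close>, before they go on to \<open>U\<close> and \<open>V\<close>. Forgetting
  the two edges of this bigon maps new flows to old ones; conversely an old flow lifts to one that
  goes straight through \<open>j\<close>. Both maps preserve \<open>inter\<close>.\<close>

lemma merge_step_flows:
  assumes "merge_step P P'" and "well e I P" and "\<And>i s. Under i s \<in># letters P' \<Longrightarrow> s = e i"
  obtains i j where "i \<in> I" and "j \<notin> I" and "well e (insert j I) P'"
    and "\<not> together e P i" and "together e P' j" and "\<And>k. together e P k \<Longrightarrow> together e P' k"
    and "planar (flat e P) I \<Longrightarrow> planar (flat e P') (insert j I)"
    and "\<And>p c q d. \<lbrakk>flow (flat e P) I p c; flow (flat e P) I q d\<rbrakk> \<Longrightarrow>
      \<exists>p' c' q' d'. flow (flat e P') (insert j I) p' c' \<and> flow (flat e P') (insert j I) q' d' \<and>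
        inter (insert j I) p' c' q' d' = inter I p c q d \<and>
        (\<forall>k\<in>insert j I - {i}. c' (k, 1) - p' (k, 1) = (if k = j then 0 else c (k, 1) - p (k, 1)) \<and>
            d' (k, 1) - q' (k, 1) = (if k = j then 0 else d (k, 1) - q (k, 1)))"
proof -
  obtain i j U V M where ij: "i \<in> I" "j \<notin> I" "e j = e i" "well e (insert j I) P'"
    and tog: "\<not> together e P i" "together e P' j" "\<And>k. together e P k \<Longrightarrow> together e P' k"
    and old: "\<And>p c. (\<forall>u\<in>#flat e P. cyclic_flow p c u) \<longleftrightarrow> cyclic_flow p c ((i, - sign_val (e i)) # U) \<and>
          cyclic_flow p c ((i, sign_val (e i)) # V) \<and> (\<forall>u\<in>#M. cyclic_flow p c u)"
    and new: "\<And>p c. (\<forall>u\<in>#flat e P'. cyclic_flow p c u) \<longleftrightarrow> cyclic_flow p c ((i, - sign_val (e i)) # (j, sign_val (e i))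
          # V @ (i, sign_val (e i)) # (j, - sign_val (e i)) # U) \<and> (\<forall>u\<in>#M. cyclic_flow p c u)"
    and rest: "\<And>x. x \<in> set U \<union> set V \<union> \<Union> (set ` set_mset M) \<Longrightarrow> x \<in> (I - {i}) \<times> {1, -1}"
    by (rule merge_step_flat[OF assms]) (assumption, (rule that; assumption))
  define s where "s = sign_val (e i)"
  have s1: "s = 1 \<or> s = -1" by (cases "e i") (auto simp: s_def)
  let ?a = "(i, - s)" and ?b = "(i, s)" and ?a' = "(j, s)" and ?b' = "(j, - s)"
  have fI: "finite I" using assms(2) by (simp add: well_def)
  have agree: "cyclic_flow p' c' u \<longleftrightarrow> cyclic_flow p c u"
    if "u \<in># M" and "\<And>x. fst x \<in> I - {i} \<Longrightarrow> p' x = p x \<and> c' x = c x" for p' c' p c u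
    by (rule cyclic_flow_cong) (use that rest in fastforce)
  have UV: "map f U = map g U \<and> map f V = map g V" if "\<And>x. fst x \<in> I - {i} \<Longrightarrow> f x = g x" for f g :: "symbol \<Rightarrow> int"
    using that rest by (fastforce intro!: map_cong)
  have newI: "flow (flat e P') (insert j I) p c \<longleftrightarrow>
     c ?a = p ?a' \<and> c ?a' # map c V = map p V @ [p ?b] \<and> c ?b = p ?b' \<and> c ?b' # map c U = map p U @ [p ?a] \<and>
     (\<forall>u\<in>#M. cyclic_flow p c u) \<and> (\<forall>k\<in>insert j I. c (k, 1) + c (k, -1) = p (k, 1) + p (k, -1))" for p c
  proof -
    have "cyclic_flow p c (?a # ?a' # V @ ?b # ?b' # U) \<longleftrightarrow>
      c ?a # (c ?a' # map c V) @ (c ?b # c ?b' # map c U) = p ?a' # (map p V @ [p ?b]) @ (p ?b' # map p U @ [p ?a])"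
      by (simp add: cyclic_flow_def)
    also have "\<dots> \<longleftrightarrow> c ?a = p ?a' \<and> c ?a' # map c V = map p V @ [p ?b] \<and> c ?b = p ?b' \<and> c ?b' # map c U = map p U @ [p ?a]"
      by (subst list.inject, subst append_eq_append_conv) auto
    finally show ?thesis unfolding flow_def new s_def[symmetric] by blast
  qed
  have oldI: "flow (flat e P) I p c \<longleftrightarrow> c ?b # map c V = map p V @ [p ?b] \<and> c ?a # map c U = map p U @ [p ?a] \<and>
     (\<forall>u\<in>#M. cyclic_flow p c u) \<and> (\<forall>k\<in>I. c (k, 1) + c (k, -1) = p (k, 1) + p (k, -1))" for p c
    unfolding flow_def old s_def[symmetric] by (auto simp: cyclic_flow_def)
  define g where "g p c q d k = c (k, 1) * d (k, -1) - c (k, -1) * d (k, 1)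
      + p (k, 1) * q (k, -1) - p (k, -1) * q (k, 1)" for p c q d :: "symbol \<Rightarrow> int" and k
  have int_eq: "inter (insert j I) p' c' q' d' = inter I p c q d"
    if "g p' c' q' d' i + g p' c' q' d' j = g p c q d i"
      and "\<And>x. fst x \<in> I - {i} \<Longrightarrow> p' x = p x \<and> c' x = c x \<and> q' x = q x \<and> d' x = d x" for p' c' q' d' p c q d
  proof -
    have "inter (insert j I) p' c' q' d' = (\<Sum>k\<in>insert j (insert i (I - {i})). g p' c' q' d' k)"
      using ij by (simp add: inter_def g_def insert_absorb)
    also have "\<dots> = g p' c' q' d' j + g p' c' q' d' i + (\<Sum>k\<in>I - {i}. g p' c' q' d' k)"
      using ij fI by (subst sum.insert; (subst sum.insert)?) auto
    also have "(\<Sum>k\<in>I - {i}. g p' c' q' d' k) = (\<Sum>k\<in>I - {i}. g p c q d k)"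
      by (rule sum.cong) (use that(2) in \<open>auto simp: g_def\<close>)
    also have "g p' c' q' d' j + g p' c' q' d' i + (\<Sum>k\<in>I - {i}. g p c q d k) = (\<Sum>k\<in>insert i (I - {i}). g p c q d k)"
      using fI that(1) by (subst sum.insert) auto
    also have "\<dots> = inter I p c q d" using ij by (simp add: inter_def g_def insert_absorb)
    finally show ?thesis .
  qed
  have vs: "c (k, 1) + c (k, -1) = p (k, 1) + p (k, -1) \<longleftrightarrow> c (k, s) + c (k, - s) = p (k, s) + p (k, - s)"
    for c p :: "symbol \<Rightarrow> int" and k
    using s1 by auto
  have gs: "g p c q d k = s * (c (k, s) * d (k, - s) - c (k, - s) * d (k, s)
      + p (k, s) * q (k, - s) - p (k, - s) * q (k, s))" for p c q d k
    using s1 by (auto simp: g_def)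
  have ne: "?a \<noteq> ?b" "?a \<noteq> ?a'" "?a \<noteq> ?b'" "?b \<noteq> ?a'" "?b \<noteq> ?b'" "?a' \<noteq> ?b'" "i \<noteq> j"
    using s1 ij by auto
  show ?thesis
  proof (rule that[OF ij(1,2,4) tog])
    assume pl: "planar (flat e P) I"
    show "planar (flat e P') (insert j I)"
      unfolding planar_def
    proof (intro allI impI)
      fix p c q d
      assume pc: "flow (flat e P') (insert j I) p c" and qd: "flow (flat e P') (insert j I) q d"
      \<comment> \<open>The bigon is collapsed. The edge to \<open>U\<close> left \<open>?a\<close>
        before the step and leaves \<open>?b'\<close> after it; the edge to \<open>V\<close> left
        \<open>?b\<close> and now leaves \<open>?a'\<close>.\<close>
      define C where "C c = c(?a := c ?b', ?b := c ?a')" for c :: "symbol \<Rightarrow> int"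
      have Cv: "C c ?a = c ?b'" "C c ?b = c ?a'" for c
        using ne by (auto simp: C_def)
      have out: "C c x = c x" if "fst x \<in> I - {i}" for c x
        using that by (auto simp: C_def)
      have down: "flow (flat e P) I p (C c)" if f: "flow (flat e P') (insert j I) p c" for p c
      proof -
        have m: "map (C c) U = map c U" "map (C c) V = map c V"
          using UV[of "C c" c] out by auto
        have N: "c ?a = p ?a'" "c ?a' # map c V = map p V @ [p ?b]" "c ?b = p ?b'"
          "c ?b' # map c U = map p U @ [p ?a]" "\<And>u. u \<in># M \<Longrightarrow> cyclic_flow p c u"
          "\<And>k. k \<in> insert j I \<Longrightarrow> c (k, s) + c (k, - s) = p (k, s) + p (k, - s)"
          using f unfolding newI vs by auto
        show ?thesis
          unfolding oldI vs
        proof (intro conjI ballI)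
          show "C c ?b # map (C c) V = map p V @ [p ?b]" using N(2) by (simp only: m Cv)
          show "C c ?a # map (C c) U = map p U @ [p ?a]" using N(4) by (simp only: m Cv)
          show "cyclic_flow p (C c) u" if "u \<in># M" for u
            using agree[OF that, of p p "C c" c] N(5)[OF that] out by blast
          show "C c (k, s) + C c (k, - s) = p (k, s) + p (k, - s)" if "k \<in> I" for k
          proof (cases "k = i")
            case True
            show ?thesis using N(1,3) N(6)[of i] N(6)[of j] ij(1) unfolding True Cv by simp
          next
            case False
            then show ?thesis using that N(6)[of k] out[of "(k, s)" c] out[of "(k, - s)" c] by simp
          qed
        qed
      qed
      have "inter I p (C c) q (C d) = 0" using pl down[OF pc] down[OF qd] unfolding planar_def by blast
      moreover have "inter (insert j I) p c q d = inter I p (C c) q (C d)"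
      proof (rule int_eq)
        \<comment> \<open>An edge of the bigon leaves \<open>i\<close> and enters \<open>j\<close>
          with opposite superscripts, so the leaving terms at \<open>i\<close> cancel the entering
          terms at \<open>j\<close>.\<close>
        have *: "c ?a = p ?a'" "c ?b = p ?b'" "d ?a = q ?a'" "d ?b = q ?b'" using pc qd unfolding newI by blast+
        show "g p c q d i + g p c q d j = g p (C c) q (C d) i"
          unfolding gs Cv * by (simp add: algebra_simps)
      qed (use out in auto)
      ultimately show "inter (insert j I) p c q d = 0" by simp
    qed
  next
    fix p c q d
    assume pc: "flow (flat e P) I p c" and qd: "flow (flat e P) I q d"
    \<comment> \<open>The bigon edge from \<open>?a\<close> to \<open>?a'\<close> continues to
      \<open>V\<close> and therefore carries the old coefficient \<open>c ?b\<close>; likewise the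
      other one carries \<open>c ?a\<close>. At \<open>j\<close> the entering and leaving
      coefficients agree, so there is no jump.\<close>
    define C where "C c = c(?a := c ?b, ?b := c ?a, ?a' := c ?b, ?b' := c ?a)" for c :: "symbol \<Rightarrow> int"
    define Q where "Q p c = p(?a' := c ?b, ?b' := c ?a)" for p c :: "symbol \<Rightarrow> int"
    have Cv: "C c ?a = c ?b" "C c ?b = c ?a" "C c ?a' = c ?b" "C c ?b' = c ?a" for c
      using ne by (auto simp: C_def)
    have Qv: "Q p c ?a = p ?a" "Q p c ?b = p ?b" "Q p c ?a' = c ?b" "Q p c ?b' = c ?a" for p c
      using ne by (auto simp: Q_def)
    have out: "C c x = c x \<and> Q p c x = p x" if "fst x \<in> I - {i}" for c p x
      using that ij by (auto simp: C_def Q_def)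
    have up: "flow (flat e P') (insert j I) (Q p c) (C c)" if f: "flow (flat e P) I p c" for p c
    proof -
      have m: "map (C c) U = map c U" "map (C c) V = map c V" "map (Q p c) U = map p U" "map (Q p c) V = map p V"
        using UV[of "C c" c] UV[of "Q p c" p] out by auto
      have N: "c ?b # map c V = map p V @ [p ?b]" "c ?a # map c U = map p U @ [p ?a]"
        "\<And>u. u \<in># M \<Longrightarrow> cyclic_flow p c u"
        "\<And>k. k \<in> I \<Longrightarrow> c (k, s) + c (k, - s) = p (k, s) + p (k, - s)"
        using f unfolding oldI vs by auto
      show ?thesis
        unfolding newI vs
      proof (intro conjI ballI)
        show "C c ?a' # map (C c) V = map (Q p c) V @ [Q p c ?b]" using N(1) by (simp only: m Cv Qv)
        show "C c ?b' # map (C c) U = map (Q p c) U @ [Q p c ?a]" using N(2) by (simp only: m Cv Qv)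
        show "C c ?a = Q p c ?a'" "C c ?b = Q p c ?b'" by (simp_all only: Cv Qv)
        show "cyclic_flow (Q p c) (C c) u" if "u \<in># M" for u
          using agree[OF that, of "Q p c" p "C c" c] N(3)[OF that] out by blast
        show "C c (k, s) + C c (k, - s) = Q p c (k, s) + Q p c (k, - s)" if "k \<in> insert j I" for k
        proof (cases "k = i")
          case True
          show ?thesis using N(4)[of i] ij(1) unfolding True Cv Qv by simp
        next
          case False
          show ?thesis
          proof (cases "k = j")
            case True
            show ?thesis unfolding True Cv Qv by simp
          next
            case False
            then show ?thesis using that \<open>k \<noteq> i\<close> N(4)[of k] out[of "(k, s)" c p] out[of "(k, - s)" c p] by simp
          qed
        qed
      qed
    qed
    show "\<exists>p' c' q' d'. flow (flat e P') (insert j I) p' c' \<and> flow (flat e P') (insert j I) q' d' \<and>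
        inter (insert j I) p' c' q' d' = inter I p c q d \<and>
        (\<forall>k\<in>insert j I - {i}. c' (k, 1) - p' (k, 1) = (if k = j then 0 else c (k, 1) - p (k, 1)) \<and>
            d' (k, 1) - q' (k, 1) = (if k = j then 0 else d (k, 1) - q (k, 1)))"
    proof (intro exI conjI)
      show "flow (flat e P') (insert j I) (Q p c) (C c)" "flow (flat e P') (insert j I) (Q q d) (C d)"
        using up pc qd by auto
      show "inter (insert j I) (Q p c) (C c) (Q q d) (C d) = inter I p c q d"
      proof (rule int_eq)
        show "g (Q p c) (C c) (Q q d) (C d) i + g (Q p c) (C c) (Q q d) (C d) j = g p c q d i"
          unfolding gs Cv Qv by (simp add: algebra_simps)
      qed (use out in auto)
      show "\<forall>k\<in>insert j I - {i}. C c (k, 1) - Q p c (k, 1) = (if k = j then 0 else c (k, 1) - p (k, 1)) \<and>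
            C d (k, 1) - Q q d (k, 1) = (if k = j then 0 else d (k, 1) - q (k, 1))"
      proof
        fix k assume k: "k \<in> insert j I - {i}"
        show "C c (k, 1) - Q p c (k, 1) = (if k = j then 0 else c (k, 1) - p (k, 1)) \<and>
            C d (k, 1) - Q q d (k, 1) = (if k = j then 0 else d (k, 1) - q (k, 1))"
        proof (cases "k = j")
          case True
          have "C c (j, 1) = Q p c (j, 1)" for c p using s1 Cv(3,4) Qv(3,4) by (metis minus_minus)
          then show ?thesis using True by simp
        next
          case False
          then show ?thesis using k out[of "(k, 1)"] by simp
        qed
      qed
    qed
  qed
qed

lemma merge_steps_flows:
  assumes "merge_step\<^sup>*\<^sup>* P P'" and "well e I P" and "\<And>i s. Under i s \<in># letters P' \<Longrightarrow> s = e i"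
  shows "\<exists>I'. I \<subseteq> I' \<and> well e I' P' \<and> (\<forall>k\<in>I' - I. together e P' k) \<and>
    (planar (flat e P) I \<longrightarrow> planar (flat e P') I') \<and>
    (\<forall>p c q d. flow (flat e P) I p c \<longrightarrow> flow (flat e P) I q d \<longrightarrow>
      (\<exists>p' c' q' d'. flow (flat e P') I' p' c' \<and> flow (flat e P') I' q' d' \<and>
        inter I' p' c' q' d' = inter I p c q d \<and>
        (\<forall>k\<in>I' - I. c' (k, 1) = p' (k, 1) \<and> d' (k, 1) = q' (k, 1))))"
  using assms(1,3)
proof (induction rule: rtranclp_induct)
  case base
  then show ?case using assms(2) by (intro exI[of _ I]) auto
next
  case (step Y Z)
  have "Under i s \<in># letters Y \<Longrightarrow> s = e i" for i s
    using step.prems merge_step_letters[OF step.hyps(2)] by (meson mset_subset_eqD)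
  from step.IH[OF this] obtain I' where I': "I \<subseteq> I'" "well e I' Y" "\<forall>k\<in>I' - I. together e Y k"
    "planar (flat e P) I \<longrightarrow> planar (flat e Y) I'"
    and lift: "\<And>p c q d. flow (flat e P) I p c \<Longrightarrow> flow (flat e P) I q d \<Longrightarrow>
      (\<exists>p' c' q' d'. flow (flat e Y) I' p' c' \<and> flow (flat e Y) I' q' d' \<and>
        inter I' p' c' q' d' = inter I p c q d \<and>
        (\<forall>k\<in>I' - I. c' (k, 1) = p' (k, 1) \<and> d' (k, 1) = q' (k, 1)))" by blast
  show ?case
  proof (rule merge_step_flows[OF step.hyps(2) I'(2) step.prems], assumption)
    fix i j
    assume ij: "i \<in> I'" "j \<notin> I'" "well e (insert j I') Z" "\<not> together e Y i" "together e Z j"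
      and tg: "\<And>k. together e Y k \<Longrightarrow> together e Z k"
      and pl: "planar (flat e Y) I' \<Longrightarrow> planar (flat e Z) (insert j I')"
      and lf: "\<And>p c q d. \<lbrakk>flow (flat e Y) I' p c; flow (flat e Y) I' q d\<rbrakk> \<Longrightarrow>
      \<exists>p' c' q' d'. flow (flat e Z) (insert j I') p' c' \<and> flow (flat e Z) (insert j I') q' d' \<and>
        inter (insert j I') p' c' q' d' = inter I' p c q d \<and>
        (\<forall>k\<in>insert j I' - {i}. c' (k, 1) - p' (k, 1) = (if k = j then 0 else c (k, 1) - p (k, 1)) \<and>
            d' (k, 1) - q' (k, 1) = (if k = j then 0 else d (k, 1) - q (k, 1)))"
    \<comment> \<open>Lifting controls the jumps at all indices except the one at which the words
      are merged. This one must be original, for otherwise a vanishing jump at an earlier new index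
      could be lost.\<close>
    have iI: "i \<in> I" using ij I' by blast
    show ?thesis
    proof (intro exI[of _ "insert j I'"] conjI allI impI)
      show "I \<subseteq> insert j I'" "well e (insert j I') Z" using I' ij by auto
      show "\<forall>k\<in>insert j I' - I. together e Z k" using I' ij tg by auto
      show "planar (flat e P) I \<Longrightarrow> planar (flat e Z) (insert j I')" using I' pl by simp
      fix p c q d
      assume "flow (flat e P) I p c" "flow (flat e P) I q d"
      from lift[OF this] obtain p1 c1 q1 d1 where 1: "flow (flat e Y) I' p1 c1" "flow (flat e Y) I' q1 d1"
        "inter I' p1 c1 q1 d1 = inter I p c q d" "\<forall>k\<in>I' - I. c1 (k, 1) = p1 (k, 1) \<and> d1 (k, 1) = q1 (k, 1)" by blast
      from lf[OF 1(1,2)] obtain p' c' q' d' where 2: "flow (flat e Z) (insert j I') p' c'" "flow (flat e Z) (insert j I') q' d'"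
        "inter (insert j I') p' c' q' d' = inter I' p1 c1 q1 d1"
        and 3: "\<forall>k\<in>insert j I' - {i}. c' (k, 1) - p' (k, 1) = (if k = j then 0 else c1 (k, 1) - p1 (k, 1)) \<and>
            d' (k, 1) - q' (k, 1) = (if k = j then 0 else d1 (k, 1) - q1 (k, 1))" by blast
      have "c' (k, 1) = p' (k, 1) \<and> d' (k, 1) = q' (k, 1)" if "k \<in> insert j I' - I" for k
      proof -
        have "k \<in> insert j I' - {i}" using that iI by auto
        then have "c' (k, 1) - p' (k, 1) = (if k = j then 0 else c1 (k, 1) - p1 (k, 1))"
          "d' (k, 1) - q' (k, 1) = (if k = j then 0 else d1 (k, 1) - q1 (k, 1))" using 3 by blast+
        then show ?thesis using 1(4) that by (auto split: if_splits)
      qed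
      with 1 2 show "\<exists>p' c' q' d'. flow (flat e Z) (insert j I') p' c' \<and> flow (flat e Z) (insert j I') q' d' \<and>
        inter (insert j I') p' c' q' d' = inter I p c q d \<and>
        (\<forall>k\<in>insert j I' - I. c' (k, 1) = p' (k, 1) \<and> d' (k, 1) = q' (k, 1))"
        by (intro exI[of _ p'] exI[of _ c'] exI[of _ q'] exI[of _ d']) auto
    qed
  qed
qed

text \<open>A new index does not occur before its step, so it receives a single sign.\<close>

lemma merge_steps_unique_sign:
  assumes "merge_step\<^sup>*\<^sup>* P P'" and "\<And>i s s'. Under i s \<in># letters P \<Longrightarrow> Under i s' \<in># letters P \<Longrightarrow> s = s'"
  shows "Under i s \<in># letters P' \<Longrightarrow> Under i s' \<in># letters P' \<Longrightarrow> s = s'"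
  using assms(1)
proof (induction arbitrary: i s s' rule: rtranclp_induct)
  case (step Y Z)
  have fresh: "Under j s \<notin># letters Y" if "j \<notin> indices Y" for j s
    using that by (force simp: indices_def)
  from step.hyps(2) show ?case
  proof cases
    case (merge u u1 k u2 v v1 e v2 j M)
    then have Z: "\<And>x. x \<in># letters Z \<longleftrightarrow> x \<in># letters Y \<or> x = Over j \<or> x = Under j e" by auto
    have "j \<notin> indices Y" using merge by simp
    then show ?thesis using step.prems step.IH[of i s s'] fresh[of j] unfolding Z by auto
  qed
qed (use assms(2) in blast)

text \<open>Planarity passes from the paragraph to the final word, hence to those of its flows that
  have no jump at new indices; lifts of flows of the paragraph are among these, which closes the
  circle. The sign function is read off the final word because it has to cover the new indices
  too.\<close>

theorem planar_iff_code:
  assumes "well e0 I P" and "merge_step\<^sup>*\<^sup>* P {#w#}" and "cyclic_eq (map (to_symbol w) w) W"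
  shows "\<exists>e. well e I P \<and> (planar (flat e P) I \<longleftrightarrow> (\<forall>i\<in>I. \<forall>j\<in>I. code_alpha W i = 0 \<and> code_beta W i j = 0))"
proof -
  have sgn0: "s = e0 i" if "Under i s \<in># letters P" for i s
    using well_letters[OF assms(1)] that by auto
  have uni: "s = s'" if "Under i s \<in># letters {#w#}" "Under i s' \<in># letters {#w#}" for i s s'
    using merge_steps_unique_sign[OF assms(2) _ that] sgn0 by metis
  define e where "e i = (THE s. Under i s \<in> set w)" for i
  have e: "s = e i" if "Under i s \<in># letters {#w#}" for i s
    unfolding e_def by (rule the_equality[symmetric]) (use that uni in auto)
  have sub: "letters P \<subseteq># letters {#w#}"
    using assms(2) by (induction rule: rtranclp_induct) (auto dest: merge_step_letters)
  have ee0: "e i = e0 i" if "i \<in> I" for i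
  proof -
    have "Under i (e0 i) \<in># letters P" using well_letters[OF assms(1)] that by auto
    then show ?thesis using e sub by (metis mset_subset_eqD)
  qed
  have wP: "well e I P"
  proof -
    have "(\<lambda>i. Under i (e i)) ` I = (\<lambda>i. Under i (e0 i)) ` I"
      by (rule image_cong) (simp_all add: ee0)
    then show ?thesis using assms(1) unfolding well_def by simp
  qed
  have sym: "to_symbol w x = lsym e x" for x by (cases x) (auto simp: e_def)
  obtain I' where I': "I \<subseteq> I'" "well e I' {#w#}"
    "planar (flat e P) I \<longrightarrow> planar (flat e {#w#}) I'"
    and lift: "\<And>p c q d. flow (flat e P) I p c \<Longrightarrow> flow (flat e P) I q d \<Longrightarrow>
      (\<exists>p' c' q' d'. flow (flat e {#w#}) I' p' c' \<and> flow (flat e {#w#}) I' q' d' \<and>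
        inter I' p' c' q' d' = inter I p c q d \<and>
        (\<forall>k\<in>I' - I. c' (k, 1) = p' (k, 1) \<and> d' (k, 1) = q' (k, 1)))"
    using merge_steps_flows[OF assms(2) wP e] by blast
  define w' where "w' = map (lsym e) w"
  have cw: "count (mset w) x \<le> 1" for x using I'(2) by (simp add: well_def)
  have dw: "distinct w"
    unfolding distinct_count_atmost_1
  proof
    fix x
    show "count (mset w) x = (if x \<in> set w then 1 else 0)"
      using cw[of x] by (auto simp: le_Suc_eq)
  qed
  have sw: "set w = Over ` I' \<union> (\<lambda>i. Under i (e i)) ` I'" using well_letters[OF I'(2)] by simp
  have sv: "sign_val s = 1 \<or> sign_val s = -1" for s by (cases s) auto
  have inj: "inj_on (lsym e) (set w)"
  proof (rule inj_onI)
    fix x y assume "x \<in> set w" "y \<in> set w" "lsym e x = lsym e y"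
    then show "x = y" unfolding sw using sv[of "e (letter_index x)"] by auto
  qed
  have fW: "W = rotate m w' \<Longrightarrow> gauss_code W I'" for m
  proof unfold_locales
    assume W: "W = rotate m w'"
    show "distinct W" using dw inj by (simp add: W w'_def distinct_map)
    have "lsym e ` set w = I' \<times> {1, -1}"
    proof
      show "lsym e ` set w \<subseteq> I' \<times> {1, -1}"
      proof
        fix x assume "x \<in> lsym e ` set w"
        then obtain i where "i \<in> I'" "x = lsym e (Over i) \<or> x = lsym e (Under i (e i))" unfolding sw by auto
        then show "x \<in> I' \<times> {1, -1}" using sv[of "e i"] by auto
      qed
      show "I' \<times> {1, -1} \<subseteq> lsym e ` set w"
      proof
        fix x assume "x \<in> I' \<times> {1, -1 :: int}"
        then obtain i where i: "i \<in> I'" "x = (i, 1) \<or> x = (i, -1)" by auto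
        have "x = lsym e (Over i) \<or> x = lsym e (Under i (e i))" using i sv[of "e i"] by auto
        then show "x \<in> lsym e ` set w" using i unfolding sw by blast
      qed
    qed
    then show "set W = I' \<times> {1, -1}" by (simp add: W w'_def)
    show "finite I'" using I'(2) by (simp add: well_def)
  qed
  from assms(3) obtain m where W: "W = rotate m w'" by (auto simp: cyclic_eq_def sym w'_def cong: map_cong)
  interpret gauss_code W I' by (rule fW[OF W])
  have fl: "flow (flat e {#w#}) I' p c \<longleftrightarrow> flow {#W#} I' p c" for p c
    by (simp add: flow_def flat_def W w'_def cyclic_flow_rotate)
  have crit: "(\<forall>i\<in>I. \<forall>j\<in>I. code_alpha W i = 0 \<and> code_beta W i j = 0) \<longleftrightarrow>
    (\<forall>p c q d. flow {#W#} I' p c \<and> flow {#W#} I' q d \<and> (\<forall>i\<in>I' - I. c (i, 1) = p (i, 1) \<and> d (i, 1) = q (i, 1)) \<longrightarrow>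
       inter I' p c q d = 0)"
    by (rule planar_lifts_iff[OF I'(1)])
  have "planar (flat e P) I \<longleftrightarrow> (\<forall>i\<in>I. \<forall>j\<in>I. code_alpha W i = 0 \<and> code_beta W i j = 0)"
  proof
    assume "planar (flat e P) I"
    with I' have "planar (flat e {#w#}) I'" by simp
    then show "\<forall>i\<in>I. \<forall>j\<in>I. code_alpha W i = 0 \<and> code_beta W i j = 0"
      unfolding crit planar_def fl by blast
  next
    assume R: "\<forall>i\<in>I. \<forall>j\<in>I. code_alpha W i = 0 \<and> code_beta W i j = 0"
    show "planar (flat e P) I"
      unfolding planar_def
    proof (intro allI impI)
      fix p c q d assume "flow (flat e P) I p c" "flow (flat e P) I q d"
      from lift[OF this] obtain p' c' q' d' where "flow {#W#} I' p' c'" "flow {#W#} I' q' d'"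
        "inter I' p' c' q' d' = inter I p c q d"
        "\<forall>k\<in>I' - I. c' (k, 1) = p' (k, 1) \<and> d' (k, 1) = q' (k, 1)" unfolding fl by blast
      then show "inter I p c q d = 0" using R[unfolded crit, rule_format, of p' c' q' d'] by simp
    qed
  qed
  with wP show ?thesis by blast
qed

section \<open>Change of angle along arcs\<close>

text \<open>The values of \<open>h\<close> differ by multiples of 2 pi, so its range is
  discrete.\<close>

lemma cis_constant_on:
  fixes h :: "'a::topological_space \<Rightarrow> real"
  assumes "connected S" and "continuous_on S h" and "\<And>x. x \<in> S \<Longrightarrow> cis (h x) = c"
  shows "\<exists>k. \<forall>x\<in>S. h x = k"
proof -
  have "h constant_on S"
  proof (rule continuous_discrete_range_constant[OF assms(1,2)])
    fix x assume x: "x \<in> S"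
    show "\<exists>e>0. \<forall>y. y \<in> S \<and> h y \<noteq> h x \<longrightarrow> e \<le> norm (h y - h x)"
    proof (intro exI[of _ "2 * pi"] conjI allI impI)
      fix y assume y: "y \<in> S \<and> h y \<noteq> h x"
      then have "cis (h y - h x) = 1"
        using assms(3) x by (metis cis_divide cis_neq_zero divide_self)
      then have "cos (h y - h x) = 1" by (metis cis.sel(1) one_complex.sel(1))
      then obtain n :: int where n: "h y - h x = of_int n * 2 * pi"
        using cos_one_2pi_int by blast
      with y have "n \<noteq> 0" by auto
      then have "1 \<le> \<bar>real_of_int n\<bar>" by linarith
      then show "2 * pi \<le> norm (h y - h x)" unfolding n by (simp add: abs_mult)
    qed simp
  qed
  then show ?thesis by (auto simp: constant_on_def)
qed

definition angle_of :: "'a::topological_space set \<Rightarrow> ('a \<Rightarrow> complex) \<Rightarrow> ('a \<Rightarrow> real) \<Rightarrow> bool" where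
  "angle_of S f h \<longleftrightarrow> continuous_on S h \<and> (\<forall>x\<in>S. f x \<noteq> 0 \<and> f x = of_real (norm (f x)) * cis (h x))"

lemma angle_of_unique:
  assumes "connected S" and "angle_of S f h" and "angle_of S g k" and "c \<noteq> 0" and "\<And>x. x \<in> S \<Longrightarrow> g x = c * f x"
  shows "\<exists>a. \<forall>x\<in>S. k x = h x + a"
proof -
  have "\<exists>a. \<forall>x\<in>S. k x - h x = a"
  proof (rule cis_constant_on[OF assms(1)])
    show "continuous_on S (\<lambda>x. k x - h x)"
      using assms(2,3) by (auto simp: angle_of_def intro!: continuous_intros)
    fix x assume x: "x \<in> S"
    then have 1: "f x \<noteq> 0" "f x = of_real (norm (f x)) * cis (h x)"
      "c * f x = of_real (norm (c * f x)) * cis (k x)"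
      using assms(2,3,5) by (auto simp: angle_of_def)
    from 1(3) have "c * (of_real (norm (f x)) * cis (h x)) = of_real (norm c) * of_real (norm (f x)) * cis (k x)"
      using 1(2) by (metis norm_mult of_real_mult)
    then have "c * cis (h x) = of_real (norm c) * cis (k x)" using 1(1) by simp
    then show "cis (k x - h x) = c / of_real (norm c)"
      using assms(4) by (simp add: field_simps flip: cis_divide)
  qed
  then show ?thesis by (metis add.commute diff_add_cancel)
qed

lemma angle_of_subset: "angle_of S f h \<Longrightarrow> T \<subseteq> S \<Longrightarrow> angle_of T f h"
  by (auto simp: angle_of_def intro: continuous_on_subset)

lemma angle_of_compose:
  assumes "angle_of S f h" and "continuous_on T r" and "r ` T \<subseteq> S"
  shows "angle_of T (\<lambda>x. f (r x)) (\<lambda>x. h (r x))"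
  using assms continuous_on_compose2[of S h T r] by (auto simp: angle_of_def)

lemma angle_of_exists:
  fixes f :: "'a::real_normed_vector \<Rightarrow> complex"
  assumes "convex S" and "continuous_on S f" and "\<And>x. x \<in> S \<Longrightarrow> f x \<noteq> 0"
  obtains h where "angle_of S f h"
proof -
  obtain g where g: "continuous_on S g" "\<And>x. x \<in> S \<Longrightarrow> f x = exp (g x)"
    using continuous_logarithm_on_contractible[OF assms(2) convex_imp_contractible[OF assms(1)] assms(3)] by metis
  have "angle_of S f (\<lambda>x. Im (g x))"
    unfolding angle_of_def
  proof (intro conjI ballI)
    show "continuous_on S (\<lambda>x. Im (g x))" using g(1) by (intro continuous_intros)
    fix x assume "x \<in> S"
    then show "f x \<noteq> 0" "f x = of_real (norm (f x)) * cis (Im (g x))"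
      using g(2) assms(3) by (simp_all add: exp_eq_polar exp_of_real norm_mult)
  qed
  then show ?thesis using that by blast
qed

text \<open>The interval is open because a curve may start or end at the point from which it is
  viewed. The angle still has one-sided limits there when the curve has a nonzero one-sided
  velocity.\<close>

definition has_turn :: "(real \<Rightarrow> complex) \<Rightarrow> real \<Rightarrow> bool" where
  "has_turn f r \<longleftrightarrow> (\<exists>h a b. angle_of {0<..<1} f h \<and> (h \<longlongrightarrow> a) (at_right 0) \<and> (h \<longlongrightarrow> b) (at_left 1) \<and> r = b - a)"

lemma has_turn_unique:
  assumes "has_turn f r" and "has_turn g s" and "c \<noteq> 0" and "\<And>x. x \<in> {0<..<1} \<Longrightarrow> g x = c * f x"
  shows "r = s"
proof -
  obtain h a b where 1: "angle_of {0<..<1} f h" "(h \<longlongrightarrow> a) (at_right 0)" "(h \<longlongrightarrow> b) (at_left 1)" "r = b - a"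
    using assms(1) unfolding has_turn_def by blast
  obtain k a' b' where 2: "angle_of {0<..<1} g k" "(k \<longlongrightarrow> a') (at_right 0)" "(k \<longlongrightarrow> b') (at_left 1)" "s = b' - a'"
    using assms(2) unfolding has_turn_def by blast
  obtain d where d: "\<And>x. x \<in> {0<..<1} \<Longrightarrow> k x = h x + d"
    using angle_of_unique[OF _ 1(1) 2(1) assms(3,4)] by auto
  have ev0: "\<forall>\<^sub>F x in at_right (0::real). x \<in> {0<..<1}" and ev1: "\<forall>\<^sub>F x in at_left (1::real). x \<in> {0<..<1}"
    by (auto simp: eventually_at_left_real eventually_at_right_real greaterThanLessThan_iff[symmetric] simp del: greaterThanLessThan_iff)
  have "((\<lambda>x. h x + d) \<longlongrightarrow> a') (at_right 0)"
    by (rule Lim_transform_eventually[OF 2(2)]) (use ev0 d in \<open>auto elim: eventually_mono\<close>)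
  moreover have "((\<lambda>x. h x + d) \<longlongrightarrow> a + d) (at_right 0)" using 1(2) by (intro tendsto_intros)
  ultimately have "a' = a + d" using tendsto_unique trivial_limit_at_right_real by blast
  have "((\<lambda>x. h x + d) \<longlongrightarrow> b') (at_left 1)"
    by (rule Lim_transform_eventually[OF 2(3)]) (use ev1 d in \<open>auto elim: eventually_mono\<close>)
  moreover have "((\<lambda>x. h x + d) \<longlongrightarrow> b + d) (at_left 1)" using 1(3) by (intro tendsto_intros)
  ultimately have "b' = b + d" using tendsto_unique trivial_limit_at_left_real by blast
  with \<open>a' = a + d\<close> 1 2 show ?thesis by simp
qed

definition turn :: "(real \<Rightarrow> complex) \<Rightarrow> real" where
  "turn f = (THE r. has_turn f r)"

lemma turn_eq: "has_turn f r \<Longrightarrow> turn f = r"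
  unfolding turn_def by (rule the_equality) (auto intro: has_turn_unique[of f _ f _ 1])

text \<open>Vertices are extreme points of the square: a proper convex combination of two of its
  points is a vertex only if both points are that vertex.\<close>

lemma convex_square_minus_vertices:
  assumes "Z \<subseteq> {0, 1} \<times> {0, 1 :: real}"
  shows "convex ({0..1::real} \<times> {0..1::real} - Z)"
  unfolding convex_def
proof (intro ballI allI impI)
  fix x y :: "real \<times> real" and u v :: real
  assume x: "x \<in> {0..1::real} \<times> {0..1::real} - Z" and y: "y \<in> {0..1::real} \<times> {0..1::real} - Z" and uv: "0 \<le> u" "0 \<le> v" "u + v = 1"
  have ends: "p = e \<and> q = e" if "u > 0" "v > 0" "u * p + v * q = e" "0 \<le> p" "p \<le> 1" "0 \<le> q" "q \<le> 1" "e = 0 \<or> e = 1" for p q e :: real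
  proof (cases "e = 0")
    case True
    have "u * p \<ge> 0" "v * q \<ge> 0" using that by auto
    then have "u * p = 0" "v * q = 0" using that True by linarith+
    then show ?thesis using that True by auto
  next
    case False
    have "u * (1 - p) \<ge> 0" "v * (1 - q) \<ge> 0" using that by auto
    moreover have "u * (1 - p) + v * (1 - q) = 0" using that False uv by (simp add: algebra_simps)
    ultimately have "u * (1 - p) = 0" "v * (1 - q) = 0" by linarith+
    then show ?thesis using that False by auto
  qed
  show "u *\<^sub>R x + v *\<^sub>R y \<in> {0..1} \<times> {0..1} - Z"
  proof (cases "u = 0 \<or> v = 0")
    case True
    then show ?thesis using x y uv by auto
  next
    case False
    then have pos: "u > 0" "v > 0" using uv by auto
    have "convex ({0..1 :: real} \<times> {0..1 :: real})" by (intro convex_Times) auto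
    then have "u *\<^sub>R x + v *\<^sub>R y \<in> {0..1} \<times> {0..1}" using x y uv by (auto simp: convex_def)
    moreover have "u *\<^sub>R x + v *\<^sub>R y \<notin> Z"
    proof
      assume z: "u *\<^sub>R x + v *\<^sub>R y \<in> Z"
      then have "u *\<^sub>R x + v *\<^sub>R y \<in> {0, 1} \<times> {0, 1}" using assms by blast
      then have e: "u * fst x + v * fst y = 0 \<or> u * fst x + v * fst y = 1"
        "u * snd x + v * snd y = 0 \<or> u * snd x + v * snd y = 1" by (auto simp: prod_eq_iff)
      have "fst x \<in> {0..1}" "snd x \<in> {0..1}" "fst y \<in> {0..1}" "snd y \<in> {0..1}" using x y by auto
      then have "fst x = u * fst x + v * fst y" "snd x = u * snd x + v * snd y"
        using ends[OF pos refl _ _ _ _ e(1)] ends[OF pos refl _ _ _ _ e(2)] by auto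
      then have "x = u *\<^sub>R x + v *\<^sub>R y" by (simp add: prod_eq_iff)
      then show False using z x by auto
    qed
    ultimately show ?thesis by blast
  qed
qed

lemma Re_of_real_mult: "Re (of_real r * z) = r * Re z"
  by simp

text \<open>The conjugate of the bisector of \<open>a\<close> and \<open>- b\<close> works. For unit
  vectors, \<open>2 * Re (cnj (x + y) * x)\<close> is the squared norm of \<open>x + y\<close>, and
  the two unit vectors cancel only if \<open>a\<close> and \<open>b\<close> lie on one ray.\<close>

lemma half_plane_exists:
  fixes a b :: complex
  assumes "a \<noteq> 0" and "b \<noteq> 0" and "\<not> (\<exists>r>0. a = of_real r * b)"
  obtains w where "Re (w * a) > 0" and "Re (w * (- b)) > 0"
proof -
  define \<alpha> where "\<alpha> = sgn a"
  define \<beta> where "\<beta> = - sgn b"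
  have n: "norm \<alpha> = 1" "norm \<beta> = 1" using assms by (auto simp: \<alpha>_def \<beta>_def norm_sgn)
  have ne: "\<alpha> + \<beta> \<noteq> 0"
  proof
    assume "\<alpha> + \<beta> = 0"
    then have "a /\<^sub>R norm a = b /\<^sub>R norm b" by (simp add: \<alpha>_def \<beta>_def sgn_div_norm)
    then have "norm a *\<^sub>R (a /\<^sub>R norm a) = norm a *\<^sub>R (b /\<^sub>R norm b)" by simp
    then have "a = of_real (norm a / norm b) * b" using assms by (simp add: scaleR_conv_of_real field_simps)
    moreover have "norm a / norm b > 0" using assms by simp
    ultimately show False using assms(3) by blast
  qed
  have key: "Re (cnj (x + y) * x) > 0" if "norm x = 1" "norm y = 1" "x + y \<noteq> 0" for x y :: complex
  proof -
    have "(norm (x + y))\<^sup>2 = 2 * Re (cnj (x + y) * x)"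
      using arg_cong[OF that(1), of "\<lambda>z. z\<^sup>2"] arg_cong[OF that(2), of "\<lambda>z. z\<^sup>2"]
      unfolding cmod_power2 by (simp add: power2_eq_square algebra_simps)
    moreover have "(norm (x + y))\<^sup>2 > 0" using that(3) by simp
    ultimately show ?thesis by linarith
  qed
  show ?thesis
  proof (rule that[of "cnj (\<alpha> + \<beta>)"])
    have "a = of_real (norm a) * \<alpha>" using assms by (simp add: \<alpha>_def sgn_div_norm scaleR_conv_of_real)
    then have "Re (cnj (\<alpha> + \<beta>) * a) = norm a * Re (cnj (\<alpha> + \<beta>) * \<alpha>)"
      by (metis Re_of_real_mult mult.left_commute)
    then show "Re (cnj (\<alpha> + \<beta>) * a) > 0" using key[OF n ne] assms by simp
    have "- b = of_real (norm b) * \<beta>" using assms by (simp add: \<beta>_def sgn_div_norm scaleR_conv_of_real)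
    then have "Re (cnj (\<alpha> + \<beta>) * (- b)) = norm b * Re (cnj (\<alpha> + \<beta>) * \<beta>)"
      by (metis Re_of_real_mult mult.left_commute)
    then show "Re (cnj (\<alpha> + \<beta>) * (- b)) > 0" using key[OF n(2,1)] ne assms by (simp add: add.commute)
  qed
qed

text \<open>Both arguments lie strictly between -pi/2 and pi/2, so their difference is already a
  principal value.\<close>

lemma Arg_half_plane_diff:
  assumes "Re x > 0" and "Re y > 0"
  shows "Arg x - Arg y = Arg (x / y)"
proof -
  have x: "x \<noteq> 0" "y \<noteq> 0" using assms by auto
  have b: "\<bar>Arg x\<bar> < pi / 2" "\<bar>Arg y\<bar> < pi / 2"
    using assms Re_Ln_pos_lt[OF x(1)] Re_Ln_pos_lt[OF x(2)] x by (auto simp: Arg_eq_Im_Ln)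
  have "x / y = of_real (norm x / norm y) * (cis (Arg x) / cis (Arg y))"
    using cis_Arg[OF x(1)] cis_Arg[OF x(2)] x by (simp add: sgn_div_norm scaleR_conv_of_real field_simps)
  then have "x / y = of_real (norm x / norm y) * cis (Arg x - Arg y)" by (simp add: cis_divide)
  then have "Arg (x / y) = Arg x - Arg y"
    using x b by (simp add: Arg_cis abs_if split: if_splits)
  then show ?thesis by simp
qed

text \<open>
  \<open>a\<close> and \<open>b\<close> are the directions in which two arcs leave their end points \<open>x\<close> and \<open>y\<close>.  If these coincide,
  the angle of \<open>A s - B t\<close> changes from \<open>Arg (- b)\<close> to \<open>Arg a\<close> around the corner, without a full turn as
  long as the two rays differ.
\<close>

definition corner_angle :: "complex \<Rightarrow> complex \<Rightarrow> complex \<Rightarrow> complex \<Rightarrow> real" where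
  "corner_angle x a y b = (if x = y then Arg (- a / b) else 0)"

definition same_ray :: "complex \<Rightarrow> complex \<Rightarrow> bool" where
  "same_ray a b \<longleftrightarrow> (\<exists>r>0. a = of_real r * b)"

lemma difference_quotient_tendsto:
  fixes A :: "real \<Rightarrow> complex"
  assumes "(A has_vector_derivative a) (at 0 within {0..1})"
  shows "((\<lambda>s. (A s - A 0) / of_real s) \<longlongrightarrow> a) (at_right 0)"
proof -
  have "((\<lambda>y. (1 / norm (y - 0)) *\<^sub>R (A y - (A 0 + (y - 0) *\<^sub>R a))) \<longlongrightarrow> 0) (at 0 within {0..1})"
    using assms unfolding has_vector_derivative_def has_derivative_within by blast
  then have "((\<lambda>y. (1 / norm (y - 0)) *\<^sub>R (A y - (A 0 + (y - 0) *\<^sub>R a))) \<longlongrightarrow> 0) (at_right 0)"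
    by (simp add: at_within_Icc_at_right)
  then have "((\<lambda>y. (1 / norm (y - 0)) *\<^sub>R (A y - (A 0 + (y - 0) *\<^sub>R a)) + a) \<longlongrightarrow> 0 + a) (at_right 0)"
    by (intro tendsto_intros)
  then have "((\<lambda>y. (1 / norm (y - 0)) *\<^sub>R (A y - (A 0 + (y - 0) *\<^sub>R a)) + a) \<longlongrightarrow> a) (at_right 0)" by simp
  then show ?thesis
  proof (rule Lim_transform_eventually)
    show "\<forall>\<^sub>F s in at_right 0. (1 / norm (s - 0)) *\<^sub>R (A s - (A 0 + (s - 0) *\<^sub>R a)) + a = (A s - A 0) / of_real s"
      using eventually_at_right_less[of "0::real"]
      by eventually_elim (simp add: scaleR_conv_of_real field_simps)
  qed
qed

text \<open>If the end points differ, \<open>G\<close> is continuous at the corner and both limits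
  agree. If they coincide, multiplication by a suitable \<open>w\<close> moves all differences near
  the corner into the right half-plane. There the principal argument is a continuous angle; it
  differs from \<open>G\<close> by a constant, and the limits along the two sides are found from the
  difference quotients.\<close>

lemma corner_limits:
  fixes A B :: "real \<Rightarrow> complex"
  assumes A: "(A has_vector_derivative a) (at 0 within {0..1})" "a \<noteq> 0" "continuous_on {0..1} A"
    and B: "(B has_vector_derivative b) (at 0 within {0..1})" "b \<noteq> 0" "continuous_on {0..1} B"
    and ray: "A 0 = B 0 \<Longrightarrow> \<not> same_ray a b"
    and G: "angle_of S (\<lambda>p. A (fst p) - B (snd p)) G"
    and S: "{0..1/2} \<times> {0..1/2} - {(0, 0)} \<subseteq> S" "A 0 \<noteq> B 0 \<Longrightarrow> (0, 0) \<in> S"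
  shows "\<exists>L1 L2. ((\<lambda>s. G (s, 0)) \<longlongrightarrow> L1) (at_right 0) \<and> ((\<lambda>t. G (0, t)) \<longlongrightarrow> L2) (at_right 0) \<and>
    L1 - L2 = corner_angle (A 0) a (B 0) b"
proof (cases "A 0 = B 0")
  case False
  have sq: "{0..1/2} \<times> {0..1/2} \<subseteq> S" using S False by auto
  then have c: "continuous_on ({0..1/2} \<times> {0..1/2}) G" using G continuous_on_subset by (auto simp: angle_of_def)
  have 1: "((\<lambda>s. G (s, 0)) \<longlongrightarrow> G (0, 0)) (at_right 0)"
  proof -
    have "continuous_on {0..1/2} (\<lambda>s. G (s, 0))"
      by (rule continuous_on_compose2[OF c]) (auto intro!: continuous_intros)
    then have "((\<lambda>s. G (s, 0)) \<longlongrightarrow> G (0, 0)) (at 0 within {0..1/2})" by (simp add: continuous_on_def)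
    then show ?thesis by (simp add: at_within_Icc_at_right)
  qed
  have 2: "((\<lambda>t. G (0, t)) \<longlongrightarrow> G (0, 0)) (at_right 0)"
  proof -
    have "continuous_on {0..1/2} (\<lambda>t. G (0, t))"
      by (rule continuous_on_compose2[OF c]) (auto intro!: continuous_intros)
    then have "((\<lambda>t. G (0, t)) \<longlongrightarrow> G (0, 0)) (at 0 within {0..1/2})" by (simp add: continuous_on_def)
    then show ?thesis by (simp add: at_within_Icc_at_right)
  qed
  show ?thesis using 1 2 False by (intro exI[of _ "G (0, 0)"]) (simp add: corner_angle_def)
next
  case True
  obtain w where w: "Re (w * a) > 0" "Re (w * (- b)) > 0"
    using half_plane_exists[OF A(2) B(2)] ray[OF True] unfolding same_ray_def by blast
  define qA where "qA s = (if s = 0 then a else (A s - A 0) / of_real s)" for s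
  define qB where "qB s = (if s = 0 then b else (B s - B 0) / of_real s)" for s
  have dA: "((\<lambda>s. w * ((A s - A 0) / of_real s)) \<longlongrightarrow> w * a) (at_right 0)"
    by (intro tendsto_intros difference_quotient_tendsto A)
  have dB: "((\<lambda>s. w * (- ((B s - B 0) / of_real s))) \<longlongrightarrow> w * (- b)) (at_right 0)"
    by (intro tendsto_intros difference_quotient_tendsto B)
  have "\<forall>\<^sub>F s in at_right 0. Re (w * ((A s - A 0) / of_real s)) > 0 \<and> Re (w * (- ((B s - B 0) / of_real s))) > 0"
    using order_tendstoD(1)[OF tendsto_Re[OF dA] w(1)] order_tendstoD(1)[OF tendsto_Re[OF dB] w(2)]
    by eventually_elim auto
  then obtain r0 where r0: "r0 > 0" "\<And>s. 0 < s \<Longrightarrow> s < r0 \<Longrightarrow>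
     Re (w * ((A s - A 0) / of_real s)) > 0 \<and> Re (w * (- ((B s - B 0) / of_real s))) > 0"
    unfolding eventually_at_right_field by auto
  define r where "r = min (r0 / 2) (1 / 2)"
  have r: "0 < r" "r < r0" "r \<le> 1/2" using r0(1) by (auto simp: r_def)
  have posA: "Re (w * (A s - A 0)) > 0" if "0 < s" "s \<le> r" for s
  proof -
    have "w * (A s - A 0) = of_real s * (w * ((A s - A 0) / of_real s))" using that by simp
    then have "Re (w * (A s - A 0)) = s * Re (w * ((A s - A 0) / of_real s))" by (metis Re_of_real_mult)
    then show ?thesis using r0(2)[of s] that r by (metis mult_pos_pos order_le_less_trans)
  qed
  have posB: "Re (w * (- (B s - B 0))) > 0" if "0 < s" "s \<le> r" for s
  proof -
    have "of_real s * (w * (- ((B s - B 0) / of_real s))) = - (w * (B s - B 0))" using that by simp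
    then have "w * (- (B s - B 0)) = of_real s * (w * (- ((B s - B 0) / of_real s)))" by (simp only: mult_minus_right)
    then have "Re (w * (- (B s - B 0))) = s * Re (w * (- ((B s - B 0) / of_real s)))" by (metis Re_of_real_mult)
    then show ?thesis using r0(2)[of s] that r by (metis mult_pos_pos order_le_less_trans)
  qed
  \<comment> \<open>Being a scaled copy of the unit square without a vertex, \<open>T\<close> is
    connected, which allows the two angles to be compared.\<close>
  define T where "T = (\<lambda>p. r *\<^sub>R p) ` ({0..1 :: real} \<times> {0..1 :: real} - {(0, 0)})"
  have T: "T = {0..r} \<times> {0..r} - {(0, 0)}"
  proof
    show "T \<subseteq> {0..r} \<times> {0..r} - {(0, 0)}"
    proof
      fix p assume "p \<in> T"
      then obtain q where q: "q \<in> {0..1} \<times> {0..1} - {(0, 0)}" "p = r *\<^sub>R q" unfolding T_def by blast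
      obtain a b where "q = (a, b)" by (cases q)
      with q have ab: "p = (r * a, r * b)" "0 \<le> a" "a \<le> 1" "0 \<le> b" "b \<le> 1" "(a, b) \<noteq> (0, 0)" by auto
      then have "r * a \<le> r" "r * b \<le> r" using r by (simp_all add: mult_left_le)
      then show "p \<in> {0..r} \<times> {0..r} - {(0, 0)}" using ab r by auto
    qed
    show "{0..r} \<times> {0..r} - {(0, 0)} \<subseteq> T"
    proof
      fix p assume p: "p \<in> {0..r} \<times> {0..r} - {(0, 0)}"
      obtain x y where "p = (x, y)" by (cases p)
      with p have xy: "p = (x, y)" "0 \<le> x" "x \<le> r" "0 \<le> y" "y \<le> r" "(x, y) \<noteq> (0, 0)" by auto
      then have "(x / r, y / r) \<in> {0..1} \<times> {0..1} - {(0, 0)}" using r by auto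
      moreover have "p = r *\<^sub>R (x / r, y / r)" using r xy by simp
      ultimately show "p \<in> T" unfolding T_def by blast
    qed
  qed
  have "connected ({0..1 :: real} \<times> {0..1 :: real} - {(0, 0)})"
    by (intro convex_connected convex_square_minus_vertices) auto
  then have conn: "connected T" unfolding T_def by (intro connected_continuous_image continuous_intros)
  have "T \<subseteq> {0..1/2} \<times> {0..1/2} - {(0, 0)}" using r unfolding T by auto
  then have TS: "T \<subseteq> S" using S(1) by (rule subset_trans)
  have GT: "angle_of T (\<lambda>p. A (fst p) - B (snd p)) G" by (rule angle_of_subset[OF G TS])
  \<comment> \<open>With a common end point, \<open>A s - B t\<close> is the sum of
    \<open>A s - A 0\<close> and \<open>- (B t - B 0)\<close>. Away from the corner at least one of
    them is nonzero and has positive real part after multiplication by \<open>w\<close>.\<close>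
  have pos: "Re (w * (A s - B t)) > 0" if "(s, t) \<in> T" for s t
  proof -
    have "w * (A s - B t) = w * (A s - A 0) + w * (- (B t - B 0))" using True by (simp add: algebra_simps)
    moreover have "Re (w * (A s - A 0)) \<ge> 0" using posA[of s] that by (cases "s = 0") (auto simp: T)
    moreover have "Re (w * (- (B t - B 0))) \<ge> 0" using posB[of t] that by (cases "t = 0") (auto simp: T)
    moreover have "Re (w * (A s - A 0)) > 0 \<or> Re (w * (- (B t - B 0))) > 0"
      using posA[of s] posB[of t] that by (auto simp: T)
    ultimately show ?thesis by auto
  qed
  have contF: "continuous_on T (\<lambda>p. A (fst p) - B (snd p))"
  proof (intro continuous_on_diff)
    show "continuous_on T (\<lambda>p. A (fst p))"
      by (rule continuous_on_compose2[OF A(3)]) (use r in \<open>auto simp: T intro!: continuous_intros\<close>)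
    show "continuous_on T (\<lambda>p. B (snd p))"
      by (rule continuous_on_compose2[OF B(3)]) (use r in \<open>auto simp: T intro!: continuous_intros\<close>)
  qed
  define K where "K = (\<lambda>p. Arg (w * (A (fst p) - B (snd p))))"
  have K: "angle_of T (\<lambda>p. w * (A (fst p) - B (snd p))) K"
    unfolding angle_of_def
  proof (intro conjI ballI)
    show "continuous_on T K" unfolding K_def
      by (intro continuous_on_Arg' continuous_intros contF) (use pos in \<open>force simp: complex_nonpos_Reals_iff\<close>)
    fix p assume "p \<in> T"
    then show nz: "w * (A (fst p) - B (snd p)) \<noteq> 0" using pos[of "fst p" "snd p"] by auto
    show "w * (A (fst p) - B (snd p)) = of_real (norm (w * (A (fst p) - B (snd p)))) * cis (K p)"
      unfolding K_def cis_Arg[OF nz] using nz by (simp add: sgn_div_norm scaleR_conv_of_real)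
  qed
  have "w \<noteq> 0" using w by auto
  then obtain k where k: "\<And>p. p \<in> T \<Longrightarrow> K p = G p + k"
    using angle_of_unique[OF conn GT K, of w] by auto
  have r_ev: "\<forall>\<^sub>F s in at_right 0. 0 < s \<and> s < r" by (simp add: eventually_at_right_real r flip: greaterThanLessThan_iff)
  have l1: "((\<lambda>s. G (s, 0)) \<longlongrightarrow> Arg (w * a) - k) (at_right 0)"
  proof (rule Lim_transform_eventually)
    show "((\<lambda>s. Arg (w * ((A s - A 0) / of_real s)) - k) \<longlongrightarrow> Arg (w * a) - k) (at_right 0)"
      using w(1) by (intro tendsto_intros tendsto_Arg dA) (auto simp: complex_nonpos_Reals_iff)
    show "\<forall>\<^sub>F s in at_right 0. Arg (w * ((A s - A 0) / of_real s)) - k = G (s, 0)"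
      using r_ev
    proof eventually_elim
      case (elim s)
      have "Arg (w * ((A s - A 0) / of_real s)) = K (s, 0)" using elim by (simp add: K_def True)
      then show ?case using k[of "(s, 0)"] elim by (simp add: T)
    qed
  qed
  have l2: "((\<lambda>s. G (0, s)) \<longlongrightarrow> Arg (w * (- b)) - k) (at_right 0)"
  proof (rule Lim_transform_eventually)
    show "((\<lambda>s. Arg (w * (- ((B s - B 0) / of_real s))) - k) \<longlongrightarrow> Arg (w * (- b)) - k) (at_right 0)"
      using w(2) by (intro tendsto_intros tendsto_Arg dB) (auto simp: complex_nonpos_Reals_iff)
    show "\<forall>\<^sub>F s in at_right 0. Arg (w * (- ((B s - B 0) / of_real s))) - k = G (0, s)"
      using r_ev
    proof eventually_elim
      case (elim s)
      have "- ((B s - B 0) / of_real s) = (A 0 - B s) / of_real s" by (simp add: True minus_divide_left)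
      then have "w * (- ((B s - B 0) / of_real s)) = w * (A 0 - B s) / of_real s" by simp
      then have "Arg (w * (- ((B s - B 0) / of_real s))) = K (0, s)" using elim by (simp add: K_def)
      then show ?case using k[of "(0, s)"] elim by (simp add: T)
    qed
  qed
  have "(Arg (w * a) - k) - (Arg (w * (- b)) - k) = Arg (- a / b)"
    using Arg_half_plane_diff[OF w] \<open>w \<noteq> 0\<close> by simp
  with l1 l2 show ?thesis
    by (intro exI[of _ "Arg (w * a) - k"] exI[of _ "Arg (w * (- b)) - k"] conjI) (simp_all add: corner_angle_def True)
qed

section \<open>Two arcs and the change of angle around the unit square\<close>

definition arc :: "(real \<Rightarrow> complex) \<Rightarrow> complex \<Rightarrow> complex \<Rightarrow> bool" where
  "arc A a a' \<longleftrightarrow> continuous_on {0..1} A \<and> (A has_vector_derivative a) (at 0 within {0..1}) \<and>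
    (A has_vector_derivative a') (at 1 within {0..1}) \<and> a \<noteq> 0 \<and> a' \<noteq> 0"

lemma arc_reverse: "arc A a a' \<Longrightarrow> arc (\<lambda>s. A (1 - s)) (- a') (- a)"
proof -
  assume A: "arc A a a'"
  have r: "((\<lambda>s :: real. 1 - s) has_vector_derivative -1) F" for F
    by (auto intro!: derivative_eq_intros)
  have im: "(\<lambda>s :: real. 1 - s) ` {0..1} = {0..1}" by simp
  have "(A \<circ> (\<lambda>s. 1 - s) has_vector_derivative (-1) *\<^sub>R a') (at 0 within {0..1})"
    by (rule vector_diff_chain_within[OF r]) (use A in \<open>simp add: im arc_def\<close>)
  moreover have "(A \<circ> (\<lambda>s. 1 - s) has_vector_derivative (-1) *\<^sub>R a) (at 1 within {0..1})"
    by (rule vector_diff_chain_within[OF r]) (use A in \<open>simp add: im arc_def\<close>)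
  moreover have "continuous_on {0..1} (\<lambda>s. A (1 - s))"
  proof (rule continuous_on_compose2[of "{0..1}" A "{0..1}" "\<lambda>s. 1 - s"])
    show "continuous_on {0..1} A" using A by (simp add: arc_def)
    show "continuous_on {0..1} (\<lambda>s :: real. 1 - s)" by (intro continuous_intros)
    show "(\<lambda>s :: real. 1 - s) ` {0..1} \<subseteq> {0..1}" by (simp only: im order_refl)
  qed
  ultimately show ?thesis using A by (auto simp: arc_def o_def)
qed

lemma tendsto_at_left_1: "((\<lambda>s. f (1 - s)) \<longlongrightarrow> l) (at_right 0) \<Longrightarrow> (f \<longlongrightarrow> l) (at_left (1::real))"
proof -
  assume "((\<lambda>s. f (1 - s)) \<longlongrightarrow> l) (at_right 0)"
  moreover have "at_left (1::real) = filtermap (\<lambda>x. 1 - x) (at_right 0)"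
  proof -
    have "filtermap (\<lambda>x. x - 1) (at_right (0::real)) = at_right (- 1)"
      using filtermap_at_right_shift[of 1 "0::real"] by simp
    then have "at_left (1::real) = filtermap (\<lambda>x. - x) (filtermap (\<lambda>x. x - 1) (at_right 0))"
      by (simp add: at_left_minus[of 1])
    then show ?thesis by (simp add: filtermap_filtermap)
  qed
  ultimately show ?thesis by (simp add: filterlim_filtermap)
qed

text \<open>The other three corners of the square reduce to this one by reversing one or both arcs;
  this is why directions at far ends occur with a minus sign.\<close>

lemma arc_corner:
  assumes A: "arc A a a'" and B: "arc B b b'"
    and meet: "\<And>s t. \<lbrakk>s \<in> {0..1}; t \<in> {0..1}; A s = B t\<rbrakk> \<Longrightarrow> s \<in> {0, 1} \<and> t \<in> {0, 1}"
    and ray: "A 0 = B 0 \<Longrightarrow> \<not> same_ray a b"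
    and G: "angle_of {p \<in> {0..1} \<times> {0..1}. A (fst p) \<noteq> B (snd p)} (\<lambda>p. A (fst p) - B (snd p)) G"
  shows "\<exists>L1 L2. ((\<lambda>s. G (s, 0)) \<longlongrightarrow> L1) (at_right 0) \<and> ((\<lambda>t. G (0, t)) \<longlongrightarrow> L2) (at_right 0) \<and>
    L1 - L2 = corner_angle (A 0) a (B 0) b"
proof (rule corner_limits[OF _ _ _ _ _ _ ray G])
  show "(A has_vector_derivative a) (at 0 within {0..1})" "a \<noteq> 0" "continuous_on {0..1} A"
    using A unfolding arc_def by blast+
  show "(B has_vector_derivative b) (at 0 within {0..1})" "b \<noteq> 0" "continuous_on {0..1} B"
    using B unfolding arc_def by blast+
  show "{0..1/2} \<times> {0..1/2} - {(0, 0)} \<subseteq> {p \<in> {0..1} \<times> {0..1}. A (fst p) \<noteq> B (snd p)}"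
  proof
    fix p assume p: "p \<in> {0..1/2 :: real} \<times> {0..1/2 :: real} - {(0, 0)}"
    obtain s t where st: "p = (s, t)" by (cases p)
    have 1: "s \<in> {0..1}" "t \<in> {0..1}" "\<not> (s \<in> {0, 1} \<and> t \<in> {0, 1})" using p st by auto
    then have "A s \<noteq> B t" using meet by blast
    then show "p \<in> {p \<in> {0..1} \<times> {0..1}. A (fst p) \<noteq> B (snd p)}" using 1 st by simp
  qed
  show "A 0 \<noteq> B 0 \<Longrightarrow> (0, 0) \<in> {p \<in> {0..1} \<times> {0..1}. A (fst p) \<noteq> B (snd p)}" by simp
qed

text \<open>
  The difference \<open>A s - B t\<close> vanishes only at vertices of the unit square, and a square without some of its
  vertices is convex, so it carries a continuous angle.
\<close>

theorem arcs_relation: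
  assumes A: "arc A a a'" and B: "arc B b b'"
    and meet: "\<And>s t. \<lbrakk>s \<in> {0..1}; t \<in> {0..1}; A s = B t\<rbrakk> \<Longrightarrow> s \<in> {0, 1} \<and> t \<in> {0, 1}"
    and ray: "A 0 = B 0 \<Longrightarrow> \<not> same_ray a b" "A 1 = B 0 \<Longrightarrow> \<not> same_ray (- a') b"
      "A 0 = B 1 \<Longrightarrow> \<not> same_ray a (- b')" "A 1 = B 1 \<Longrightarrow> \<not> same_ray (- a') (- b')"
  shows "turn (\<lambda>s. A s - B 0) - turn (\<lambda>s. A s - B 1) + turn (\<lambda>t. B t - A 1) - turn (\<lambda>t. B t - A 0) =
    corner_angle (A 1) (- a') (B 0) b + corner_angle (A 0) a (B 1) (- b') -
    corner_angle (A 0) a (B 0) b - corner_angle (A 1) (- a') (B 1) (- b')"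
proof -
  define S where "S A B = {p \<in> {0..1} \<times> {0..1}. A (fst p) \<noteq> (B (snd p) :: complex)}" for A B :: "real \<Rightarrow> complex"
  have cont: "continuous_on (S A B) (\<lambda>p. A (fst p) - B (snd p))"
  proof (intro continuous_on_diff)
    show "continuous_on (S A B) (\<lambda>p. A (fst p))"
      by (rule continuous_on_compose2[of "{0..1}" A]) (use A in \<open>auto simp: S_def arc_def intro!: continuous_intros\<close>)
    show "continuous_on (S A B) (\<lambda>p. B (snd p))"
      by (rule continuous_on_compose2[of "{0..1}" B]) (use B in \<open>auto simp: S_def arc_def intro!: continuous_intros\<close>)
  qed
  have "S A B = {0..1} \<times> {0..1} - {p \<in> {0, 1} \<times> {0, 1}. A (fst p) = B (snd p)}"
  proof
    show "{0..1} \<times> {0..1} - {p \<in> {0, 1} \<times> {0, 1}. A (fst p) = B (snd p)} \<subseteq> S A B"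
    proof
      fix p assume p: "p \<in> {0..1} \<times> {0..1} - {p \<in> {0, 1} \<times> {0, 1}. A (fst p) = B (snd p)}"
      then have "A (fst p) \<noteq> B (snd p)" using meet[of "fst p" "snd p"] by (auto simp: mem_Times_iff prod_eq_iff)
      then show "p \<in> S A B" using p by (simp add: S_def)
    qed
  qed (auto simp: S_def)
  moreover have "convex ({0..1} \<times> {0..1} - {p \<in> {0, 1} \<times> {0, 1}. A (fst p) = B (snd p)})"
    by (rule convex_square_minus_vertices) blast
  ultimately have conv: "convex (S A B)" by simp
  obtain G where G: "angle_of (S A B) (\<lambda>p. A (fst p) - B (snd p)) G"
    by (rule angle_of_exists[OF conv cont]) (auto simp: S_def)
  have G10: "angle_of (S (\<lambda>s. A (1 - s)) B) (\<lambda>p. A (1 - fst p) - B (snd p)) (\<lambda>p. G (1 - fst p, snd p))"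
  proof -
    have c: "continuous_on (S (\<lambda>s. A (1 - s)) B) (\<lambda>p. (1 - fst p, snd p))" by (intro continuous_intros)
    have i: "(\<lambda>p. (1 - fst p, snd p)) ` S (\<lambda>s. A (1 - s)) B \<subseteq> S A B" by (auto simp: S_def)
    show ?thesis using angle_of_compose[OF G c i] by simp
  qed
  have G01: "angle_of (S A (\<lambda>t. B (1 - t))) (\<lambda>p. A (fst p) - B (1 - snd p)) (\<lambda>p. G (fst p, 1 - snd p))"
  proof -
    have c: "continuous_on (S A (\<lambda>t. B (1 - t))) (\<lambda>p. (fst p, 1 - snd p))" by (intro continuous_intros)
    have i: "(\<lambda>p. (fst p, 1 - snd p)) ` S A (\<lambda>t. B (1 - t)) \<subseteq> S A B" by (auto simp: S_def)
    show ?thesis using angle_of_compose[OF G c i] by simp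
  qed
  have G11: "angle_of (S (\<lambda>s. A (1 - s)) (\<lambda>t. B (1 - t))) (\<lambda>p. A (1 - fst p) - B (1 - snd p)) (\<lambda>p. G (1 - fst p, 1 - snd p))"
  proof -
    have c: "continuous_on (S (\<lambda>s. A (1 - s)) (\<lambda>t. B (1 - t))) (\<lambda>p. (1 - fst p, 1 - snd p))" by (intro continuous_intros)
    have i: "(\<lambda>p. (1 - fst p, 1 - snd p)) ` S (\<lambda>s. A (1 - s)) (\<lambda>t. B (1 - t)) \<subseteq> S A B" by (auto simp: S_def)
    show ?thesis using angle_of_compose[OF G c i] by simp
  qed
  have flip: "1 - s \<in> {0, 1} \<longleftrightarrow> s \<in> {0, 1 :: real}" "1 - s \<in> {0..1} \<longleftrightarrow> s \<in> {0..1 :: real}" for s by auto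
  have meet10: "s \<in> {0, 1} \<and> t \<in> {0, 1}" if "s \<in> {0..1}" "t \<in> {0..1}" "A (1 - s) = B t" for s t
    using meet[of "1 - s" t] that unfolding flip by blast
  have meet01: "s \<in> {0, 1} \<and> t \<in> {0, 1}" if "s \<in> {0..1}" "t \<in> {0..1}" "A s = B (1 - t)" for s t
    using meet[of s "1 - t"] that unfolding flip by blast
  have meet11: "s \<in> {0, 1} \<and> t \<in> {0, 1}" if "s \<in> {0..1}" "t \<in> {0..1}" "A (1 - s) = B (1 - t)" for s t
    using meet[of "1 - s" "1 - t"] that unfolding flip by blast
  \<comment> \<open>The letters \<open>b\<close>, \<open>t\<close>, \<open>l\<close>,
    \<open>r\<close> name the bottom, top, left and right side along which the limit of
    \<open>G\<close> is taken, and the digits name the corner. Turns are differences along a side,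
    corner angles are differences at a corner; regrouping the eight limits gives the claim.\<close>
  obtain b00 l00 where c00: "((\<lambda>s. G (s, 0)) \<longlongrightarrow> b00) (at_right 0)" "((\<lambda>t. G (0, t)) \<longlongrightarrow> l00) (at_right 0)"
    "b00 - l00 = corner_angle (A 0) a (B 0) b"
  proof -
    note * = arc_corner[OF A B _ _ G[unfolded S_def], simplified fst_conv snd_conv diff_zero]
    show ?thesis by (rule exE[OF *], erule (2) meet, erule ray(1), elim exE conjE, rule that)
  qed
  obtain b10 r10 where c10: "((\<lambda>s. G (1 - s, 0)) \<longlongrightarrow> b10) (at_right 0)" "((\<lambda>t. G (1, t)) \<longlongrightarrow> r10) (at_right 0)"
    "b10 - r10 = corner_angle (A 1) (- a') (B 0) b"
  proof -
    note * = arc_corner[OF arc_reverse[OF A] B _ _ G10[unfolded S_def], simplified fst_conv snd_conv diff_zero]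
    show ?thesis by (rule exE[OF *], erule (2) meet10, erule ray(2), elim exE conjE, rule that)
  qed
  note d10 = tendsto_at_left_1[of "\<lambda>s. G (s, 0)", OF c10(1)]
  obtain t01 l01 where c01: "((\<lambda>s. G (s, 1)) \<longlongrightarrow> t01) (at_right 0)" "((\<lambda>t. G (0, 1 - t)) \<longlongrightarrow> l01) (at_right 0)"
    "t01 - l01 = corner_angle (A 0) a (B 1) (- b')"
  proof -
    note * = arc_corner[OF A arc_reverse[OF B] _ _ G01[unfolded S_def], simplified fst_conv snd_conv diff_zero]
    show ?thesis by (rule exE[OF *], erule (2) meet01, erule ray(3), elim exE conjE, rule that)
  qed
  note e01 = tendsto_at_left_1[of "\<lambda>t. G (0, t)", OF c01(2)]
  obtain t11 r11 where c11: "((\<lambda>s. G (1 - s, 1)) \<longlongrightarrow> t11) (at_right 0)" "((\<lambda>t. G (1, 1 - t)) \<longlongrightarrow> r11) (at_right 0)"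
    "t11 - r11 = corner_angle (A 1) (- a') (B 1) (- b')"
  proof -
    note * = arc_corner[OF arc_reverse[OF A] arc_reverse[OF B] _ _ G11[unfolded S_def], simplified fst_conv snd_conv diff_zero]
    show ?thesis by (rule exE[OF *], erule (2) meet11, erule ray(4), elim exE conjE, rule that)
  qed
  note d11 = tendsto_at_left_1[of "\<lambda>s. G (s, 1)", OF c11(1)]
  note e11 = tendsto_at_left_1[of "\<lambda>t. G (1, t)", OF c11(2)]
  have side: "angle_of {0<..<1} (\<lambda>x. A (fst (r x)) - B (snd (r x))) (\<lambda>x. G (r x))"
    if "continuous_on {0<..<1} r" "r ` {0<..<1} \<subseteq> S A B" for r
    using angle_of_compose[OF G that] .
  have side1: "angle_of {0<..<1} (\<lambda>s. A s - B 0) (\<lambda>s. G (s, 0))"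
  proof -
    have "(\<lambda>s. (s, 0)) ` {0<..<1} \<subseteq> S A B"
    proof (rule image_subsetI)
      fix s :: real assume "s \<in> {0<..<1}"
      then show "(s, 0) \<in> S A B" using meet[of s 0] by (auto simp: S_def)
    qed
    from side[OF _ this] show ?thesis by (simp add: continuous_on_Pair continuous_on_id continuous_on_const)
  qed
  have side2: "angle_of {0<..<1} (\<lambda>s. A s - B 1) (\<lambda>s. G (s, 1))"
  proof -
    have "(\<lambda>s. (s, 1)) ` {0<..<1} \<subseteq> S A B"
    proof (rule image_subsetI)
      fix s :: real assume "s \<in> {0<..<1}"
      then show "(s, 1) \<in> S A B" using meet[of s 1] by (auto simp: S_def)
    qed
    from side[OF _ this] show ?thesis by (simp add: continuous_on_Pair continuous_on_id continuous_on_const)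
  qed
  have side3: "angle_of {0<..<1} (\<lambda>s. A 0 - B s) (\<lambda>s. G (0, s))"
  proof -
    have "(\<lambda>s. (0, s)) ` {0<..<1} \<subseteq> S A B"
    proof (rule image_subsetI)
      fix s :: real assume "s \<in> {0<..<1}"
      then show "(0, s) \<in> S A B" using meet[of 0 s] by (auto simp: S_def)
    qed
    from side[OF _ this] show ?thesis by (simp add: continuous_on_Pair continuous_on_id continuous_on_const)
  qed
  have side4: "angle_of {0<..<1} (\<lambda>s. A 1 - B s) (\<lambda>s. G (1, s))"
  proof -
    have "(\<lambda>s. (1, s)) ` {0<..<1} \<subseteq> S A B"
    proof (rule image_subsetI)
      fix s :: real assume "s \<in> {0<..<1}"
      then show "(1, s) \<in> S A B" using meet[of 1 s] by (auto simp: S_def)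
    qed
    from side[OF _ this] show ?thesis by (simp add: continuous_on_Pair continuous_on_id continuous_on_const)
  qed
  have "has_turn (\<lambda>s. A s - B 0) (b10 - b00)"
    unfolding has_turn_def
    by (intro exI[of _ "\<lambda>s. G (s, 0)"] exI[of _ b00] exI[of _ b10] conjI c00 d10 refl side1)
  moreover have "has_turn (\<lambda>s. A s - B 1) (t11 - t01)"
    unfolding has_turn_def
    by (intro exI[of _ "\<lambda>s. G (s, 1)"] exI[of _ t01] exI[of _ t11] conjI c01 d11 refl side2)
  \<comment> \<open>Negating the difference shifts its angle by pi and leaves the turn
    unchanged.\<close>
  moreover have neg: "has_turn (\<lambda>t. B t - x) r" if "has_turn (\<lambda>t. x - B t) r" for x r
  proof -
    obtain h k l where h: "angle_of {0<..<1} (\<lambda>t. x - B t) h" "(h \<longlongrightarrow> k) (at_right 0)" "(h \<longlongrightarrow> l) (at_left 1)" "r = l - k"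
      using \<open>has_turn (\<lambda>t. x - B t) r\<close> unfolding has_turn_def by blast
    have "angle_of {0<..<1} (\<lambda>t. B t - x) (\<lambda>t. h t + pi)"
      unfolding angle_of_def
    proof (intro conjI ballI)
      show "continuous_on {0<..<1} (\<lambda>t. h t + pi)" using h(1) by (auto simp: angle_of_def intro!: continuous_intros)
      fix t :: real assume "t \<in> {0<..<1}"
      then have *: "x - B t \<noteq> 0" "x - B t = of_real (norm (x - B t)) * cis (h t)" using h(1) unfolding angle_of_def by blast+
      show "B t - x \<noteq> 0" using *(1) by auto
      have "B t - x = - (x - B t)" by simp
      also have "\<dots> = - (of_real (norm (x - B t)) * cis (h t))" using *(2) by simp
      also have "\<dots> = of_real (norm (B t - x)) * cis (h t + pi)" by (simp add: norm_minus_commute flip: cis_mult)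
      finally show "B t - x = of_real (norm (B t - x)) * cis (h t + pi)" .
    qed
    moreover have "((\<lambda>t. h t + pi) \<longlongrightarrow> k + pi) (at_right 0)" "((\<lambda>t. h t + pi) \<longlongrightarrow> l + pi) (at_left 1)"
      using h by (intro tendsto_intros; simp)+
    ultimately show ?thesis unfolding has_turn_def using h(4)
      by (intro exI[of _ "\<lambda>t. h t + pi"] exI[of _ "k + pi"] exI[of _ "l + pi"]) simp
  qed
  have "has_turn (\<lambda>t. A 0 - B t) (l01 - l00)"
    unfolding has_turn_def
    by (intro exI[of _ "\<lambda>t. G (0, t)"] exI[of _ l00] exI[of _ l01] conjI c00 e01 refl side3)
  note l = neg[OF this]
  have "has_turn (\<lambda>t. A 1 - B t) (r11 - r10)"
    unfolding has_turn_def
    by (intro exI[of _ "\<lambda>t. G (1, t)"] exI[of _ r10] exI[of _ r11] conjI c10 e11 refl side4)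
  note r = neg[OF this]
  show ?thesis
    using turn_eq[OF calculation(1)] turn_eq[OF calculation(2)] turn_eq[OF l] turn_eq[OF r] c00(3) c10(3) c01(3) c11(3)
    by linarith
qed

section \<open>Diagrams satisfy the planarity condition\<close>

definition next_in :: "real list \<Rightarrow> real \<Rightarrow> real" where
  "next_in ts t = (THE u. \<exists>i<length ts. ts ! i = t \<and> u = ts ! (Suc i mod length ts))"

text \<open>
  \<open>end_in ts t\<close> lifts the cyclic successor of \<open>t\<close> to the universal cover, so it may exceed \<open>1\<close>.
\<close>

definition end_in :: "real list \<Rightarrow> real \<Rightarrow> real" where
  "end_in ts t = (THE u. \<exists>i<length ts. ts ! i = t \<and> u = (if Suc i < length ts then ts ! Suc i else ts ! 0 + 1))"

lemma next_in_nth: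
  assumes "distinct ts" and "i < length ts"
  shows "next_in ts (ts ! i) = ts ! (Suc i mod length ts)"
    and "end_in ts (ts ! i) = (if Suc i < length ts then ts ! Suc i else ts ! 0 + 1)"
proof -
  have uni: "k = i" if "k < length ts" "ts ! k = ts ! i" for k
    using nth_eq_iff_index_eq[OF assms(1) that(1) assms(2)] that(2) by simp
  show "next_in ts (ts ! i) = ts ! (Suc i mod length ts)"
    unfolding next_in_def
  proof (rule the_equality)
    show "\<exists>k<length ts. ts ! k = ts ! i \<and> ts ! (Suc i mod length ts) = ts ! (Suc k mod length ts)"
      using assms(2) by blast
  qed (use uni in blast)
  show "end_in ts (ts ! i) = (if Suc i < length ts then ts ! Suc i else ts ! 0 + 1)"
    unfolding end_in_def
  proof (rule the_equality)
    show "\<exists>k<length ts. ts ! k = ts ! i \<and> (if Suc i < length ts then ts ! Suc i else ts ! 0 + 1) =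
       (if Suc k < length ts then ts ! Suc k else ts ! 0 + 1)"
      using assms(2) by blast
  qed (use uni in blast)
qed

lemma next_in_props:
  assumes ts: "sorted ts" "distinct ts" "set ts \<subseteq> {0..<1}" and t: "t \<in> set ts"
  shows "t < end_in ts t" and "end_in ts t \<le> t + 1"
    and "next_in ts t \<in> set ts"
    and "next_in ts t = end_in ts t \<or> next_in ts t = end_in ts t - 1"
    and "\<And>u. u \<in> set ts \<Longrightarrow> \<not> (t < u \<and> u < end_in ts t)"
    and "\<And>u. u \<in> set ts \<Longrightarrow> \<not> (t < u + 1 \<and> u + 1 < end_in ts t)"
proof -
  obtain i where i: "i < length ts" "t = ts ! i" using t by (metis in_set_conv_nth)
  let ?r = "length ts"
  have rng: "0 \<le> ts ! k \<and> ts ! k < 1" if "k < ?r" for k using subsetD[OF ts(3) nth_mem[OF that]] by simp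
  have le: "ts ! k \<le> ts ! l" if "k \<le> l" "l < ?r" for k l using ts(1) that by (simp add: sorted_nth_mono)
  have lt: "ts ! k < ts ! l" if "k < l" "l < ?r" for k l
    using le[of k l] that nth_eq_iff_index_eq[OF ts(2), of k l] by (simp add: order_le_less)
  note nx = next_in_nth[OF ts(2) i(1), folded i(2)]
  show "t < end_in ts t"
  proof (cases "Suc i < ?r")
    case True
    then show ?thesis using lt[of i "Suc i"] i nx by simp
  next
    case False
    moreover have "0 < ?r" using i by linarith
    ultimately show ?thesis using rng[of i] rng[of 0] i nx by simp
  qed
  show "end_in ts t \<le> t + 1"
  proof (cases "Suc i < ?r")
    case True
    then show ?thesis using rng[of i] rng[of "Suc i"] i nx by simp
  next
    case False
    then show ?thesis using le[of 0 i] i nx by simp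
  qed
  show "next_in ts t \<in> set ts" using nx i by (auto intro!: nth_mem mod_less_divisor)
  show "next_in ts t = end_in ts t \<or> next_in ts t = end_in ts t - 1"
  proof (cases "Suc i < ?r")
    case False
    then have "Suc i = ?r" using i by simp
    then show ?thesis using nx by simp
  qed (use nx in simp)
  fix u assume "u \<in> set ts"
  then obtain k where k: "k < ?r" "u = ts ! k" by (metis in_set_conv_nth)
  show "\<not> (t < u \<and> u < end_in ts t)"
  proof
    assume tu: "t < u \<and> u < end_in ts t"
    then have "i < k" using le[of k i] k i by (meson not_le)
    then have "Suc i < ?r" "ts ! Suc i \<le> ts ! k" using k le[of "Suc i" k] by auto
    then show False using tu nx k by simp
  qed
  show "\<not> (t < u + 1 \<and> u + 1 < end_in ts t)"
  proof
    assume tu: "t < u + 1 \<and> u + 1 < end_in ts t"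
    show False
    proof (cases "Suc i < ?r")
      case True
      then show False using tu nx rng[of "Suc i"] rng[of k] k by simp
    next
      case False
      then show False using tu nx le[of 0 k] k by simp
    qed
  qed
qed

lemma next_in_bij:
  assumes "distinct ts"
  shows "bij_betw (next_in ts) (set ts) (set ts)"
proof -
  have "next_in ts ` set ts = set ts"
  proof
    show "next_in ts ` set ts \<subseteq> set ts"
    proof
      fix x assume "x \<in> next_in ts ` set ts"
      then obtain i where i: "i < length ts" "x = next_in ts (ts ! i)" by (auto simp: in_set_conv_nth)
      then have "Suc i mod length ts < length ts" by (intro mod_less_divisor) auto
      then show "x \<in> set ts" using next_in_nth(1)[OF assms i(1)] i(2) by simp
    qed
    show "set ts \<subseteq> next_in ts ` set ts"
    proof
      fix x assume "x \<in> set ts"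
      then obtain i where i: "i < length ts" "x = ts ! i" by (auto simp: in_set_conv_nth)
      define k where "k = (if i = 0 then length ts - 1 else i - 1)"
      have k: "k < length ts" "Suc k mod length ts = i" using i by (auto simp: k_def)
      then have "x = next_in ts (ts ! k)" using next_in_nth(1)[OF assms k(1)] i by simp
      then show "x \<in> next_in ts ` set ts" using k by auto
    qed
  qed
  moreover have "inj_on (next_in ts) (set ts)"
    by (rule eq_card_imp_inj_on) (simp_all add: calculation)
  ultimately show ?thesis by (simp add: bij_betw_def)
qed

lemma cyclic_flow_next_in:
  assumes "distinct ts" and "cyclic_flow p c (map f ts)" and "t \<in> set ts"
  shows "c (f t) = p (f (next_in ts t))"
proof -
  obtain i where i: "i < length ts" "t = ts ! i" using assms(3) by (metis in_set_conv_nth)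
  have "map c (map f ts) ! i = rotate1 (map p (map f ts)) ! i"
    using assms(2) by (simp add: cyclic_flow_def)
  then have "c (f t) = map p (map f ts) ! (Suc i mod length ts)"
    using i by (simp add: nth_rotate1)
  moreover have "Suc i mod length ts < length ts" using i by (intro mod_less_divisor) auto
  ultimately show ?thesis using next_in_nth(1)[OF assms(1) i(1)] i by simp
qed

text \<open>No time of the list, nor its translate by 1, lies inside an interval between consecutive
  times. This will show that different arcs of one component share no interior point.\<close>

lemma intervals_disjoint_mod_1:
  fixes t t' x x' :: real
  assumes ts: "sorted ts" "distinct ts" "set ts \<subseteq> {0..<1}" and t: "t \<in> set ts" "t' \<in> set ts"
    and x: "t < x" "x < end_in ts t" "t' < x'" "x' < end_in ts t'" and eq: "x = x' \<or> x = x' + 1 \<or> x' = x + 1"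
  shows "t = t'"
proof (rule ccontr)
  assume ne: "t \<noteq> t'"
  note P = next_in_props[OF ts t(1)] and P' = next_in_props[OF ts t(2)]
  have r: "0 \<le> t" "t < 1" "0 \<le> t'" "t' < 1" using ts(3) t by auto
  from eq show False
  proof (elim disjE)
    assume "x = x'"
    then show False using P(5)[OF t(2)] P'(5)[OF t(1)] x ne by linarith
  next
    assume "x = x' + 1"
    then show False using P(6)[OF t(2)] x r P(2) by linarith
  next
    assume "x' = x + 1"
    then show False using P'(6)[OF t(1)] x r P'(2) by linarith
  qed
qed

lemma Im_divide_det2: "Im (u / v) * (norm v)\<^sup>2 = - det2 u v" if "v \<noteq> 0"
proof -
  have "(norm v)\<^sup>2 \<noteq> 0" using that by simp
  then show ?thesis by (simp add: Im_divide det2_def cmod_power2)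
qed

text \<open>The quotient of two independent vectors is not real, so the exceptional case of
  \<open>Arg_inverse\<close> does not arise.\<close>

lemma Arg_inverse_det2:
  assumes "det2 u v \<noteq> 0"
  shows "Arg (v / u) = - Arg (u / v)" and "Arg (- v / u) = - Arg (- u / v)"
proof -
  have nz: "u \<noteq> 0" "v \<noteq> 0" using assms by (auto simp: det2_def)
  have "Im (u / v) \<noteq> 0" using Im_divide_det2[OF nz(2), of u] assms by auto
  then have "u / v \<notin> \<real>" "- u / v \<notin> \<real>" by (auto simp: complex_is_Real_iff)
  then have "Arg (inverse (u / v)) = - Arg (u / v)" "Arg (inverse (- u / v)) = - Arg (- u / v)"
    unfolding Arg_inverse by auto
  then show "Arg (v / u) = - Arg (u / v)" "Arg (- v / u) = - Arg (- u / v)" by simp_all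
qed

text \<open>Negation changes the principal argument by pi, in a direction that depends on the
  half-plane, hence on the orientation of the pair. This is how the sign of a crossing enters the
  computation.\<close>

lemma Arg_opposite_det2:
  assumes "det2 u v \<noteq> 0"
  shows "Arg (u / v) - Arg (- u / v) = - (pi * sgn (det2 u v))"
proof -
  have nz: "u \<noteq> 0" "v \<noteq> 0" using assms by (auto simp: det2_def)
  have I: "Im (u / v) * (norm v)\<^sup>2 = - det2 u v" by (rule Im_divide_det2[OF nz(2)])
  have n: "(norm v)\<^sup>2 > 0" using nz by simp
  have A: "Arg (- (u / v)) = (if Arg (u / v) \<le> 0 then Arg (u / v) + pi else Arg (u / v) - pi)"
    using nz by (intro Arg_minus) auto
  show ?thesis
  proof (cases "det2 u v > 0")
    case True
    then have "Im (u / v) < 0" using I n by (metis neg_less_0_iff_less zero_less_mult_pos2 mult_less_0_iff not_less_iff_gr_or_eq)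
    then have "Arg (u / v) < 0" using Arg_lt_pi Arg_less_0 by (meson Arg_neg_iff)
    then show ?thesis using A True by simp
  next
    case False
    then have "Im (u / v) > 0" using I n assms by (metis linorder_neqE_linordered_idom neg_0_less_iff_less zero_less_mult_pos2)
    then have "Arg (u / v) > 0" by (simp add: Arg_pos_iff)
    then show ?thesis using A False assms by simp
  qed
qed

section \<open>The arcs of a diagram between consecutive crossings\<close>

locale link =
  fixes D :: diagram
  assumes link: "link_diagram D"
begin

definition vel :: "nat \<Rightarrow> real \<Rightarrow> complex" where
  "vel j t = vector_derivative (curve D j) (at t)"

lemma curve_deriv: "j < ncomp D \<Longrightarrow> (curve D j has_vector_derivative vel j t) (at t)"
proof -
  assume "j < ncomp D"
  then have "smooth_curve (curve D j)" using link by (simp add: link_diagram_def)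
  then obtain E where E: "E 0 = curve D j" "\<And>m t. (E m has_vector_derivative E (Suc m) t) (at t)"
    unfolding smooth_curve_def by blast
  have "(curve D j has_vector_derivative E (Suc 0) t) (at t)" using E(2)[of 0] E(1) by simp
  then show ?thesis unfolding vel_def by (metis vector_derivative_at)
qed

lemma curve_periodic: "j < ncomp D \<Longrightarrow> curve D j (t + 1) = curve D j t"
  and vel_nonzero: "j < ncomp D \<Longrightarrow> vel j t \<noteq> 0"
  using link by (simp_all add: link_diagram_def vel_def)

lemma vel_periodic: "j < ncomp D \<Longrightarrow> vel j (t + 1) = vel j t"
proof -
  assume j: "j < ncomp D"
  have "((curve D j \<circ> (\<lambda>s. s + 1)) has_vector_derivative 1 *\<^sub>R vel j (t + 1)) (at t)"
    by (rule vector_diff_chain_at) (auto intro!: derivative_eq_intros curve_deriv j)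
  moreover have "curve D j \<circ> (\<lambda>s. s + 1) = curve D j" using curve_periodic[OF j] by auto
  ultimately have "(curve D j has_vector_derivative vel j (t + 1)) (at t)" by simp
  then show ?thesis using curve_deriv[OF j, of t] vector_derivative_unique_at by blast
qed

lemma finite_crossings: "finite (crossings D)"
  and card_branches: "p \<in> crossings D \<Longrightarrow> card (branches D p) = 2"
  and transversal: "p \<in> crossings D \<Longrightarrow> a \<in> branches D p \<Longrightarrow> b \<in> branches D p \<Longrightarrow> a \<noteq> b \<Longrightarrow>
    det2 (tangent D a) (tangent D b) \<noteq> 0"
  and over_in: "p \<in> crossings D \<Longrightarrow> over_branch D p \<in> branches D p"
  using link by (simp_all add: link_diagram_def)

definition Br :: "(nat \<times> real) set" where
  "Br = (\<Union>p\<in>crossings D. branches D p)"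

definition pt :: "nat \<times> real \<Rightarrow> complex" where
  "pt b = curve D (fst b) (snd b)"

definition times :: "nat \<Rightarrow> real list" where
  "times j = sorted_list_of_set {t. 0 \<le> t \<and> t < 1 \<and> curve D j t \<in> crossings D}"

lemma finite_branches: "p \<in> crossings D \<Longrightarrow> finite (branches D p)"
  using card_branches by (metis card.infinite zero_neq_numeral)

lemma finite_Br: "finite Br"
  unfolding Br_def using finite_crossings finite_branches by blast

lemma Br_iff: "(j, t) \<in> Br \<longleftrightarrow> j < ncomp D \<and> 0 \<le> t \<and> t < 1 \<and> curve D j t \<in> crossings D"
  unfolding Br_def branches_def by auto

lemma branches_pt: "b \<in> branches D p \<Longrightarrow> pt b = p"
  unfolding branches_def pt_def by auto

lemma Br_branches: "b \<in> Br \<longleftrightarrow> pt b \<in> crossings D \<and> b \<in> branches D (pt b)"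
  unfolding Br_def using branches_pt by blast

lemma set_times: "j < ncomp D \<Longrightarrow> set (times j) = {t. (j, t) \<in> Br}"
proof -
  assume j: "j < ncomp D"
  have "(\<lambda>t. (j, t)) ` {t. 0 \<le> t \<and> t < 1 \<and> curve D j t \<in> crossings D} \<subseteq> Br"
    using j by (auto simp: Br_iff)
  then have "finite ((\<lambda>t. (j, t)) ` {t. 0 \<le> t \<and> t < 1 \<and> curve D j t \<in> crossings D})"
    using finite_Br finite_subset by blast
  then have "finite {t. 0 \<le> t \<and> t < 1 \<and> curve D j t \<in> crossings D}"
    by (rule finite_imageD) (simp add: inj_on_def)
  then show ?thesis using j by (simp add: times_def Br_iff)
qed

lemma times_props: "sorted (times j)" "distinct (times j)" "j < ncomp D \<Longrightarrow> set (times j) \<subseteq> {0..<1}"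
  by (simp_all add: times_def) (use set_times in \<open>auto simp: times_def[symmetric] Br_iff\<close>)

definition nx :: "nat \<times> real \<Rightarrow> nat \<times> real" where
  "nx b = (fst b, next_in (times (fst b)) (snd b))"

definition en :: "nat \<times> real \<Rightarrow> real" where
  "en b = end_in (times (fst b)) (snd b)"

definition A :: "nat \<times> real \<Rightarrow> real \<Rightarrow> complex" where
  "A b s = curve D (fst b) (snd b + s * (en b - snd b))"

lemma Br_times: "b \<in> Br \<longleftrightarrow> fst b < ncomp D \<and> snd b \<in> set (times (fst b))"
  by (cases b) (use set_times Br_iff in auto)

lemma nx_props:
  assumes "b \<in> Br"
  shows "snd b < en b" "en b \<le> snd b + 1" "nx b \<in> Br" "pt (nx b) = curve D (fst b) (en b)"
    "tangent D (nx b) = vel (fst b) (en b)"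
proof -
  have b: "fst b < ncomp D" "snd b \<in> set (times (fst b))" using assms Br_times by auto
  note P = next_in_props[OF times_props(1,2) times_props(3)[OF b(1)] b(2)]
  show "snd b < en b" "en b \<le> snd b + 1" using P by (simp_all add: en_def)
  show "nx b \<in> Br" using P(3) b(1) Br_times by (simp add: nx_def)
  have "snd (nx b) = en b \<or> snd (nx b) + 1 = en b" using P(4) by (auto simp: nx_def en_def)
  then show "pt (nx b) = curve D (fst b) (en b)" "tangent D (nx b) = vel (fst b) (en b)"
    using curve_periodic[OF b(1), of "snd (nx b)"] vel_periodic[OF b(1), of "snd (nx b)"]
    by (auto simp: pt_def nx_def tangent_def vel_def)
qed

lemma nx_bij: "bij_betw nx Br Br"
proof -
  have inj: "inj_on nx Br"
  proof (rule inj_onI)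
    fix x y assume xy: "x \<in> Br" "y \<in> Br" "nx x = nx y"
    then have f: "fst x = fst y" by (simp add: nx_def)
    have "inj_on (next_in (times (fst x))) (set (times (fst x)))"
      using next_in_bij[OF times_props(2)] by (simp add: bij_betw_def)
    then have "snd x = snd y"
      by (rule inj_onD) (use xy f in \<open>simp_all add: nx_def Br_times\<close>)
    with f show "x = y" by (simp add: prod_eq_iff)
  qed
  have "nx ` Br \<subseteq> Br" using nx_props(3) by auto
  then have "nx ` Br = Br" using inj finite_Br endo_inj_surj by blast
  with inj show ?thesis by (simp add: bij_betw_def)
qed

lemma A_ends: "b \<in> Br \<Longrightarrow> A b 0 = pt b" "b \<in> Br \<Longrightarrow> A b 1 = pt (nx b)"
  using nx_props(4) by (simp_all add: A_def pt_def)

lemma arc_A: "b \<in> Br \<Longrightarrow> arc (A b) ((en b - snd b) *\<^sub>R tangent D b) ((en b - snd b) *\<^sub>R tangent D (nx b))"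
proof -
  assume b: "b \<in> Br"
  have j: "fst b < ncomp D" using b Br_times by blast
  have d: "(A b has_vector_derivative (en b - snd b) *\<^sub>R vel (fst b) (snd b + s * (en b - snd b))) (at s)" for s
  proof -
    have "((curve D (fst b) \<circ> (\<lambda>s. snd b + s * (en b - snd b))) has_vector_derivative
        (en b - snd b) *\<^sub>R vel (fst b) (snd b + s * (en b - snd b))) (at s)"
      by (rule vector_diff_chain_at) (auto intro!: derivative_eq_intros curve_deriv j)
    then show ?thesis by (simp add: A_def[abs_def] o_def)
  qed
  have "continuous_on {0..1} (A b)"
    using d by (intro continuous_at_imp_continuous_on ballI) (blast intro: has_vector_derivative_continuous)
  moreover have "tangent D b = vel (fst b) (snd b)" by (simp add: tangent_def vel_def)
  moreover note nx_props[OF b]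
  ultimately show ?thesis
    using d[of 0] d[of 1] vel_nonzero[OF j] by (auto simp: arc_def intro: has_vector_derivative_at_within)
qed

text \<open>Reduced modulo 1, the two parameters are branches at the same point, and a point that is
  no crossing has only one. The bound 2 suffices because arcs start before 1 and last at most
  1.\<close>

lemma crossing_point_branch:
  assumes "j < ncomp D" and "curve D j x \<notin> crossings D" and "j' < ncomp D" and "curve D j x = curve D j' x'"
    and "0 \<le> x" "x < 2" "0 \<le> x'" "x' < 2"
  shows "j = j'" and "x = x' \<or> x = x' + 1 \<or> x' = x + 1"
proof -
  define f where "f y = (if y < 1 then y else y - 1)" for y :: real
  have f: "0 \<le> f y \<and> f y < 1 \<and> curve D i (f y) = curve D i y" if "i < ncomp D" "0 \<le> y" "y < 2" for i y
    using that curve_periodic[OF that(1), of "y - 1"] by (auto simp: f_def)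
  have "(j, f x) \<in> branches D (curve D j x)" "(j', f x') \<in> branches D (curve D j x)"
    using f[of j x] f[of j' x'] assms by (auto simp: branches_def)
  with assms(2) have "(j, f x) = (j', f x')" unfolding crossings_def by blast
  then show "j = j'" "x = x' \<or> x = x' + 1 \<or> x' = x + 1" by (auto simp: f_def split: if_splits)
qed

lemma interior_not_crossing:
  assumes b: "b \<in> Br" and x: "snd b < x" "x < en b"
  shows "curve D (fst b) x \<notin> crossings D"
proof
  assume c: "curve D (fst b) x \<in> crossings D"
  have j: "fst b < ncomp D" "snd b \<in> set (times (fst b))" using b Br_times by auto
  note P = next_in_props[OF times_props(1,2) times_props(3)[OF j(1)] j(2)]
  have s: "0 \<le> snd b" "snd b < 1" using times_props(3)[OF j(1)] j(2) by auto
  show False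
  proof (cases "x < 1")
    case True
    then have "x \<in> set (times (fst b))" using s x c j by (simp add: set_times Br_iff)
    from P(5)[OF this] show False using x by (simp add: en_def)
  next
    case False
    have "curve D (fst b) (x - 1) \<in> crossings D" using curve_periodic[OF j(1), of "x - 1"] c by simp
    then have "x - 1 \<in> set (times (fst b))" using s x j P(2) False by (simp add: set_times Br_iff en_def)
    from P(6)[OF this] show False using x by (simp add: en_def)
  qed
qed

lemma arcs_meet:
  assumes b: "b \<in> Br" "b' \<in> Br" "b \<noteq> b'" and s: "s \<in> {0..1}" "s' \<in> {0..1}" and eq: "A b s = A b' s'"
  shows "s \<in> {0, 1}"
proof (rule ccontr)
  assume "s \<notin> {0, 1}"
  with s have s01: "0 < s" "s < 1" by auto
  define x where "x = snd b + s * (en b - snd b)"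
  define x' where "x' = snd b' + s' * (en b' - snd b')"
  have r: "0 \<le> snd b" "snd b < 1" "0 \<le> snd b'" "snd b' < 1" using b Br_iff by (metis prod.collapse)+
  have x: "snd b < x" "x < en b"
  proof -
    define d where "d = en b - snd b"
    have d: "d > 0" using nx_props(1)[OF b(1)] by (simp add: d_def)
    then have "0 < s * d" "s * d < d" using s01 by simp_all
    moreover have "x = snd b + s * d" "en b = snd b + d" by (simp_all add: x_def d_def)
    ultimately show "snd b < x" "x < en b" by simp_all
  qed
  have x': "snd b' \<le> x'" "x' \<le> en b'"
  proof -
    define d where "d = en b' - snd b'"
    have d: "d > 0" using nx_props(1)[OF b(2)] by (simp add: d_def)
    then have "0 \<le> s' * d" "s' * d \<le> d" using s by (simp_all add: mult_left_le_one_le)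
    moreover have "x' = snd b' + s' * d" "en b' = snd b' + d" by (simp_all add: x'_def d_def)
    ultimately show "snd b' \<le> x'" "x' \<le> en b'" by simp_all
  qed
  have nc: "curve D (fst b) x \<notin> crossings D" by (rule interior_not_crossing[OF b(1) x])
  have e: "curve D (fst b) x = curve D (fst b') x'" using eq by (simp add: A_def x_def x'_def)
  have j: "fst b < ncomp D" "fst b' < ncomp D" "snd b \<in> set (times (fst b))" "snd b' \<in> set (times (fst b'))"
    using b Br_times by auto
  \<comment> \<open>Both ends of an arc are crossings, while the common point is none.\<close>
  have "x' \<noteq> snd b'" using e nc b(2) by (auto simp: Br_branches pt_def)
  moreover have "x' \<noteq> en b'" using e nc nx_props(3,4)[OF b(2)] by (auto simp: Br_branches)
  ultimately have x'': "snd b' < x'" "x' < en b'" using x' by auto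
  have lt2: "x < 2" "x' < 2" using x x' r nx_props(2)[OF b(1)] nx_props(2)[OF b(2)] by linarith+
  have cp: "fst b = fst b'" "x = x' \<or> x = x' + 1 \<or> x' = x + 1"
    by (rule crossing_point_branch[OF j(1) nc j(2) e]; use x x'' r lt2 in linarith)+
  have "snd b = snd b'"
    by (rule intervals_disjoint_mod_1[OF times_props(1,2) times_props(3)[OF j(1)] j(3) _ x[unfolded en_def] x''[unfolded en_def cp(1)[symmetric]] cp(2)])
      (use j cp in simp)
  with cp(1) b(3) show False by (simp add: prod_eq_iff)
qed

lemma tangent_nonzero: "b \<in> Br \<Longrightarrow> tangent D b \<noteq> 0"
  using vel_nonzero Br_times by (simp add: tangent_def vel_def)

lemma not_same_ray:
  assumes "b \<in> Br" "b' \<in> Br" "pt b = pt b'" "b \<noteq> b'" "r \<noteq> 0" "r' \<noteq> 0"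
  shows "\<not> same_ray (r *\<^sub>R tangent D b) (r' *\<^sub>R tangent D b')"
proof
  assume "same_ray (r *\<^sub>R tangent D b) (r' *\<^sub>R tangent D b')"
  then obtain q where "r *\<^sub>R tangent D b = of_real q * (r' *\<^sub>R tangent D b')" by (auto simp: same_ray_def)
  then have e: "r * Re (tangent D b) = q * r' * Re (tangent D b')" "r * Im (tangent D b) = q * r' * Im (tangent D b')"
    by (auto simp: complex_eq_iff)
  have "r * det2 (tangent D b) (tangent D b') = (r * Re (tangent D b)) * Im (tangent D b') - (r * Im (tangent D b)) * Re (tangent D b')"
    by (simp add: det2_def algebra_simps)
  also have "\<dots> = 0" unfolding e by simp
  finally have "det2 (tangent D b) (tangent D b') = 0" using assms(5) by simp
  moreover have "b \<in> branches D (pt b)" "b' \<in> branches D (pt b)" "pt b \<in> crossings D" using assms Br_branches by metis+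
  ultimately show False using transversal assms(4) by blast
qed

lemma not_same_ray_opposite:
  assumes "b \<in> Br" "r > 0" "r' > 0"
  shows "\<not> same_ray (- (r *\<^sub>R tangent D b)) (r' *\<^sub>R tangent D b)" "\<not> same_ray (r *\<^sub>R tangent D b) (- (r' *\<^sub>R tangent D b))"
proof -
  have t: "tangent D b \<noteq> 0" using tangent_nonzero[OF assms(1)] .
  have 1: "(r + q * r') *\<^sub>R tangent D b \<noteq> 0" if "q > 0" for q
  proof -
    have "r + q * r' > 0" using assms that by (simp add: add_pos_pos)
    then show ?thesis using t by simp
  qed
  show "\<not> same_ray (- (r *\<^sub>R tangent D b)) (r' *\<^sub>R tangent D b)"
    unfolding same_ray_def
  proof
    assume "\<exists>q>0. - (r *\<^sub>R tangent D b) = of_real q * (r' *\<^sub>R tangent D b)"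
    then obtain q where q: "q > 0" "- (r *\<^sub>R tangent D b) = of_real q * (r' *\<^sub>R tangent D b)" by blast
    have "(r + q * r') *\<^sub>R tangent D b = r *\<^sub>R tangent D b + of_real q * (r' *\<^sub>R tangent D b)"
      by (simp add: scaleR_conv_of_real algebra_simps)
    also have "\<dots> = r *\<^sub>R tangent D b + - (r *\<^sub>R tangent D b)" using q(2) by simp
    finally have "(r + q * r') *\<^sub>R tangent D b = r *\<^sub>R tangent D b + - (r *\<^sub>R tangent D b)" .
    then show False using 1[OF q(1)] by simp
  qed
  show "\<not> same_ray (r *\<^sub>R tangent D b) (- (r' *\<^sub>R tangent D b))"
    unfolding same_ray_def
  proof
    assume "\<exists>q>0. r *\<^sub>R tangent D b = of_real q * (- (r' *\<^sub>R tangent D b))"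
    then obtain q where q: "q > 0" "r *\<^sub>R tangent D b = of_real q * (- (r' *\<^sub>R tangent D b))" by blast
    have "(r + q * r') *\<^sub>R tangent D b = r *\<^sub>R tangent D b + (q * r') *\<^sub>R tangent D b"
      by (rule scaleR_add_left)
    also have "\<dots> = of_real q * (- (r' *\<^sub>R tangent D b)) + (q * r') *\<^sub>R tangent D b"
      by (simp only: q(2))
    also have "\<dots> = 0" by (simp add: scaleR_conv_of_real)
    finally show False using 1[OF q(1)] by simp
  qed
qed

text \<open>
  \<open>A b\<close> is the arc from the branch \<open>b\<close> to the next one; \<open>ph\<close> is the corner between two arcs that both
  leave or both enter a crossing, \<open>ps\<close> the corner between an entering and a leaving one.
\<close>

definition th :: "nat \<times> real \<Rightarrow> nat \<times> real \<Rightarrow> real" where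
  "th b b' = turn (\<lambda>s. A b s - pt b')"

definition ph :: "nat \<times> real \<Rightarrow> nat \<times> real \<Rightarrow> real" where
  "ph b b' = (if pt b = pt b' \<and> b \<noteq> b' then Arg (- tangent D b / tangent D b') else 0)"

definition ps :: "nat \<times> real \<Rightarrow> nat \<times> real \<Rightarrow> real" where
  "ps b b' = (if pt b = pt b' \<and> b \<noteq> b' then Arg (tangent D b / tangent D b') else 0)"

lemma ph_antisym: "b \<in> Br \<Longrightarrow> b' \<in> Br \<Longrightarrow> ph b' b = - ph b b'"
  and ps_antisym: "b \<in> Br \<Longrightarrow> b' \<in> Br \<Longrightarrow> ps b' b = - ps b b'"
proof -
  assume b: "b \<in> Br" "b' \<in> Br"
  have "det2 (tangent D b) (tangent D b') \<noteq> 0" if "pt b = pt b'" "b \<noteq> b'"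
    using transversal[of "pt b" b b'] b that Br_branches by metis
  then have "Arg (tangent D b' / tangent D b) = - Arg (tangent D b / tangent D b')"
    "Arg (- tangent D b' / tangent D b) = - Arg (- tangent D b / tangent D b')" if "pt b = pt b'" "b \<noteq> b'"
    using Arg_inverse_det2[of "tangent D b" "tangent D b'"] that by blast+
  then show "ph b' b = - ph b b'" "ps b' b = - ps b b'"
    by (cases "pt b = pt b' \<and> b \<noteq> b'"; force simp: ph_def ps_def)+
qed

lemma scaled_Arg: "r > 0 \<Longrightarrow> r' > 0 \<Longrightarrow> Arg ((r *\<^sub>R u) / (r' *\<^sub>R v)) = Arg (u / v)"
proof -
  assume r: "r > 0" "r' > 0"
  have "(r *\<^sub>R u) / (r' *\<^sub>R v) = of_real (r / r') * (u / v)"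
    by (simp add: scaleR_conv_of_real)
  then show ?thesis using r by (simp only: Arg_times_of_real divide_pos_pos)
qed

text \<open>For different branches this is \<open>arcs_relation\<close> with the corner angles
  rewritten. An arc cannot be compared with itself in that way, but then the turns cancel, and the
  corner terms cancel by antisymmetry.\<close>

lemma arcs_sum:
  assumes b: "b \<in> Br" "b' \<in> Br"
  shows "th b b' - th b (nx b') + th b' (nx b) - th b' b = ps (nx b) b' + ps b (nx b') - ph b b' - ph (nx b) (nx b')"
proof (cases "b = b'")
  case True
  then show ?thesis using ps_antisym[OF b(1) nx_props(3)[OF b(1)]] by (simp add: ph_def)
next
  case False
  define r where "r = en b - snd b"
  define r' where "r' = en b' - snd b'"
  have r: "r > 0" "r' > 0" using nx_props(1) b by (auto simp: r_def r'_def)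
  note n = nx_props(3)[OF b(1)] nx_props(3)[OF b(2)]
  have nn: "nx b \<noteq> nx b'" using nx_bij b False by (auto simp: bij_betw_def inj_on_def)
  have ca: "corner_angle x (r *\<^sub>R u) y (r' *\<^sub>R v) = (if x = y then Arg (- u / v) else 0)"
    "corner_angle x (- (r *\<^sub>R u)) y (r' *\<^sub>R v) = (if x = y then Arg (u / v) else 0)"
    "corner_angle x (r *\<^sub>R u) y (- (r' *\<^sub>R v)) = (if x = y then Arg (u / v) else 0)"
    "corner_angle x (- (r *\<^sub>R u)) y (- (r' *\<^sub>R v)) = (if x = y then Arg (- u / v) else 0)" for x y u v
    using scaled_Arg[OF r, of "- u" v] scaled_Arg[OF r, of u v] by (simp_all add: corner_angle_def)
  \<comment> \<open>Where one arc ends and the other continues it on the same branch, the angle is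
    \<open>Arg 1\<close>, that is 0, in agreement with the convention in \<open>ps\<close>.\<close>
  have tt: "Arg (tangent D c / tangent D c) = 0" if "c \<in> Br" for c using tangent_nonzero[OF that] by simp
  have neg: "- (r' *\<^sub>R x) = (- r') *\<^sub>R x" "- (r *\<^sub>R x) = (- r) *\<^sub>R x" for x :: complex by simp_all
  have "turn (\<lambda>s. A b s - A b' 0) - turn (\<lambda>s. A b s - A b' 1) + turn (\<lambda>t. A b' t - A b 1) - turn (\<lambda>t. A b' t - A b 0) =
    corner_angle (A b 1) (- (r *\<^sub>R tangent D (nx b))) (A b' 0) (r' *\<^sub>R tangent D b') +
    corner_angle (A b 0) (r *\<^sub>R tangent D b) (A b' 1) (- (r' *\<^sub>R tangent D (nx b'))) -
    corner_angle (A b 0) (r *\<^sub>R tangent D b) (A b' 0) (r' *\<^sub>R tangent D b') -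
    corner_angle (A b 1) (- (r *\<^sub>R tangent D (nx b))) (A b' 1) (- (r' *\<^sub>R tangent D (nx b')))"
  proof (rule arcs_relation)
    show "arc (A b) (r *\<^sub>R tangent D b) (r *\<^sub>R tangent D (nx b))" using arc_A[OF b(1)] by (simp add: r_def)
    show "arc (A b') (r' *\<^sub>R tangent D b') (r' *\<^sub>R tangent D (nx b'))" using arc_A[OF b(2)] by (simp add: r'_def)
    show "s \<in> {0, 1} \<and> t \<in> {0, 1}" if "s \<in> {0..1}" "t \<in> {0..1}" "A b s = A b' t" for s t
      using arcs_meet[OF b False that] arcs_meet[OF b(2,1) False[symmetric] that(2,1) that(3)[symmetric]] by blast
    show "\<not> same_ray (r *\<^sub>R tangent D b) (r' *\<^sub>R tangent D b')" if "A b 0 = A b' 0"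
      using not_same_ray[OF b _ False] that r by (simp add: A_ends b)
    show "\<not> same_ray (- (r *\<^sub>R tangent D (nx b))) (r' *\<^sub>R tangent D b')" if "A b 1 = A b' 0"
    proof (cases "nx b = b'")
      case True
      then show ?thesis using not_same_ray_opposite(1)[OF b(2) r] by simp
    next
      case F: False
      then show ?thesis using not_same_ray[OF n(1) b(2) _ F, of "- r" r'] that r by (simp add: A_ends b)
    qed
    show "\<not> same_ray (r *\<^sub>R tangent D b) (- (r' *\<^sub>R tangent D (nx b')))" if "A b 0 = A b' 1"
    proof (cases "b = nx b'")
      case True
      then show ?thesis using not_same_ray_opposite(2)[OF b(1) r] by simp
    next
      case F: False
      then show ?thesis using not_same_ray[OF b(1) n(2) _ F, of r "- r'"] that r by (simp add: A_ends b)
    qed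
    show "\<not> same_ray (- (r *\<^sub>R tangent D (nx b))) (- (r' *\<^sub>R tangent D (nx b')))" if "A b 1 = A b' 1"
      using not_same_ray[OF n _ nn, of "- r" "- r'"] that r by (simp add: A_ends b)
  qed
  moreover have "(if pt (nx b) = pt b' then Arg (tangent D (nx b) / tangent D b') else 0) = ps (nx b) b'"
    using tt[OF n(1)] by (auto simp: ps_def)
  moreover have "(if pt b = pt (nx b') then Arg (tangent D b / tangent D (nx b')) else 0) = ps b (nx b')"
    using tt[OF b(1)] by (auto simp: ps_def)
  moreover have "(if pt b = pt b' then Arg (- tangent D b / tangent D b') else 0) = ph b b'"
    using False by (auto simp: ph_def)
  moreover have "(if pt (nx b) = pt (nx b') then Arg (- tangent D (nx b) / tangent D (nx b')) else 0) = ph (nx b) (nx b')"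
    using nn by (auto simp: ph_def)
  ultimately show ?thesis by (simp only: ca th_def A_ends[OF b(1)] A_ends[OF b(2)])
qed

end

section \<open>Summation over all pairs of arcs\<close>

context link
begin

lemma sum_Br: "(\<Sum>b\<in>Br. f b) = (\<Sum>x\<in>crossings D. \<Sum>b\<in>branches D x. f b)"
  unfolding Br_def
proof (rule sum.UNION_disjoint)
  show "\<forall>x\<in>crossings D. \<forall>y\<in>crossings D. x \<noteq> y \<longrightarrow> branches D x \<inter> branches D y = {}"
  proof (intro ballI impI equals0I)
    fix x y b assume "x \<noteq> y" "b \<in> branches D x \<inter> branches D y"
    then show False using branches_pt[of b x] branches_pt[of b y] by simp
  qed
qed (use finite_crossings finite_branches in auto)

lemma sum_nx: "(\<Sum>b\<in>Br. f (nx b)) = (\<Sum>b\<in>Br. f b)"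
  by (rule sum.reindex_bij_betw[OF nx_bij])

text \<open>Summation by parts: shifting along \<open>nx\<close> turns \<open>d\<close> into
  \<open>q\<close>. The remaining factor \<open>d b' - q b'\<close> sums to 0 at each crossing,
  while \<open>th b b'\<close> depends on \<open>b'\<close> only through its point.\<close>

lemma sum_th:
  fixes d q :: "nat \<times> real \<Rightarrow> real"
  assumes "\<And>b. b \<in> Br \<Longrightarrow> d b = q (nx b)" and "\<And>x. x \<in> crossings D \<Longrightarrow> (\<Sum>b\<in>branches D x. d b - q b) = 0"
  shows "(\<Sum>b'\<in>Br. d b' * (th b b' - th b (nx b'))) = 0"
proof -
  have "(\<Sum>b'\<in>Br. d b' * th b (nx b')) = (\<Sum>b'\<in>Br. q (nx b') * th b (nx b'))"
    using assms(1) by (intro sum.cong) auto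
  also have "\<dots> = (\<Sum>b'\<in>Br. q b' * th b b')" by (rule sum_nx)
  finally have "(\<Sum>b'\<in>Br. d b' * (th b b' - th b (nx b'))) = (\<Sum>b'\<in>Br. (d b' - q b') * th b b')"
    by (simp add: right_diff_distrib left_diff_distrib sum_subtractf)
  also have "\<dots> = (\<Sum>x\<in>crossings D. \<Sum>b'\<in>branches D x. (d b' - q b') * th b b')" by (rule sum_Br)
  also have "\<dots> = (\<Sum>x\<in>crossings D. 0)"
  proof (rule sum.cong[OF refl])
    fix x assume x: "x \<in> crossings D"
    have "(\<Sum>b'\<in>branches D x. (d b' - q b') * th b b') = (\<Sum>b'\<in>branches D x. (d b' - q b') * turn (\<lambda>s. A b s - x))"
      by (rule sum.cong) (simp_all add: th_def branches_pt)
    also have "\<dots> = 0" using assms(2)[OF x] by (simp flip: sum_distrib_right)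
    finally show "(\<Sum>b'\<in>branches D x. (d b' - q b') * th b b') = 0" .
  qed
  finally show ?thesis by simp
qed

text \<open>Multiply \<open>arcs_sum\<close> by \<open>c b * d b'\<close> and sum over all pairs.
  The turns disappear by \<open>sum_th\<close>; in the corner terms each occurrence of
  \<open>nx\<close> is removed by reindexing, which replaces \<open>c\<close> by \<open>p\<close> or
  \<open>d\<close> by \<open>q\<close>. Corner terms at different points are 0 by
  definition.\<close>

lemma sum_corners:
  fixes c p d q :: "nat \<times> real \<Rightarrow> real"
  assumes c: "\<And>b. b \<in> Br \<Longrightarrow> c b = p (nx b)" "\<And>x. x \<in> crossings D \<Longrightarrow> (\<Sum>b\<in>branches D x. c b - p b) = 0"
    and d: "\<And>b. b \<in> Br \<Longrightarrow> d b = q (nx b)" "\<And>x. x \<in> crossings D \<Longrightarrow> (\<Sum>b\<in>branches D x. d b - q b) = 0"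
  shows "(\<Sum>x\<in>crossings D. \<Sum>b\<in>branches D x. \<Sum>b'\<in>branches D x.
     (p b * d b' + c b * q b') * ps b b' - (c b * d b' + p b * q b') * ph b b') = 0"
proof -
  have nxc: "(\<Sum>b\<in>Br. c b * f (nx b)) = (\<Sum>b\<in>Br. p b * f b)" for f
    using sum_nx[of "\<lambda>b. p b * f b"] c(1) by simp
  have nxd: "(\<Sum>b\<in>Br. d b * f (nx b)) = (\<Sum>b\<in>Br. q b * f b)" for f
    using sum_nx[of "\<lambda>b. q b * f b"] d(1) by simp
  have "(\<Sum>b\<in>Br. \<Sum>b'\<in>Br. c b * d b' * (th b b' - th b (nx b') + th b' (nx b) - th b' b)) =
    (\<Sum>b\<in>Br. c b * (\<Sum>b'\<in>Br. d b' * (th b b' - th b (nx b')))) -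
    (\<Sum>b\<in>Br. \<Sum>b'\<in>Br. d b' * (c b * (th b' b - th b' (nx b))))"
    by (simp add: sum_distrib_left sum_subtractf[symmetric] algebra_simps)
  also have "(\<Sum>b\<in>Br. \<Sum>b'\<in>Br. d b' * (c b * (th b' b - th b' (nx b)))) =
    (\<Sum>b'\<in>Br. d b' * (\<Sum>b\<in>Br. c b * (th b' b - th b' (nx b))))"
    by (subst sum.swap) (simp add: sum_distrib_left)
  finally have 0: "(\<Sum>b\<in>Br. \<Sum>b'\<in>Br. c b * d b' * (th b b' - th b (nx b') + th b' (nx b) - th b' b)) = 0"
    using sum_th[OF c] sum_th[OF d] by simp
  have "(\<Sum>b\<in>Br. \<Sum>b'\<in>Br. c b * d b' * (th b b' - th b (nx b') + th b' (nx b) - th b' b)) =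
    (\<Sum>b\<in>Br. \<Sum>b'\<in>Br. c b * d b' * (ps (nx b) b' + ps b (nx b') - ph b b' - ph (nx b) (nx b')))"
    by (intro sum.cong refl) (simp add: arcs_sum)
  also have "\<dots> = (\<Sum>b\<in>Br. \<Sum>b'\<in>Br. c b * d b' * ps (nx b) b') + (\<Sum>b\<in>Br. \<Sum>b'\<in>Br. c b * d b' * ps b (nx b'))
      - (\<Sum>b\<in>Br. \<Sum>b'\<in>Br. c b * d b' * ph b b') - (\<Sum>b\<in>Br. \<Sum>b'\<in>Br. c b * d b' * ph (nx b) (nx b'))"
    by (simp add: right_diff_distrib distrib_left sum.distrib sum_subtractf)
  also have "(\<Sum>b\<in>Br. \<Sum>b'\<in>Br. c b * d b' * ps (nx b) b') = (\<Sum>b\<in>Br. \<Sum>b'\<in>Br. p b * d b' * ps b b')"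
    using nxc[of "\<lambda>b. \<Sum>b'\<in>Br. d b' * ps b b'"] by (simp add: sum_distrib_left mult.assoc)
  also have "(\<Sum>b\<in>Br. \<Sum>b'\<in>Br. c b * d b' * ps b (nx b')) = (\<Sum>b\<in>Br. \<Sum>b'\<in>Br. c b * q b' * ps b b')"
    using nxd by (simp add: mult.assoc flip: sum_distrib_left)
  also have "(\<Sum>b\<in>Br. \<Sum>b'\<in>Br. c b * d b' * ph (nx b) (nx b')) = (\<Sum>b\<in>Br. \<Sum>b'\<in>Br. p b * q b' * ph b b')"
    using nxc[of "\<lambda>b. \<Sum>b'\<in>Br. q b' * ph b b'"] nxd by (simp add: mult.assoc flip: sum_distrib_left)
  finally have "(\<Sum>b\<in>Br. \<Sum>b'\<in>Br. (p b * d b' + c b * q b') * ps b b' - (c b * d b' + p b * q b') * ph b b') = 0"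
    unfolding 0 by (simp add: distrib_right sum.distrib sum_subtractf)
  moreover have "(\<Sum>b'\<in>Br. (p b * d b' + c b * q b') * ps b b' - (c b * d b' + p b * q b') * ph b b') =
    (\<Sum>b'\<in>branches D x. (p b * d b' + c b * q b') * ps b b' - (c b * d b' + p b * q b') * ph b b')"
    if x: "x \<in> crossings D" "b \<in> branches D x" for x b
  proof (rule sum.mono_neutral_right[OF finite_Br])
    show "branches D x \<subseteq> Br" using x(1) by (auto simp: Br_def)
    show "\<forall>b'\<in>Br - branches D x. (p b * d b' + c b * q b') * ps b b' - (c b * d b' + p b * q b') * ph b b' = 0"
    proof
      fix b' assume b': "b' \<in> Br - branches D x"
      then have "pt b' \<noteq> pt b" using Br_branches branches_pt[OF x(2)] by auto
      then show "(p b * d b' + c b * q b') * ps b b' - (c b * d b' + p b * q b') * ph b b' = 0"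
        by (simp add: ph_def ps_def)
    qed
  qed
  ultimately show ?thesis by (simp add: sum_Br)
qed

lemma branches_over_under:
  assumes "x \<in> crossings D"
  shows "branches D x = {over_branch D x, under_branch D x}" "over_branch D x \<noteq> under_branch D x"
proof -
  obtain a b where ab: "branches D x = {a, b}" "a \<noteq> b"
    using card_branches[OF assms] by (auto simp: card_2_iff)
  have "over_branch D x = a \<or> over_branch D x = b" using over_in[OF assms] ab(1) by simp
  then obtain u where u: "branches D x = {over_branch D x, u}" "over_branch D x \<noteq> u"
    using ab that[of a] that[of b] by (elim disjE) (simp_all add: insert_commute)
  have "under_branch D x = u" unfolding under_branch_def by (rule the_equality) (use u in auto)
  with u show "branches D x = {over_branch D x, under_branch D x}" "over_branch D x \<noteq> under_branch D x" by simp_all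
qed

text \<open>Substituting the conservation laws makes the coefficients of \<open>ps\<close> and
  \<open>ph\<close> equal up to sign. Since \<open>ps\<close> and \<open>ph\<close> differ by pi
  times the crossing sign, the unknown angle itself drops out.\<close>

lemma crossing_sum:
  fixes c p d q :: "nat \<times> real \<Rightarrow> real"
  assumes x: "x \<in> crossings D" and ou: "ov = over_branch D x" "un = under_branch D x"
    and c: "c ov + c un = p ov + p un" and d: "d ov + d un = q ov + q un"
  shows "(\<Sum>b\<in>branches D x. \<Sum>b'\<in>branches D x.
     (p b * d b' + c b * q b') * ps b b' - (c b * d b' + p b * q b') * ph b b') =
     - (pi * real_of_int (sign_val (crossing_sign D x)) * (c ov * d un + p ov * q un - c un * d ov - p un * q ov))"
proof -
  note B = branches_over_under[OF x, folded ou]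
  have Brs: "ov \<in> Br" "un \<in> Br" using x B by (auto simp: Br_def)
  have pts: "pt ov = pt un" using branches_pt B by blast
  have det: "det2 (tangent D ov) (tangent D un) \<noteq> 0" using transversal[OF x] B by auto
  have z: "ps b b = 0" "ph b b = 0" for b by (simp_all add: ps_def ph_def)
  have sgn: "sgn (det2 (tangent D ov) (tangent D un)) = real_of_int (sign_val (crossing_sign D x))"
    using det by (auto simp: crossing_sign_def ou)
  have diff: "ps ov un = ph ov un - pi * real_of_int (sign_val (crossing_sign D x))"
    using Arg_opposite_det2[OF det] pts B(2) sgn by (simp add: ps_def ph_def)
  have cp: "c un = p ov + p un - c ov" "d un = q ov + q un - d ov" using c d by simp_all
  have "(\<Sum>b\<in>branches D x. \<Sum>b'\<in>branches D x.
     (p b * d b' + c b * q b') * ps b b' - (c b * d b' + p b * q b') * ph b b') =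
     (p ov * d un + c ov * q un) * ps ov un - (c ov * d un + p ov * q un) * ph ov un +
     ((p un * d ov + c un * q ov) * (- ps ov un) - (c un * d ov + p un * q ov) * (- ph ov un))"
    using B(2) by (simp add: B(1) z ps_antisym[OF Brs] ph_antisym[OF Brs])
  also have "\<dots> = - (pi * real_of_int (sign_val (crossing_sign D x)) * (c ov * d un + p ov * q un - c un * d ov - p un * q ov))"
    unfolding diff cp by (simp add: algebra_simps)
  finally show ?thesis .
qed

end

lemma rel_mset_cyclic:
  assumes "rel_mset cyclic_eq P Q"
  shows "v \<in># Q \<Longrightarrow> \<exists>u\<in>#P. cyclic_eq u v" and "u \<in># P \<Longrightarrow> \<exists>v\<in>#Q. cyclic_eq u v"
proof -
  obtain xs ys where xy: "mset xs = P" "mset ys = Q" "list_all2 cyclic_eq xs ys"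
    using assms by (auto simp: rel_mset_def)
  then show "v \<in># Q \<Longrightarrow> \<exists>u\<in>#P. cyclic_eq u v" "u \<in># P \<Longrightarrow> \<exists>v\<in>#Q. cyclic_eq u v"
    by (metis in_set_conv_nth list_all2_conv_all_nth set_mset_mset)+
qed

lemma cyclic_flow_map: "cyclic_flow p c (map f u) \<longleftrightarrow> cyclic_flow (\<lambda>x. p (f x)) (\<lambda>x. c (f x)) u"
  by (simp add: cyclic_flow_def o_def)

theorem diagram_planar:
  assumes "link_diagram D" and "encodes P D" and "well e I P"
  shows "planar (flat e P) I"
proof -
  interpret link D by unfold_locales (rule assms(1))
  obtain num where num: "bij_betw num (crossings D) {1..card (crossings D)}"
    and rel: "rel_mset cyclic_eq P (image_mset (component_word D num) (mset_set {..<ncomp D}))"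
    using assms(2) unfolding encodes_def by blast
  define bl where "bl = branch_letter D num"
  have words: "component_word D num j = map (\<lambda>t. bl (j, t)) (times j)" for j
    by (simp add: component_word_def times_def bl_def)
  have bl_over: "bl (over_branch D x) = Over (num x)" and bl_under: "bl (under_branch D x) = Under (num x) (crossing_sign D x)"
    if "x \<in> crossings D" for x
  proof -
    note B = branches_over_under[OF that]
    have "pt (over_branch D x) = x" "pt (under_branch D x) = x" using branches_pt B(1) by blast+
    then show "bl (over_branch D x) = Over (num x)" "bl (under_branch D x) = Under (num x) (crossing_sign D x)"
      using B(2) by (simp_all add: bl_def branch_letter_def Let_def pt_def)
  qed
  have letters_bl: "set_mset (letters P) = bl ` Br"
  proof -
    have "x \<in># letters P \<longleftrightarrow> (\<exists>j<ncomp D. x \<in> set (component_word D num j))" for x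
    proof
      assume "x \<in># letters P"
      then obtain u where u: "u \<in># P" "x \<in> set u" by (auto simp: in_letters_iff)
      then obtain v where "v \<in># image_mset (component_word D num) (mset_set {..<ncomp D})" "cyclic_eq u v"
        using rel_mset_cyclic(2)[OF rel] by blast
      then show "\<exists>j<ncomp D. x \<in> set (component_word D num j)" using u by (auto simp: cyclic_eq_def)
    next
      assume "\<exists>j<ncomp D. x \<in> set (component_word D num j)"
      then obtain j where j: "j < ncomp D" "x \<in> set (component_word D num j)" by blast
      then have "component_word D num j \<in># image_mset (component_word D num) (mset_set {..<ncomp D})" by auto
      then obtain u where "u \<in># P" "cyclic_eq u (component_word D num j)"
        using rel_mset_cyclic(1)[OF rel] by blast
      then show "x \<in># letters P" using j(2) by (auto simp: cyclic_eq_def in_letters_iff)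
    qed
    then show ?thesis
      by (force simp: words set_times Br_iff image_iff)
  qed
  have BrOU: "Br = over_branch D ` crossings D \<union> under_branch D ` crossings D"
    using branches_over_under(1) by (auto simp: Br_def)
  have let_eq: "Over ` I \<union> (\<lambda>i. Under i (e i)) ` I = Over ` num ` crossings D \<union> (\<lambda>x. Under (num x) (crossing_sign D x)) ` crossings D"
    using letters_bl well_letters[OF assms(3)] bl_over bl_under by (simp add: BrOU image_Un image_image)
  have I: "I = num ` crossings D"
  proof -
    have "Over i \<in> Over ` I \<union> (\<lambda>i. Under i (e i)) ` I \<longleftrightarrow> i \<in> I" for i by auto
    moreover have "Over i \<in> Over ` num ` crossings D \<union> (\<lambda>x. Under (num x) (crossing_sign D x)) ` crossings D \<longleftrightarrow> i \<in> num ` crossings D" for i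
      by auto
    ultimately show ?thesis unfolding let_eq by blast
  qed
  have sgn: "crossing_sign D x = e (num x)" if "x \<in> crossings D" for x
  proof -
    have "Under (num x) (crossing_sign D x) \<in> Over ` I \<union> (\<lambda>i. Under i (e i)) ` I"
      unfolding let_eq using that by blast
    then show ?thesis by auto
  qed
  define lb where "lb b = lsym e (bl b)" for b
  have lbO: "lb (over_branch D x) = (num x, - sign_val (crossing_sign D x))"
    and lbU: "lb (under_branch D x) = (num x, sign_val (crossing_sign D x))" if "x \<in> crossings D" for x
    using bl_over bl_under sgn that by (simp_all add: lb_def)
  have flowBr: "c (lb b) = p (lb (nx b))" if f: "flow (flat e P) I p c" and b: "b \<in> Br" for p c b
  proof -
    obtain j t where jt: "b = (j, t)" by (cases b)
    then have j: "j < ncomp D" "t \<in> set (times j)" using b Br_times by auto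
    then have "component_word D num j \<in># image_mset (component_word D num) (mset_set {..<ncomp D})" by auto
    then obtain u where u: "u \<in># P" "cyclic_eq u (component_word D num j)"
      using rel_mset_cyclic(1)[OF rel] by blast
    have "cyclic_flow p c (map (lsym e) u)" using f u by (simp add: flow_def flat_def)
    then have "cyclic_flow (\<lambda>x. p (lsym e x)) (\<lambda>x. c (lsym e x)) (component_word D num j)"
      using u(2) by (auto simp: cyclic_flow_map cyclic_eq_def cyclic_flow_rotate)
    then have "c (lsym e (bl (j, t))) = p (lsym e (bl (j, next_in (times j) t)))"
      unfolding words by (rule cyclic_flow_next_in[OF times_props(2) _ j(2)])
    then show ?thesis by (simp add: lb_def jt nx_def)
  qed
  have s1: "sign_val s = 1 \<or> sign_val s = -1" for s by (cases s) auto
  have vert: "c (lb (over_branch D x)) + c (lb (under_branch D x)) = p (lb (over_branch D x)) + p (lb (under_branch D x))"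
    if f: "flow (flat e P) I p c" and x: "x \<in> crossings D" for p c x
  proof -
    have "c (num x, 1) + c (num x, -1) = p (num x, 1) + p (num x, -1)" using f x I by (simp add: flow_def)
    then show ?thesis using s1[of "crossing_sign D x"] by (auto simp: lbO[OF x] lbU[OF x])
  qed
  have vsum: "(\<Sum>b\<in>branches D x. real_of_int (c (lb b)) - real_of_int (p (lb b))) = 0"
    if f: "flow (flat e P) I p c" and x: "x \<in> crossings D" for p c x
  proof -
    have "(\<Sum>b\<in>branches D x. real_of_int (c (lb b)) - real_of_int (p (lb b))) =
      real_of_int (c (lb (over_branch D x)) + c (lb (under_branch D x)) - (p (lb (over_branch D x)) + p (lb (under_branch D x))))"
      using branches_over_under(2)[OF x] by (simp add: branches_over_under(1)[OF x])
    then show ?thesis using vert[OF f x] by simp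
  qed
  show ?thesis
    unfolding planar_def
  proof (intro allI impI)
    fix p c q d assume pc: "flow (flat e P) I p c" and qd: "flow (flat e P) I q d"
    \<comment> \<open>The over-branch is normalised to the superscript opposite to the crossing
      sign, so the factor in front turns the over/under expression into the summand of
      \<open>inter\<close>.\<close>
    define g where "g x = - (sign_val (crossing_sign D x) * (c (lb (over_branch D x)) * d (lb (under_branch D x)) +
       p (lb (over_branch D x)) * q (lb (under_branch D x)) - c (lb (under_branch D x)) * d (lb (over_branch D x)) -
       p (lb (under_branch D x)) * q (lb (over_branch D x))))" for x
    have "0 = (\<Sum>x\<in>crossings D. \<Sum>b\<in>branches D x. \<Sum>b'\<in>branches D x.
     (real_of_int (p (lb b)) * real_of_int (d (lb b')) + real_of_int (c (lb b)) * real_of_int (q (lb b'))) * ps b b' -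
     (real_of_int (c (lb b)) * real_of_int (d (lb b')) + real_of_int (p (lb b)) * real_of_int (q (lb b'))) * ph b b')"
      by (rule sum_corners[symmetric]) (simp_all add: flowBr[OF pc] flowBr[OF qd] vsum[OF pc] vsum[OF qd])
    also have "\<dots> = (\<Sum>x\<in>crossings D. pi * real_of_int (g x))"
    proof (rule sum.cong[OF refl])
      fix x assume x: "x \<in> crossings D"
      have 1: "real_of_int (c (lb (over_branch D x))) + real_of_int (c (lb (under_branch D x))) =
        real_of_int (p (lb (over_branch D x))) + real_of_int (p (lb (under_branch D x)))"
        using vert[OF pc x] by (simp flip: of_int_add)
      have 2: "real_of_int (d (lb (over_branch D x))) + real_of_int (d (lb (under_branch D x))) =
        real_of_int (q (lb (over_branch D x))) + real_of_int (q (lb (under_branch D x)))"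
        using vert[OF qd x] by (simp flip: of_int_add)
      show "(\<Sum>b\<in>branches D x. \<Sum>b'\<in>branches D x.
         (real_of_int (p (lb b)) * real_of_int (d (lb b')) + real_of_int (c (lb b)) * real_of_int (q (lb b'))) * ps b b' -
         (real_of_int (c (lb b)) * real_of_int (d (lb b')) + real_of_int (p (lb b)) * real_of_int (q (lb b'))) * ph b b')
         = pi * real_of_int (g x)"
        by (subst crossing_sum[OF x refl refl 1 2]) (simp add: g_def)
    qed
    also have "\<dots> = pi * real_of_int (\<Sum>x\<in>crossings D. g x)" by (simp add: sum_distrib_left)
    finally have "(\<Sum>x\<in>crossings D. g x) = 0" by (simp flip: of_int_sum)
    moreover have "inter I p c q d = (\<Sum>x\<in>crossings D. g x)"
    proof -
      have "inj_on num (crossings D)" using num by (simp add: bij_betw_def)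
      then have "inter I p c q d = (\<Sum>x\<in>crossings D. c (num x, 1) * d (num x, -1) - c (num x, -1) * d (num x, 1)
          + p (num x, 1) * q (num x, -1) - p (num x, -1) * q (num x, 1))"
        unfolding inter_def I by (simp add: sum.reindex)
      also have "\<dots> = (\<Sum>x\<in>crossings D. g x)"
      proof (rule sum.cong[OF refl])
        fix x assume x: "x \<in> crossings D"
        show "c (num x, 1) * d (num x, -1) - c (num x, -1) * d (num x, 1)
          + p (num x, 1) * q (num x, -1) - p (num x, -1) * q (num x, 1) = g x"
          using s1[of "crossing_sign D x"] by (auto simp: g_def lbO[OF x] lbU[OF x])
      qed
      finally show ?thesis .
    qed
    ultimately show "inter I p c q d = 0" by simp
  qed
qed

section \<open>Sweeping out a planar flat structure\<close>

text \<open>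
  The dart \<open>(m, True)\<close> is the edge that follows the passage \<open>m\<close>, read forwards; \<open>(m, False)\<close> is the same edge read
  backwards.
\<close>

type_synonym dart = "symbol \<times> bool"

definition opp :: "dart \<Rightarrow> dart" where
  "opp d = (fst d, \<not> snd d)"

lemma opp_simps [simp]: "opp (opp d) = d" "fst (opp d) = fst d" "snd (opp d) = (\<not> snd d)" "opp d \<noteq> d" "d \<noteq> opp d"
  by (cases d; simp add: opp_def)+

lemma opp_eq_iff [simp]: "opp d = opp d' \<longleftrightarrow> d = d'"
  by (metis opp_simps(1))

lemma fst_eq_dart: "fst x = fst y \<Longrightarrow> x = y \<or> x = opp y"
  by (cases x; cases y) (auto simp: opp_def)

section \<open>Areas of the polygons formed by coefficients\<close>

definition val :: "(symbol \<Rightarrow> int) \<Rightarrow> dart \<Rightarrow> int" where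
  "val c d = (if snd d then c (fst d) else - c (fst d))"

lemma val_opp [simp]: "val c (opp d) = - val c d"
  by (simp add: val_def)

definition total :: "(symbol \<Rightarrow> int) \<Rightarrow> dart list \<Rightarrow> int" where
  "total c w = (\<Sum>x\<leftarrow>w. val c x)"

lemma total_simps [simp]: "total c [] = 0" "total c (x # w) = val c x + total c w" "total c (u @ w) = total c u + total c w"
  by (simp_all add: total_def)

text \<open>The sum of the determinants of all pairs of sides taken in order, the sides being the
  vectors \<open>(val c x, val d x)\<close>. For a closed polygon this is twice the signed
  area.\<close>

fun area :: "(symbol \<Rightarrow> int) \<Rightarrow> (symbol \<Rightarrow> int) \<Rightarrow> dart list \<Rightarrow> int" where
  "area c d [] = 0"
| "area c d (x # w) = val c x * total d w - val d x * total c w + area c d w"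

lemma area_append: "area c d (u @ w) = area c d u + area c d w + total c u * total d w - total d u * total c w"
  by (induction u) (simp_all add: algebra_simps)

text \<open>For a closed polygon the two parts of the word have opposite totals, so the mixed terms
  of \<open>area_append\<close> vanish in either order.\<close>

lemma area_rotate:
  assumes "total c w = 0" and "total d w = 0"
  shows "area c d (rotate m w) = area c d w"
proof -
  define u v where "u = take (m mod length w) w" and "v = drop (m mod length w) w"
  have w: "w = u @ v" "rotate m w = v @ u" by (simp_all add: u_def v_def rotate_drop_take)
  have "total c v = - total c u" "total d v = - total d u" using assms unfolding w(1) by simp_all
  then show ?thesis unfolding w(2) unfolding w(1) area_append by (simp add: algebra_simps)
qed

lemma total_rotate: "total c (rotate m w) = total c w"
  unfolding rotate_drop_take total_def
  by (metis (no_types, lifting) add.commute append_take_drop_id map_append sum_list_append)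

lemma total_cong: "(\<And>x. x \<in> set w \<Longrightarrow> val c x = val c' x) \<Longrightarrow> total c w = total c' w"
  by (induction w) auto

lemma total_zero: "(\<And>x. x \<in> set w \<Longrightarrow> val c x = 0) \<Longrightarrow> total c w = 0"
  by (induction w) auto

lemma area_cong: "(\<And>x. x \<in> set w \<Longrightarrow> val c x = val c' x \<and> val d x = val d' x) \<Longrightarrow> area c d w = area c' d' w"
  by (induction w) (auto intro!: arg_cong2[where f = minus] arg_cong2[where f = times] total_cong)

lemma length_4: "length w = 4 \<Longrightarrow> \<exists>a x y z. w = [a, x, y, z]"
  by (auto simp: numeral_eq_Suc length_Suc_conv)

text \<open>
  Reading upwards, \<open>Cap k\<close> creates the strands \<open>k\<close> and \<open>k + 1\<close>, \<open>Cross k\<close> exchanges them and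
  \<open>Cup k\<close> joins them.
\<close>

datatype layer = Cap nat | Cross nat | Cup nat

fun is_cross :: "layer \<Rightarrow> bool" where
  "is_cross (Cross k) = True"
| "is_cross _ = False"

fun pos :: "layer \<Rightarrow> nat" where
  "pos (Cross k) = k"
| "pos (Cap k) = k"
| "pos (Cup k) = k"

section \<open>Sweeps and the word on the boundary of the disc\<close>

locale flat_map =
  fixes I :: "nat set" and nxt prv :: "symbol \<Rightarrow> symbol"
  assumes fin: "finite I"
    and nxt_in: "\<And>m. m \<in> I \<times> {1, -1} \<Longrightarrow> nxt m \<in> I \<times> {1, -1}"
    and prv_in: "\<And>m. m \<in> I \<times> {1, -1} \<Longrightarrow> prv m \<in> I \<times> {1, -1}"
    and nxt_prv: "\<And>m. m \<in> I \<times> {1, -1} \<Longrightarrow> nxt (prv m) = m"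
    and prv_nxt: "\<And>m. m \<in> I \<times> {1, -1} \<Longrightarrow> prv (nxt m) = m"
begin

text \<open>
  The darts pointing away from crossing \<open>i\<close>, in clockwise order.
\<close>

definition vertex :: "nat \<Rightarrow> dart list" where
  "vertex i = [((i, -1), True), (prv (i, 1), False), (prv (i, -1), False), ((i, 1), True)]"

definition head :: "dart \<Rightarrow> symbol" where
  "head d = (if snd d then nxt (fst d) else fst d)"

text \<open>A word lists the edges met by a horizontal line from left to right, each read upwards.
  At \<open>Cross k\<close> the darts pointing away from the crossing are, clockwise from the lower
  left, \<open>opp a\<close>, \<open>b'\<close>, \<open>a'\<close>, \<open>opp b\<close>; they must
  agree with \<open>vertex i\<close> up to rotation.\<close>

fun step :: "layer \<Rightarrow> dart list \<Rightarrow> dart list \<Rightarrow> bool" where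
  "step (Cap k) w w' \<longleftrightarrow> (\<exists>A C d. length A = k \<and> w = A @ C \<and> w' = A @ d # opp d # C)"
| "step (Cup k) w w' \<longleftrightarrow> (\<exists>A C d. length A = k \<and> w' = A @ C \<and> w = A @ d # opp d # C)"
| "step (Cross k) w w' \<longleftrightarrow> (\<exists>A C a b a' b'. length A = k \<and> w = A @ a # b # C \<and> w' = A @ b' # a' # C \<and>
     (\<exists>i\<in>I. \<exists>m. rotate m (vertex i) = [opp a, b', a', opp b]))"

text \<open>In a \<open>Cross\<close> layer the dart at position \<open>pos\<close> of the lower
  word points upwards into the crossing, so its head tells which crossing is drawn there.\<close>

definition cross_index :: "dart list list \<Rightarrow> layer list \<Rightarrow> nat \<Rightarrow> nat" where
  "cross_index ws ls h = fst (head (ws ! h ! pos (ls ! h)))"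

definition sweep :: "layer list \<Rightarrow> dart list list \<Rightarrow> nat set \<Rightarrow> bool" where
  "sweep ls ws V \<longleftrightarrow> length ws = Suc (length ls) \<and> ws ! 0 = [] \<and>
     (\<forall>h<length ls. step (ls ! h) (ws ! h) (ws ! Suc h)) \<and>
     bij_betw (cross_index ws ls) {h. h < length ls \<and> is_cross (ls ! h)} V"

definition reach :: "dart list \<Rightarrow> nat set \<Rightarrow> bool" where
  "reach w V \<longleftrightarrow> (\<exists>ls ws. sweep ls ws V \<and> last ws = w)"

lemma reach_Nil: "reach [] {}"
  unfolding reach_def by (intro exI[of _ "[]"] exI[of _ "[[]]"]) (simp add: sweep_def bij_betw_def)

lemma vertex_set: "set (vertex i) = {((i, -1), True), (prv (i, 1), False), (prv (i, -1), False), ((i, 1), True)}"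
  by (auto simp: vertex_def)

lemma head_vertex: "i \<in> I \<Longrightarrow> opp a \<in> set (vertex i) \<Longrightarrow> fst (head a) = i"
proof -
  assume i: "i \<in> I" and a: "opp a \<in> set (vertex i)"
  obtain l b where "a = (l, b)" by (cases a)
  then show ?thesis using a i nxt_prv[of "(i, 1)"] nxt_prv[of "(i, -1)"]
    by (auto simp: vertex_set opp_def head_def)
qed

lemma reach_step:
  assumes "reach w V" and "step T w w'" and "V' = (if is_cross T then insert (fst (head (w ! pos T))) V else V)"
    and "is_cross T \<Longrightarrow> fst (head (w ! pos T)) \<notin> V"
  shows "reach w' V'"
proof -
  obtain ls ws where s: "sweep ls ws V" and w: "last ws = w" using assms(1) by (auto simp: reach_def)
  note S = s[unfolded sweep_def]
  let ?n = "length ls"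
  let ?H = "{h. h < ?n \<and> is_cross (ls ! h)}"
  have wn: "ws ! ?n = w" using S w last_conv_nth[of ws] by (cases ws) auto
  have ci: "cross_index (ws @ [w']) (ls @ [T]) h = cross_index ws ls h" if "h < ?n" for h
    using that S by (simp add: cross_index_def nth_append)
  have cn: "cross_index (ws @ [w']) (ls @ [T]) ?n = fst (head (w ! pos T))"
    using S wn by (simp add: cross_index_def nth_append)
  have H: "{h. h < length (ls @ [T]) \<and> is_cross ((ls @ [T]) ! h)} = (if is_cross T then insert ?n ?H else ?H)"
    by (auto simp: nth_append less_Suc_eq)
  have "bij_betw (cross_index (ws @ [w']) (ls @ [T])) ?H V"
    using S by (subst bij_betw_cong[where g = "cross_index ws ls"]) (auto simp: ci)
  then have "bij_betw (cross_index (ws @ [w']) (ls @ [T])) {h. h < length (ls @ [T]) \<and> is_cross ((ls @ [T]) ! h)} V'"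
    unfolding H assms(3) using notIn_Un_bij_betw[of ?n ?H "cross_index (ws @ [w']) (ls @ [T])" V] assms(4) cn by auto
  moreover have "step ((ls @ [T]) ! h) ((ws @ [w']) ! h) ((ws @ [w']) ! Suc h)" if "h < length (ls @ [T])" for h
  proof (cases "h = ?n")
    case True
    then show ?thesis using S wn assms(2) by (simp add: nth_append)
  next
    case False
    then have "h < ?n" using that by simp
    then show ?thesis using S by (simp add: nth_append)
  qed
  ultimately have "sweep (ls @ [T]) (ws @ [w']) V'" using S unfolding sweep_def by (auto simp: nth_append)
  then show ?thesis unfolding reach_def by (intro exI[of _ "ls @ [T]"] exI[of _ "ws @ [w']"]) simp
qed

lemma reach_cap: "reach (A @ C) V \<Longrightarrow> reach (A @ d # opp d # C) V"
proof (rule reach_step[of "A @ C" V "Cap (length A)"])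
  show "step (Cap (length A)) (A @ C) (A @ d # opp d # C)" unfolding step.simps by blast
qed simp_all

lemma reach_cup: "reach (A @ d # opp d # C) V \<Longrightarrow> reach (A @ C) V"
proof (rule reach_step[of "A @ d # opp d # C" V "Cup (length A)"])
  show "step (Cup (length A)) (A @ d # opp d # C) (A @ C)" unfolding step.simps by blast
qed simp_all

lemma reach_cross:
  assumes "reach (A @ a # b # C) V" and "i \<in> I" "i \<notin> V" and "rotate m (vertex i) = [opp a, b', a', opp b]"
  shows "reach (A @ b' # a' # C) (insert i V)"
proof -
  have "set (vertex i) = set [opp a, b', a', opp b]" using assms(4) by (metis set_rotate)
  then have "fst (head a) = i" using head_vertex[OF assms(2), of a] by simp
  moreover have "step (Cross (length A)) (A @ a # b # C) (A @ b' # a' # C)"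
    using assms(2,4) unfolding step.simps by blast
  ultimately show ?thesis
    using reach_step[OF assms(1), of "Cross (length A)" "A @ b' # a' # C" "insert i V"] assms(3) by simp
qed

definition darts :: "nat set \<Rightarrow> dart set" where
  "darts R = (\<Union>i\<in>R. set (vertex i))"

lemma prv_inj: "x \<in> I \<times> {1, -1} \<Longrightarrow> y \<in> I \<times> {1, -1} \<Longrightarrow> prv x = prv y \<Longrightarrow> x = y"
  by (metis nxt_prv)

lemma distinct_vertex: "i \<in> I \<Longrightarrow> distinct (vertex i)"
  using prv_inj[of "(i, 1)" "(i, -1)"] by (auto simp: vertex_def)

lemma in_darts_iff: "R \<subseteq> I \<Longrightarrow> x \<in> darts R \<longleftrightarrow> fst x \<in> I \<times> {1, -1} \<and> fst (head (opp x)) \<in> R"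
proof -
  assume R: "R \<subseteq> I"
  obtain l b where x: "x = (l, b)" by (cases x)
  show ?thesis
  proof
    assume "x \<in> darts R"
    then obtain i where i: "i \<in> R" "x \<in> set (vertex i)" by (auto simp: darts_def)
    then have "i \<in> I" using R by blast
    have "fst x \<in> {(i, -1), prv (i, 1), prv (i, -1), (i, 1)}" using i(2) by (auto simp: vertex_set)
    then have "fst x \<in> I \<times> {1, -1}"
      using prv_in[of "(i, 1)"] prv_in[of "(i, -1)"] \<open>i \<in> I\<close> by (elim insertE emptyE) (simp_all add: mem_Times_iff)
    moreover have "fst (head (opp x)) = i" using head_vertex[OF \<open>i \<in> I\<close>, of "opp x"] i(2) by simp
    ultimately show "fst x \<in> I \<times> {1, -1} \<and> fst (head (opp x)) \<in> R" using i(1) by blast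
  next
    assume *: "fst x \<in> I \<times> {1, -1} \<and> fst (head (opp x)) \<in> R"
    show "x \<in> darts R"
    proof (cases b)
      case True
      then have "x \<in> set (vertex (fst l))" using * by (auto simp: x vertex_set)
      moreover have "fst l \<in> R" using * True by (simp add: x head_def)
      ultimately show ?thesis unfolding darts_def by blast
    next
      case False
      have n: "nxt l \<in> I \<times> {1, -1}" "prv (nxt l) = l" using * nxt_in prv_nxt by (auto simp: x)
      obtain j e where je: "nxt l = (j, e)" by (cases "nxt l")
      then have "x \<in> set (vertex j)" using False n by (auto simp: x vertex_set)
      moreover have "j \<in> R" using * False je by (simp add: x head_def)
      ultimately show ?thesis unfolding darts_def by blast
    qed
  qed
qed

text \<open>
  \<open>w\<close> is the word on the boundary of the disc and \<open>R\<close> consists of the vertices outside it, so this is the vanishing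
  of the intersection form on the graph obtained by contracting the disc to a point.
\<close>

definition flat_word :: "dart list \<Rightarrow> nat set \<Rightarrow> bool" where
  "flat_word w R \<longleftrightarrow> (\<forall>c d. total c w = 0 \<longrightarrow> total d w = 0 \<longrightarrow>
     (\<forall>i\<in>R. total c (vertex i) = 0 \<and> total d (vertex i) = 0) \<longrightarrow>
     area c d w + (\<Sum>i\<in>R. area c d (vertex i)) = 0)"

text \<open>The edge \<open>h\<close> leads from the disc to \<open>i\<close>. Coefficients on the
  new boundary determine the one on \<open>h\<close> by conservation at \<open>i\<close>, and
  \<open>fresh\<close> allows \<open>h\<close> to be reassigned. The polygon of \<open>i\<close> is
  then glued to that of the disc along the side \<open>h\<close>, and areas add up.\<close>

lemma flat_word_glue:
  assumes fl: "flat_word (A @ h # C) (insert i R)" and "finite R" "i \<notin> R"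
    and rot: "rotate m (vertex i) = [opp h, x, y, z]"
    and fresh: "\<And>t. t \<in> set A \<union> set C \<union> {x, y, z} \<union> darts R \<Longrightarrow> fst t \<noteq> fst h"
  shows "flat_word (A @ x # y # z # C) R"
  unfolding flat_word_def
proof (intro allI impI)
  fix c d
  assume c: "total c (A @ x # y # z # C) = 0" and d: "total d (A @ x # y # z # C) = 0"
    and R: "\<forall>i\<in>R. total c (vertex i) = 0 \<and> total d (vertex i) = 0"
  define ext where "ext c = c(fst h := (if snd h then val c x + val c y + val c z else - (val c x + val c y + val c z)))" for c :: "symbol \<Rightarrow> int"
  have vh: "val (ext c) h = val c x + val c y + val c z" for c by (simp add: ext_def val_def)
  have vo: "val (ext c) t = val c t" if "t \<in> set A \<union> set C \<union> {x, y, z} \<union> darts R" for c t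
    using fresh[OF that] by (simp add: ext_def val_def)
  have vx: "val (ext c) x = val c x" "val (ext c) y = val c y" "val (ext c) z = val c z" for c
    by (simp_all add: vo)
  have tA: "total (ext c) A = total c A" "total (ext c) C = total c C" for c
    by (intro total_cong vo; simp)+
  have aA: "area (ext c) (ext d) A = area c d A" "area (ext c) (ext d) C = area c d C" for c d
    by (intro area_cong conjI vo; simp)+
  have tR: "total (ext c) (vertex j) = total c (vertex j)" if "j \<in> R" for c j
    by (intro total_cong vo) (use that in \<open>auto simp: darts_def\<close>)
  have aR: "area (ext c) (ext d) (vertex j) = area c d (vertex j)" if "j \<in> R" for c d j
    by (intro area_cong conjI vo) (use that in \<open>auto simp: darts_def\<close>)
  have ti: "total (ext c) (vertex i) = 0" for c
    using total_rotate[of "ext c" m "vertex i"] by (simp add: rot vh vx)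
  have ai: "area (ext c) (ext d) (vertex i) = area (ext c) (ext d) [opp h, x, y, z]"
    using area_rotate[OF ti ti, of c d m] by (simp only: rot)
  have "area (ext c) (ext d) (A @ h # C) + (\<Sum>j\<in>insert i R. area (ext c) (ext d) (vertex j)) = 0"
  proof (rule fl[unfolded flat_word_def, rule_format])
    show "total (ext c) (A @ h # C) = 0" "total (ext d) (A @ h # C) = 0" using c d by (simp_all add: tA vh)
    show "total (ext c) (vertex j) = 0 \<and> total (ext d) (vertex j) = 0" if "j \<in> insert i R" for j
      using that R tR ti by auto
  qed
  also have "(\<Sum>j\<in>insert i R. area (ext c) (ext d) (vertex j)) = area (ext c) (ext d) [opp h, x, y, z] + (\<Sum>j\<in>R. area c d (vertex j))"
    using assms(2,3) by (simp add: ai aR del: area.simps)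
  finally show "area c d (A @ x # y # z # C) + (\<Sum>i\<in>R. area c d (vertex i)) = 0"
    by (simp add: area_append aA tA vh vx algebra_simps)
qed

definition balanced :: "dart list \<Rightarrow> bool" where
  "balanced w \<longleftrightarrow> distinct w \<and> (\<forall>x\<in>set w. opp x \<in> set w)"

lemma total_balanced: "balanced w \<Longrightarrow> total c w = 0"
proof -
  assume b: "balanced w"
  have "total c w = (\<Sum>x\<in>set w. val c x)"
    using b by (simp add: total_def sum_list_distinct_conv_sum_set balanced_def)
  moreover have "(\<Sum>x\<in>set w. val c x) = (\<Sum>x\<in>set w. val c (opp x))"
    by (rule sum.reindex_bij_witness[of _ opp opp]) (use b in \<open>auto simp: balanced_def\<close>)
  moreover have "(\<Sum>x\<in>set w. val c (opp x)) = - (\<Sum>x\<in>set w. val c x)" by (simp add: sum_negf)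
  ultimately show ?thesis by linarith
qed

text \<open>If only one end of the edge of \<open>y\<close> lay between \<open>x\<close> and
  \<open>opp x\<close>, the indicator functions of the two edges would have area 2 or -2.\<close>

lemma flat_word_noncrossing:
  assumes fl: "flat_word w {}" and bal: "balanced w" and w: "w = A @ x # B @ opp x # C" and y: "y \<in> set B"
  shows "opp y \<in> set B"
proof (rule ccontr)
  assume ny: "opp y \<notin> set B"
  define c where "c s = (of_bool (s = fst x) :: int)" for s
  define d where "d s = (of_bool (s = fst y) :: int)" for s
  have dist: "distinct (A @ x # B @ opp x # C)" using bal w by (simp add: balanced_def)
  have xy: "fst x \<noteq> fst y" using dist y fst_eq_dart[of y x] by auto
  have c0: "val c t = 0" if "t \<in> set A \<union> set B \<union> set C" for t
  proof -
    have "t \<noteq> x" "t \<noteq> opp x" using that dist by auto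
    then show ?thesis using fst_eq_dart[of t x] by (auto simp: val_def c_def)
  qed
  have tc: "total c A = 0" "total c B = 0" "total c C = 0"
    by (rule total_zero, rule c0, simp)+
  have ac: "area c d u = 0" if "\<And>t. t \<in> set u \<Longrightarrow> val c t = 0" for u
    using that
  proof (induction u)
    case (Cons a u)
    then have "total c u = 0" by (intro total_zero) simp
    then show ?case using Cons by simp
  qed simp
  have aA: "area c d A = 0" "area c d B = 0" "area c d C = 0" using ac c0 by auto
  have dx: "val d x = 0" using xy by (simp add: val_def d_def)
  have "area c d w + (\<Sum>i\<in>{}. area c d (vertex i)) = 0"
    using fl total_balanced[OF bal] unfolding flat_word_def by blast
  then have "2 * (val c x * total d B) = 0"
    unfolding w by (simp add: area_append aA tc dx algebra_simps)
  moreover have "val c x \<noteq> 0" by (simp add: val_def c_def)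
  moreover have "total d B \<noteq> 0"
  proof -
    obtain B1 B2 where B: "B = B1 @ y # B2" using y by (meson split_list)
    have "val d t = 0" if "t \<in> set B1 \<union> set B2" for t
    proof -
      have "t \<noteq> y" "t \<noteq> opp y" using that dist ny B by auto
      then show ?thesis using fst_eq_dart[of t y] by (auto simp: val_def d_def)
    qed
    then have "total d B1 = 0" "total d B2 = 0"
      by (intro total_zero; simp)+
    then have "total d B = val d y" by (simp add: B)
    then show ?thesis by (simp add: val_def d_def)
  qed
  ultimately show False by simp
qed

text \<open>The word between \<open>x\<close> and \<open>opp x\<close>, if not empty, contains a
  complete pair with a shorter gap, by \<open>flat_word_noncrossing\<close>. Descent ends with an
  adjacent pair.\<close>

lemma flat_word_adjacent:
  assumes "flat_word w {}" and bal: "balanced w" and "w \<noteq> []"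
  obtains A x C where "w = A @ x # opp x # C"
proof -
  have split: "\<exists>A x B C. u = A @ x # B @ opp x # C" if "y \<in> set u" "opp y \<in> set u" for u :: "dart list" and y
  proof -
    obtain A C where AC: "u = A @ y # C" using \<open>y \<in> set u\<close> by (meson split_list)
    then have "opp y \<in> set A \<or> opp y \<in> set C" using \<open>opp y \<in> set u\<close> by auto
    then show ?thesis
    proof
      assume "opp y \<in> set C"
      then obtain B C' where "C = B @ opp y # C'" by (meson split_list)
      then show ?thesis using AC by blast
    next
      assume "opp y \<in> set A"
      then obtain A' B where "A = A' @ opp y # B" by (meson split_list)
      then have "u = A' @ opp y # B @ opp (opp y) # C" using AC by simp
      then show ?thesis by blast
    qed
  qed
  have "\<exists>A x B C. w = A @ x # B @ opp x # C"
    using split[of "hd w" w] assms(3) bal by (auto simp: balanced_def)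
  moreover have "\<exists>A x C. w = A @ x # opp x # C" if "w = A @ x # B @ opp x # C" for A x B C
    using that
  proof (induction "length B" arbitrary: A x B C rule: less_induct)
    case less
    show ?case
    proof (cases B)
      case Nil
      then have "w = A @ x # opp x # C" using less.prems by simp
      then show ?thesis by blast
    next
      case (Cons y B')
      then have "y \<in> set B" by simp
      then have "opp y \<in> set B" using flat_word_noncrossing[OF assms(1,2) less.prems] by blast
      then obtain P z Q R where B: "B = P @ z # Q @ opp z # R" using split \<open>y \<in> set B\<close> by blast
      show ?thesis
        by (rule less.hyps[of Q "A @ x # P" z "R @ opp x # C"]) (use B less.prems in auto)
    qed
  qed
  ultimately show ?thesis using that by blast
qed

lemma reach_Nil_of_flat:
  assumes "reach w V" and "flat_word w {}" and "balanced w"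
  shows "reach [] V"
  using assms
proof (induction "length w" arbitrary: w rule: less_induct)
  case less
  show ?case
  proof (cases "w = []")
    case False
    obtain A x C where w: "w = A @ x # opp x # C" by (rule flat_word_adjacent[OF less.prems(2,3) False])
    have tot: "total c (A @ C) = total c w" for c by (simp add: w)
    have ar: "area c d (A @ C) = area c d w" for c d by (simp add: w area_append algebra_simps)
    have "flat_word (A @ C) {}" using less.prems(2) unfolding flat_word_def tot ar .
    moreover have "balanced (A @ C)"
      using less.prems(3) unfolding balanced_def w by auto
    moreover have "reach (A @ C) V" using less.prems(1) unfolding w by (rule reach_cup)
    ultimately show ?thesis using less.hyps[of "A @ C"] by (simp add: w)
  qed (use less.prems in simp)
qed

theorem reach_all:
  assumes planar: "flat_word (vertex i0) (I - {i0})" and i0: "i0 \<in> I"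
    and conn: "\<And>R. R \<subseteq> I \<Longrightarrow> R \<noteq> {} \<Longrightarrow> (\<And>m. m \<in> R \<times> {1, -1} \<Longrightarrow> fst (nxt m) \<in> R) \<Longrightarrow> R = I"
  shows "reach [] I"
proof -
  \<comment> \<open>The last two conditions say that the open edges on the boundary and the edges at
    the remaining vertices account for all ends: an edge leaving the disc ends either on its
    boundary again or at a vertex not yet absorbed.\<close>
  define inv where "inv w V \<longleftrightarrow> reach w V \<and> V \<subseteq> I \<and> i0 \<in> V \<and> flat_word w (I - V) \<and> distinct w \<and>
     set w \<inter> darts (I - V) = {} \<and> (\<forall>x\<in>set w \<union> darts (I - V). opp x \<in> set w \<union> darts (I - V))" for w V
  have "inv (vertex i0) {i0}"
  proof -
    have "vertex i0 = [((i0, -1), True), (prv (i0, 1), False), (prv (i0, -1), False), ((i0, 1), True)]" by (simp add: vertex_def)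
    then obtain g0 g1 g2 g3 where g: "vertex i0 = [g0, g1, g2, g3]" by blast
    \<comment> \<open>Two caps side by side give \<open>g0\<close>, \<open>opp g0\<close>,
      \<open>opp g3\<close>, \<open>g3\<close>. The inner two enter the crossing from below; the
      outer two already are the first and the last edge of \<open>vertex i0\<close>.\<close>
    have "reach ([] @ g0 # opp g0 # []) {}" by (rule reach_cap) (simp add: reach_Nil)
    then have "reach ([g0, opp g0] @ opp g3 # opp (opp g3) # []) {}" by (intro reach_cap) simp
    then have "reach ([g0] @ opp g0 # opp g3 # [g3]) {}" by simp
    then have "reach ([g0] @ g1 # g2 # [g3]) (insert i0 {})"
      by (rule reach_cross[where m = 0, OF _ i0]) (simp_all add: g)
    then have "reach (vertex i0) {i0}" by (simp add: g)
    moreover have "set (vertex i0) \<inter> darts (I - {i0}) = {}"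
    proof -
      have "x \<notin> darts (I - {i0})" if "x \<in> set (vertex i0)" for x
        using head_vertex[OF i0, of "opp x"] that in_darts_iff[of "I - {i0}" x] by auto
      then show ?thesis by blast
    qed
    moreover have "set (vertex i0) \<union> darts (I - {i0}) = darts I" using i0 by (auto simp: darts_def)
    moreover have "opp x \<in> darts I" if "x \<in> darts I" for x
    proof -
      have "fst x \<in> I \<times> {1, -1}" using that in_darts_iff[of I x] by simp
      then have "fst (head x) \<in> I" using nxt_in[of "fst x"] by (auto simp: head_def)
      then show ?thesis using \<open>fst x \<in> I \<times> {1, -1}\<close> in_darts_iff[of I "opp x"] by simp
    qed
    ultimately show ?thesis using planar i0 distinct_vertex[OF i0] unfolding inv_def by simp
  qed
  moreover have "\<exists>w'. inv w' I" if "inv w V" for w V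
    using that
  proof (induction "card (I - V)" arbitrary: w V rule: less_induct)
    case less
    note J = less.prems[unfolded inv_def]
    show ?case
    proof (cases "I - V = {}")
      case True
      then have "V = I" using J by blast
      then show ?thesis using less.prems by blast
    next
      case False
      \<comment> \<open>Otherwise no edge joins the disc to the remaining vertices, and every edge
        leaving one of these ends at one of them, against connectedness.\<close>
      have "\<exists>h\<in>set w. opp h \<in> darts (I - V)"
      proof (rule ccontr)
        assume no: "\<not> (\<exists>h\<in>set w. opp h \<in> darts (I - V))"
        have "fst (nxt m) \<in> I - V" if m: "m \<in> (I - V) \<times> {1, -1}" for m
        proof -
          have "(m, True) \<in> darts (I - V)" using m in_darts_iff[of "I - V" "(m, True)"] by (auto simp: head_def opp_def)
          then have "opp (m, True) \<in> set w \<union> darts (I - V)" using J by blast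
          moreover have "opp (m, True) \<notin> set w"
            using no \<open>(m, True) \<in> darts (I - V)\<close> by (metis opp_simps(1))
          ultimately have "opp (m, True) \<in> darts (I - V)" by blast
          then show ?thesis using in_darts_iff[of "I - V" "opp (m, True)"] by (simp add: head_def)
        qed
        then have "I - V = I" using conn[of "I - V"] False by blast
        then show False using J i0 by blast
      qed
      then obtain h i where h: "h \<in> set w" and i: "i \<in> I" "i \<notin> V" "opp h \<in> set (vertex i)"
        by (auto simp: darts_def)
      obtain A C where w: "w = A @ h # C" using h by (meson split_list)
      obtain m x y z where rot: "rotate m (vertex i) = [opp h, x, y, z]"
      proof -
        obtain k where k: "k < length (vertex i)" "vertex i ! k = opp h" using i(3) by (metis in_set_conv_nth)
        have "length (rotate k (vertex i)) = 4" by (simp add: vertex_def)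
        then obtain a x y z where r: "rotate k (vertex i) = [a, x, y, z]"
          using length_4 by blast
        have "hd (rotate k (vertex i)) = vertex i ! k"
          using k by (subst hd_rotate_conv_nth) auto
        then show ?thesis using that[of k x y z] r k by simp
      qed
      have vs: "set (vertex i) = {opp h, x, y, z}" using rot by (metis set_rotate list.set(1,2) insert_commute)
      have dv: "distinct [opp h, x, y, z]" using rot distinct_vertex[OF i(1)] by (metis distinct_rotate)
      define V' where "V' = insert i V"
      have IV: "I - V = insert i (I - V')" "i \<notin> I - V'" using i by (auto simp: V'_def)
      have dI: "darts (I - V) = {opp h, x, y, z} \<union> darts (I - V')" unfolding IV(1) by (auto simp: darts_def vs)
      have "t \<notin> darts (I - V')" if "t \<in> {opp h, x, y, z}" for t
        using head_vertex[OF i(1), of "opp t"] that vs in_darts_iff[of "I - V'" t] by (auto simp: V'_def)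
      then have disj: "{opp h, x, y, z} \<inter> darts (I - V') = {}" by blast
      have dw: "distinct (A @ h # C)" "set (A @ h # C) \<inter> ({opp h, x, y, z} \<union> darts (I - V')) = {}"
        using J w dI by auto
      have fr: "t \<noteq> h \<and> t \<noteq> opp h" if "t \<in> set A \<union> set C \<union> {x, y, z} \<union> darts (I - V')" for t
        using that dw dv disj by auto
      have cl: "opp t \<in> set A \<union> set C \<union> {x, y, z} \<union> darts (I - V')"
        if "t \<in> set A \<union> set C \<union> {x, y, z} \<union> darts (I - V')" for t
      proof -
        have "t \<in> set w \<union> darts (I - V)" using that w dI by auto
        then have "opp t \<in> set w \<union> darts (I - V)" using J by blast
        moreover have "opp t \<noteq> h" "opp t \<noteq> opp h" using fr[OF that] by (metis opp_simps(1))+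
        ultimately show ?thesis using w dI by auto
      qed
      have "inv (A @ x # y # z # C) V'"
        unfolding inv_def
      proof (intro conjI)
        \<comment> \<open>A cap to the right of \<open>h\<close> bends the edge \<open>z\<close>
          down, so that \<open>h\<close> and \<open>opp z\<close> can enter the crossing from below;
          it produces \<open>x\<close> and \<open>y\<close>, and \<open>z\<close> is already in
          place.\<close>
        have "reach ((A @ [h]) @ C) V" using J w by simp
        then have "reach ((A @ [h]) @ opp z # opp (opp z) # C) V" by (rule reach_cap)
        then have "reach (A @ h # opp z # (z # C)) V" by simp
        then have "reach (A @ x # y # (z # C)) (insert i V)"
          by (rule reach_cross[where m = m, OF _ i(1,2)]) (simp add: rot)
        then show "reach (A @ x # y # z # C) V'" by (simp add: V'_def)
        show "V' \<subseteq> I" "i0 \<in> V'" using J i by (auto simp: V'_def)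
        show "flat_word (A @ x # y # z # C) (I - V')"
        proof (rule flat_word_glue[OF _ _ IV(2) rot])
          show "flat_word (A @ h # C) (insert i (I - V'))" using J w IV(1) by simp
          show "finite (I - V')" using fin by simp
          show "fst t \<noteq> fst h" if "t \<in> set A \<union> set C \<union> {x, y, z} \<union> darts (I - V')" for t
            using fr[OF that] fst_eq_dart[of t h] by blast
        qed
        show "distinct (A @ x # y # z # C)" using dw dv by auto
        show "set (A @ x # y # z # C) \<inter> darts (I - V') = {}" using dw disj by auto
        show "\<forall>t\<in>set (A @ x # y # z # C) \<union> darts (I - V'). opp t \<in> set (A @ x # y # z # C) \<union> darts (I - V')"
        proof
          fix t assume "t \<in> set (A @ x # y # z # C) \<union> darts (I - V')"
          then have "t \<in> set A \<union> set C \<union> {x, y, z} \<union> darts (I - V')" by auto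
          from cl[OF this] show "opp t \<in> set (A @ x # y # z # C) \<union> darts (I - V')" by auto
        qed
      qed
      moreover have "card (I - V') < card (I - V)" using fin IV by simp
      ultimately show ?thesis using less.hyps by blast
    qed
  qed
  ultimately obtain w where "inv w I" by blast
  then have "reach w I" "flat_word w {}" "balanced w" by (auto simp: inv_def balanced_def darts_def)
  then show ?thesis by (rule reach_Nil_of_flat)
qed

text \<open>Conservation at \<open>i\<close> says that the quadrilateral with the sides of
  \<open>vertex i\<close> is closed, and its area is then the summand of \<open>inter\<close> at
  \<open>i\<close>. The initial disc is a neighbourhood of \<open>i0\<close>.\<close>

lemma flat_word_of_planar:
  assumes i0: "i0 \<in> I" and pl: "\<And>c d. (\<And>i. i \<in> I \<Longrightarrow> c (i, 1) + c (i, -1) = c (prv (i, 1)) + c (prv (i, -1))) \<Longrightarrow>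
    (\<And>i. i \<in> I \<Longrightarrow> d (i, 1) + d (i, -1) = d (prv (i, 1)) + d (prv (i, -1))) \<Longrightarrow>
    inter I (\<lambda>m. c (prv m)) c (\<lambda>m. d (prv m)) d = 0"
  shows "flat_word (vertex i0) (I - {i0})"
  unfolding flat_word_def
proof (intro allI impI)
  fix c d
  assume c: "total c (vertex i0) = 0" "total d (vertex i0) = 0"
    and R: "\<forall>i\<in>I - {i0}. total c (vertex i) = 0 \<and> total d (vertex i) = 0"
  have t: "total c (vertex i) = 0" "total d (vertex i) = 0" if "i \<in> I" for i using that c R by (cases "i = i0"; simp)+
  have tv: "total c (vertex i) = c (i, -1) - c (prv (i, 1)) - c (prv (i, -1)) + c (i, 1)" for c i
    by (simp add: vertex_def val_def)
  have v: "c (i, 1) + c (i, -1) = c (prv (i, 1)) + c (prv (i, -1))" "d (i, 1) + d (i, -1) = d (prv (i, 1)) + d (prv (i, -1))"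
    if "i \<in> I" for i using t[OF that] unfolding tv by linarith+
  have "area c d (vertex i0) + (\<Sum>i\<in>I - {i0}. area c d (vertex i)) = (\<Sum>i\<in>I. area c d (vertex i))"
    using fin i0 by (simp add: sum.remove)
  also have "\<dots> = inter I (\<lambda>m. c (prv m)) c (\<lambda>m. d (prv m)) d"
    unfolding inter_def
  proof (rule sum.cong[OF refl])
    fix i assume i: "i \<in> I"
    have e: "c (i, -1) = c (prv (i, 1)) + c (prv (i, -1)) - c (i, 1)" "d (i, -1) = d (prv (i, 1)) + d (prv (i, -1)) - d (i, 1)"
      using v[OF i] by linarith+
    show "area c d (vertex i) = c (i, 1) * d (i, -1) - c (i, -1) * d (i, 1) + c (prv (i, 1)) * d (prv (i, -1)) - c (prv (i, -1)) * d (prv (i, 1))"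
      unfolding vertex_def e by (simp add: val_def e algebra_simps)
  qed
  also have "\<dots> = 0" by (rule pl) (use v in auto)
  finally show "area c d (vertex i0) + (\<Sum>i\<in>I - {i0}. area c d (vertex i)) = 0" .
qed

end

section \<open>Smooth strands\<close>

text \<open>
  Membership in a class closed under derivatives gives smoothness of sums and products
  without a formula for the higher derivatives.
\<close>

definition smooth_real :: "(real \<Rightarrow> real) \<Rightarrow> bool" where
  "smooth_real f \<longleftrightarrow> (\<exists>S. f \<in> S \<and> (\<forall>g\<in>S. \<exists>g'\<in>S. \<forall>t. (g has_real_derivative g' t) (at t)))"

inductive_set algebra_of :: "(real \<Rightarrow> real) set \<Rightarrow> (real \<Rightarrow> real) set" for S where
  base: "f \<in> S \<Longrightarrow> f \<in> algebra_of S"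
| const: "(\<lambda>_. c) \<in> algebra_of S"
| plus: "f \<in> algebra_of S \<Longrightarrow> g \<in> algebra_of S \<Longrightarrow> (\<lambda>x. f x + g x) \<in> algebra_of S"
| times: "f \<in> algebra_of S \<Longrightarrow> g \<in> algebra_of S \<Longrightarrow> (\<lambda>x. f x * g x) \<in> algebra_of S"

lemma algebra_of_derivative:
  assumes "\<And>g. g \<in> S \<Longrightarrow> \<exists>g'\<in>S. \<forall>t. (g has_real_derivative g' t) (at t)" and "f \<in> algebra_of S"
  shows "\<exists>g'\<in>algebra_of S. \<forall>t. (f has_real_derivative g' t) (at t)"
  using assms(2)
proof induction
  case (base f)
  then show ?case using assms(1) algebra_of.base by blast
next
  case (const c)
  show ?case by (rule bexI[OF _ algebra_of.const[of 0]]) auto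
next
  case (plus f g)
  then obtain f' g' where "f' \<in> algebra_of S" "g' \<in> algebra_of S"
    "\<And>t. (f has_real_derivative f' t) (at t)" "\<And>t. (g has_real_derivative g' t) (at t)" by blast
  then show ?case by (intro bexI[OF _ algebra_of.plus[of f' S g']] allI DERIV_add)
next
  case (times f g)
  then obtain f' g' where *: "f' \<in> algebra_of S" "g' \<in> algebra_of S"
    "\<And>t. (f has_real_derivative f' t) (at t)" "\<And>t. (g has_real_derivative g' t) (at t)" by blast
  have "(\<lambda>x. f' x * g x + g' x * f x) \<in> algebra_of S"
    by (intro algebra_of.plus algebra_of.times * times)
  then show ?case by (rule bexI[rotated]) (intro allI DERIV_mult *)
qed

lemma smooth_real_union:
  assumes "smooth_real f" and "smooth_real g"
  obtains S where "f \<in> algebra_of S" and "g \<in> algebra_of S" and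
    "\<And>h. h \<in> algebra_of S \<Longrightarrow> smooth_real h"
proof -
  obtain S1 S2 where S: "f \<in> S1" "\<And>g. g \<in> S1 \<Longrightarrow> \<exists>g'\<in>S1. \<forall>t. (g has_real_derivative g' t) (at t)"
    "g \<in> S2" "\<And>g. g \<in> S2 \<Longrightarrow> \<exists>g'\<in>S2. \<forall>t. (g has_real_derivative g' t) (at t)"
    using assms unfolding smooth_real_def by blast
  have "\<exists>g'\<in>S1 \<union> S2. \<forall>t. (h has_real_derivative g' t) (at t)" if "h \<in> S1 \<union> S2" for h
    using that S(2,4) by blast
  note d = algebra_of_derivative[OF this]
  show ?thesis
  proof (rule that[of "S1 \<union> S2"])
    show "f \<in> algebra_of (S1 \<union> S2)" "g \<in> algebra_of (S1 \<union> S2)" using S by (auto intro: algebra_of.base)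
    show "smooth_real h" if "h \<in> algebra_of (S1 \<union> S2)" for h
      unfolding smooth_real_def by (rule exI[of _ "algebra_of (S1 \<union> S2)"]) (use d that in blast)
  qed
qed

lemma smooth_real_add: "smooth_real f \<Longrightarrow> smooth_real g \<Longrightarrow> smooth_real (\<lambda>x. f x + g x)"
  by (erule (1) smooth_real_union) (blast intro: algebra_of.plus)

lemma smooth_real_mult: "smooth_real f \<Longrightarrow> smooth_real g \<Longrightarrow> smooth_real (\<lambda>x. f x * g x)"
  by (erule (1) smooth_real_union) (blast intro: algebra_of.times)

lemma smooth_real_const: "smooth_real (\<lambda>_. c)"
  unfolding smooth_real_def by (rule exI[of _ "range (\<lambda>c _. c)"]) (auto intro!: exI[of _ 0])

lemma smooth_real_antiderivative:
  assumes "smooth_real f" and "\<And>t. (F has_real_derivative f t) (at t)"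
  shows "smooth_real F"
proof -
  obtain S where S: "f \<in> S" "\<forall>g\<in>S. \<exists>g'\<in>S. \<forall>t. (g has_real_derivative g' t) (at t)"
    using assms(1) unfolding smooth_real_def by blast
  show ?thesis unfolding smooth_real_def by (rule exI[of _ "insert F S"]) (use S assms(2) in blast)
qed

lemma smooth_real_ident: "smooth_real (\<lambda>x. x)"
  by (rule smooth_real_antiderivative[OF smooth_real_const[of 1]]) (rule DERIV_ident)

lemma smooth_real_affine:
  assumes "smooth_real f" shows "smooth_real (\<lambda>x. f (a * x + b))"
proof -
  obtain S where S: "f \<in> S" "\<And>g. g \<in> S \<Longrightarrow> \<exists>g'\<in>S. \<forall>t. (g has_real_derivative g' t) (at t)"
    using assms unfolding smooth_real_def by blast
  define T where "T = {\<lambda>x. c * g (a * x + b) | c g. g \<in> S}"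
  have "\<exists>g'\<in>T. \<forall>t. (h has_real_derivative g' t) (at t)" if "h \<in> T" for h
  proof -
    obtain c g where h: "h = (\<lambda>x. c * g (a * x + b))" "g \<in> S" using \<open>h \<in> T\<close> unfolding T_def by blast
    obtain g' where g': "g' \<in> S" "\<And>t. (g has_real_derivative g' t) (at t)" using S(2)[OF h(2)] by blast
    have "(h has_real_derivative (c * a) * g' (a * t + b)) (at t)" for t
      unfolding h(1) by (rule derivative_eq_intros DERIV_chain2[OF g'(2)] refl | simp)+
    moreover have "(\<lambda>t. (c * a) * g' (a * t + b)) \<in> T" using g'(1) by (auto simp: T_def)
    ultimately show ?thesis by (intro bexI[of _ "\<lambda>t. (c * a) * g' (a * t + b)"]) auto
  qed
  moreover have "(\<lambda>x. f (a * x + b)) \<in> T" using S(1) by (auto simp: T_def intro!: exI[of _ 1])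
  ultimately show ?thesis unfolding smooth_real_def by blast
qed

lemma smooth_real_sequence:
  assumes "smooth_real f"
  obtains E where "E 0 = f" and "\<And>m t. (E m has_real_derivative E (Suc m) t) (at t)"
proof -
  obtain S where S: "f \<in> S" "\<And>g. g \<in> S \<Longrightarrow> \<exists>g'\<in>S. \<forall>t. (g has_real_derivative g' t) (at t)"
    using assms unfolding smooth_real_def by blast
  then obtain d where d: "\<And>g. g \<in> S \<Longrightarrow> d g \<in> S \<and> (\<forall>t. (g has_real_derivative d g t) (at t))" by metis
  define E where "E m = (d ^^ m) f" for m
  have "E m \<in> S" for m by (induction m) (use S d in \<open>auto simp: E_def\<close>)
  then have "(E m has_real_derivative E (Suc m) t) (at t)" for m t using d by (simp add: E_def)
  then show ?thesis using that[of E] by (simp add: E_def)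
qed

section \<open>A flat function, a bump and a smooth step\<close>

definition flat_exp :: "real poly \<Rightarrow> real \<Rightarrow> real" where
  "flat_exp p x = (if x > 0 then poly p (inverse x) * exp (- inverse x) else 0)"

lemma poly_exp_tendsto_0: "((\<lambda>y. poly p y * exp (- y)) \<longlongrightarrow> 0) (at_top :: real filter)"
proof -
  have "((\<lambda>y. \<Sum>i\<le>degree p. coeff p i * (y ^ i / exp y)) \<longlongrightarrow> (\<Sum>i\<le>degree p. coeff p i * 0)) at_top"
    by (intro tendsto_intros tendsto_power_div_exp_0)
  moreover have "(\<Sum>i\<le>degree p. coeff p i * (y ^ i / exp y)) = poly p y * exp (- y)" for y
    by (simp add: poly_altdef exp_minus sum_distrib_right divide_inverse mult.assoc)
  ultimately show ?thesis by simp
qed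

text \<open>For \<open>x > 0\<close>, differentiating \<open>p(1/x) exp(-1/x)\<close> replaces
  \<open>p\<close> by \<open>X^2 (p - p')\<close>, so the family is closed under derivatives. At 0
  the exponential beats every polynomial in \<open>1/x\<close>.\<close>

lemma flat_exp_derivative:
  "(flat_exp p has_real_derivative flat_exp ([:0, 0, 1:] * (p - pderiv p)) x) (at x)"
proof -
  consider "x > 0" | "x < 0" | "x = 0" by linarith
  then show ?thesis
  proof cases
    case 1
    have "((\<lambda>x. poly p (inverse x) * exp (- inverse x)) has_real_derivative
      flat_exp ([:0, 0, 1:] * (p - pderiv p)) x) (at x)"
      using 1 by (auto intro!: derivative_eq_intros DERIV_chain2[OF poly_DERIV]
        simp: flat_exp_def algebra_simps power2_eq_square)
    then show ?thesis
      by (rule has_field_derivative_transform_within_open[of _ _ _ "{0<..}"]) (use 1 in \<open>auto simp: flat_exp_def\<close>)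
  next
    case 2
    have "((\<lambda>x. 0) has_real_derivative flat_exp ([:0, 0, 1:] * (p - pderiv p)) x) (at x)"
      using 2 by (simp add: flat_exp_def)
    then show ?thesis
      by (rule has_field_derivative_transform_within_open[of _ _ _ "{..<0}"]) (use 2 in \<open>auto simp: flat_exp_def\<close>)
  next
    case 3
    have "((\<lambda>h. poly ([:0, 1:] * p) (inverse h) * exp (- inverse h)) \<longlongrightarrow> 0) (at_right 0)"
      by (rule filterlim_compose[OF poly_exp_tendsto_0 filterlim_inverse_at_top_right])
    then have r: "((\<lambda>h. flat_exp p h / h) \<longlongrightarrow> 0) (at_right 0)"
      by (rule Lim_transform_eventually)
        (use eventually_at_right_less[of "0::real"] in \<open>eventually_elim, simp add: flat_exp_def field_simps\<close>)
    have l: "((\<lambda>h. flat_exp p h / h) \<longlongrightarrow> 0) (at_left 0)"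
      by (rule Lim_transform_eventually[OF tendsto_const])
        (use eventually_at_left_real[of "-1" "0::real"] in \<open>auto elim!: eventually_mono simp: flat_exp_def\<close>)
    have "((\<lambda>h. flat_exp p h / h) \<longlongrightarrow> 0) (at 0)" using l r filterlim_split_at by blast
    then show ?thesis unfolding 3 has_field_derivative_iff by (simp add: flat_exp_def)
  qed
qed

lemma smooth_flat_exp: "smooth_real (flat_exp p)"
  unfolding smooth_real_def
  by (rule exI[of _ "range flat_exp"]) (use flat_exp_derivative in blast)

definition bump :: "real \<Rightarrow> real" where
  "bump s = flat_exp 1 (s - 1/4) * flat_exp 1 (3/4 - s)"

lemma smooth_bump: "smooth_real bump"
proof -
  have "smooth_real (\<lambda>s. flat_exp 1 (1 * s + (- 1/4)) * flat_exp 1 ((-1) * s + 3/4))"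
    by (intro smooth_real_mult smooth_real_affine smooth_flat_exp)
  then show ?thesis by (simp add: bump_def[abs_def])
qed

lemma bump_pos: "1/4 < s \<Longrightarrow> s < 3/4 \<Longrightarrow> bump s > 0"
  and bump_zero: "s \<le> 1/4 \<or> 3/4 \<le> s \<Longrightarrow> bump s = 0"
  and bump_symmetric: "bump (1 - s) = bump s"
  by (auto simp: bump_def flat_exp_def)

lemma bump_nonneg: "bump s \<ge> 0"
  by (simp add: bump_def flat_exp_def)

lemma bump_antiderivative: "\<exists>B. (\<forall>s. (B has_real_derivative bump s) (at s)) \<and> B 0 = 0"
proof -
  define B where "B s = integral {0..s} bump" for s
  have "continuous_on S bump" for S
    using smooth_bump unfolding smooth_real_def by (meson DERIV_isCont continuous_at_imp_continuous_on)
  note c = this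
  have "(B has_real_derivative bump s) (at s)" for s
  proof (cases "s > 0")
    case True
    have "(B has_real_derivative bump s) (at s within {0..s + 1})"
      unfolding B_def by (rule integral_has_real_derivative[OF c]) (use True in auto)
    then show ?thesis using at_within_Icc_at[of 0 s "s + 1"] True by simp
  next
    case False
    \<comment> \<open>For \<open>u < 0\<close> the interval is empty and the integral is 0; this is
      the right value, since \<open>bump\<close> vanishes to the left of 1/4.\<close>
    have "B u = 0" if "u < 1/4" for u
    proof -
      have "integral {0..u} bump = integral {0..u} (\<lambda>_. 0 :: real)"
        by (rule integral_cong) (use that bump_zero in auto)
      then show ?thesis by (simp add: B_def)
    qed
    then have z: "B u = 0" if "u \<in> {..<1/4}" for u using that by simp
    have "((\<lambda>_. 0) has_real_derivative bump s) (at s)" using False by (simp add: bump_zero)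
    then show ?thesis
      by (rule has_field_derivative_transform_within_open[of _ _ _ "{..<1/4}"]) (use False z in auto)
  qed
  then show ?thesis by (intro exI[of _ B]) (simp add: B_def)
qed

text \<open>The normalised integral of \<open>bump\<close>. Constancy near both ends lets strands be
  glued, symmetry makes a strand and its reverse trace the same curve, and the positive derivative
  in between keeps turning strands immersed.\<close>

lemma smooth_step_exists:
  "\<exists>l. smooth_real l \<and> (\<forall>s\<le>1/4. l s = 0) \<and> (\<forall>s\<ge>3/4. l s = 1) \<and> (\<forall>s. l (1 - s) = 1 - l s) \<and> mono l \<and>
     (\<forall>s\<in>{1/4<..<3/4}. \<exists>d>0. (l has_real_derivative d) (at s))"
proof -
  obtain B where B: "\<And>s. (B has_real_derivative bump s) (at s)" "B 0 = 0" using bump_antiderivative by blast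
  have mono: "B s \<le> B t" if "s \<le> t" for s t
    by (rule DERIV_nonneg_imp_nondecreasing[OF that]) (use B(1) bump_nonneg in blast)
  have "B (1/4) < B (3/4)"
    by (rule DERIV_pos_imp_increasing_open) (use B(1) bump_pos in \<open>auto intro!: DERIV_isCont continuous_at_imp_continuous_on\<close>)
  then have pos: "B 1 > 0" using mono[of 0 "1/4"] mono[of "3/4" 1] B(2) by simp
  have "\<forall>s. B (1 - s) + B s = B (1 - 0) + B 0"
  proof
    fix s
    have "((\<lambda>s. B (1 - s) + B s) has_real_derivative 0) (at x)" for x
      by (rule derivative_eq_intros DERIV_chain2[OF B(1)] B(1) refl | simp add: bump_symmetric)+
    then show "B (1 - s) + B s = B (1 - 0) + B 0" using DERIV_isconst_all[of "\<lambda>s. B (1 - s) + B s"] by blast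
  qed
  then have sym: "B (1 - s) = B 1 - B s" for s using B(2) by (simp add: eq_diff_eq)
  have z: "B s = 0" if "s \<le> 1/4" for s
  proof -
    have const: "B a = B b" if "a < b" "b \<le> 1/4" for a b
    proof -
      have "B b = B a"
      proof (rule DERIV_isconst_end[OF that(1)])
        show "continuous_on {a..b} B" by (intro continuous_at_imp_continuous_on ballI DERIV_isCont[OF B(1)])
        show "(B has_real_derivative 0) (at x)" if "a < x" "x < b" for x
          using B(1)[of x] bump_zero[of x] that \<open>b \<le> 1/4\<close> by simp
      qed
      then show ?thesis by simp
    qed
    show ?thesis using const[of s 0] const[of 0 s] B(2) that by (cases s "0::real" rule: linorder_cases) auto
  qed
  have "smooth_real (\<lambda>s. inverse (B 1) * B s)"
    by (intro smooth_real_mult smooth_real_const smooth_real_antiderivative[OF smooth_bump B(1)])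
  moreover have "inverse (B 1) * B s = 1" if "s \<ge> 3/4" for s
    using z[of "1 - s"] sym[of s] that pos by simp
  moreover have "inverse (B 1) * B (1 - s) = 1 - inverse (B 1) * B s" for s
    using pos by (simp add: sym right_diff_distrib)
  moreover have "mono (\<lambda>s. inverse (B 1) * B s)"
    using pos mono by (auto intro!: monoI mult_left_mono)
  moreover have "\<exists>d>0. ((\<lambda>s. inverse (B 1) * B s) has_real_derivative d) (at s)" if "s \<in> {1/4<..<3/4}" for s
    using that pos bump_pos[of s] DERIV_cmult[OF B(1), of "inverse (B 1)" s]
    by (intro exI[of _ "inverse (B 1) * bump s"]) auto
  ultimately show ?thesis using z by (intro exI[of _ "\<lambda>s. inverse (B 1) * B s"]) auto
qed

definition lam :: "real \<Rightarrow> real" where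
  "lam = (SOME l. smooth_real l \<and> (\<forall>s\<le>1/4. l s = 0) \<and> (\<forall>s\<ge>3/4. l s = 1) \<and> (\<forall>s. l (1 - s) = 1 - l s) \<and> mono l \<and>
     (\<forall>s\<in>{1/4<..<3/4}. \<exists>d>0. (l has_real_derivative d) (at s)))"

lemma lam_smooth: "smooth_real lam"
  and lam_0: "s \<le> 1/4 \<Longrightarrow> lam s = 0"
  and lam_1: "s \<ge> 3/4 \<Longrightarrow> lam s = 1"
  and lam_symmetric: "lam (1 - s) = 1 - lam s"
  and lam_mono: "s \<le> t \<Longrightarrow> lam s \<le> lam t"
  and lam_deriv: "1/4 < s \<Longrightarrow> s < 3/4 \<Longrightarrow> \<exists>d>0. (lam has_real_derivative d) (at s)"
  using someI_ex[OF smooth_step_exists, folded lam_def] by (auto simp: mono_def)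

lemma lam_strict: "s < t \<Longrightarrow> 1/4 \<le> s \<Longrightarrow> t \<le> 3/4 \<Longrightarrow> lam s < lam t"
proof -
  assume st: "s < t" "1/4 \<le> s" "t \<le> 3/4"
  obtain E where E: "E 0 = lam" "\<And>m t. (E m has_real_derivative E (Suc m) t) (at t)"
    using smooth_real_sequence[OF lam_smooth] by blast
  have "isCont lam x" for x using E(2)[of 0] unfolding E(1) by (rule DERIV_isCont)
  then have c: "continuous_on {s..t} lam" by (simp add: continuous_at_imp_continuous_on)
  show ?thesis
  proof (rule DERIV_pos_imp_increasing_open[OF st(1) _ c])
    fix x assume "s < x" "x < t"
    then obtain d where "d > 0" "(lam has_real_derivative d) (at x)" using lam_deriv[of x] st by auto
    then show "\<exists>y. (lam has_real_derivative y) (at x) \<and> 0 < y" by blast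
  qed
qed

lemma lam_bounds: "0 \<le> lam s" "lam s \<le> 1"
  using lam_mono[of "min s 0" s] lam_0[of "min s 0"] lam_mono[of s "max s 1"] lam_1[of "max s 1"] by auto

lemma lam_half: "lam (1/2) = 1/2"
  using lam_symmetric[of "1/2"] by simp

lemma lam_eq_half_iff: "lam s = 1/2 \<longleftrightarrow> s = 1/2"
proof
  assume l: "lam s = 1/2"
  then have s: "1/4 < s" "s < 3/4" using lam_0[of s] lam_1[of s] by (force simp: not_less[symmetric])+
  show "s = 1/2" using lam_strict[of s "1/2"] lam_strict[of "1/2" s] s l lam_half by (cases s "1/2::real" rule: linorder_cases) auto
qed (simp only: lam_half)

text \<open>
  \<open>lam\<close> is the horizontal profile of a strand; \<open>kap\<close> is the height profile of a turning strand, which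
  starts with slope \<open>1\<close>, ends with slope \<open>-1\<close> and stays below \<open>1\<close>.
\<close>

definition kap :: "real \<Rightarrow> real" where
  "kap s = s * (1 - lam s) + (1 - s) * lam s"

lemma kap_smooth: "smooth_real kap"
proof -
  have "smooth_real (\<lambda>s. s * (1 + (-1) * lam s) + (1 + (-1) * s) * lam s)"
    by (intro smooth_real_add smooth_real_mult smooth_real_const smooth_real_ident lam_smooth)
  then show ?thesis by (simp add: kap_def[abs_def])
qed

lemma kap_low: "s \<le> 1/4 \<Longrightarrow> kap s = s"
  and kap_high: "s \<ge> 3/4 \<Longrightarrow> kap s = 1 - s"
  by (simp_all add: kap_def lam_0 lam_1)

lemma kap_pos: "0 < s \<Longrightarrow> s < 1 \<Longrightarrow> kap s > 0"
proof -
  assume s: "0 < s" "s < 1"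
  have "s * (1 - lam s) \<ge> 0" "(1 - s) * lam s \<ge> 0" using s lam_bounds[of s] by simp_all
  moreover have "s * (1 - lam s) > 0 \<or> (1 - s) * lam s > 0" using s lam_bounds[of s] by (cases "lam s = 0") auto
  ultimately show ?thesis unfolding kap_def by linarith
qed

text \<open>\<open>1/2 - kap s\<close> is twice the product of \<open>1/2 - s\<close> and
  \<open>1/2 - lam s\<close>, which have the same sign.\<close>

lemma kap_le_half: "0 \<le> s \<Longrightarrow> s \<le> 1 \<Longrightarrow> kap s \<le> 1/2"
proof -
  assume s: "0 \<le> s" "s \<le> 1"
  have e: "1/2 - kap s = 2 * ((1/2 - s) * (1/2 - lam s))" by (simp add: kap_def field_simps)
  have "(1/2 - s) * (1/2 - lam s) \<ge> 0"
    using lam_mono[of s "1/2"] lam_mono[of "1/2" s] lam_half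
    by (cases "s \<le> 1/2") (auto intro!: mult_nonneg_nonneg mult_nonpos_nonpos)
  then show ?thesis using e by linarith
qed

section \<open>Smooth plane curves and their gluing\<close>

lemma smooth_curve_Complex:
  assumes "smooth_real x" and "smooth_real y"
  shows "smooth_curve (\<lambda>s. Complex (x s) (y s))"
proof -
  obtain E where E: "E 0 = x" "\<And>m t. (E m has_real_derivative E (Suc m) t) (at t)"
    using smooth_real_sequence[OF assms(1)] by blast
  obtain F where F: "F 0 = y" "\<And>m t. (F m has_real_derivative F (Suc m) t) (at t)"
    using smooth_real_sequence[OF assms(2)] by blast
  have "((\<lambda>s. Complex (E m s) (F m s)) has_vector_derivative Complex (E (Suc m) t) (F (Suc m) t)) (at t)" for m t
    using E(2)[of m t] F(2)[of m t] by (simp add: has_vector_derivative_complex_iff)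
  then show ?thesis unfolding smooth_curve_def
    by (intro exI[of _ "\<lambda>m s. Complex (E m s) (F m s)"]) (simp add: E F)
qed

lemma smooth_curve_scale:
  assumes "smooth_curve g" shows "smooth_curve (\<lambda>t. g (a * t))"
proof -
  obtain E where E: "E 0 = g" "\<And>m t. (E m has_vector_derivative E (Suc m) t) (at t)"
    using assms unfolding smooth_curve_def by blast
  have "((\<lambda>t. a ^ m *\<^sub>R E m (a * t)) has_vector_derivative a ^ Suc m *\<^sub>R E (Suc m) (a * t)) (at t)" for m t
  proof -
    have "((E m \<circ> (\<lambda>t. a * t)) has_vector_derivative a *\<^sub>R E (Suc m) (a * t)) (at t)"
      by (rule vector_diff_chain_at) (auto intro!: derivative_eq_intros E(2))
    then show ?thesis by (auto simp: o_def intro!: derivative_eq_intros)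
  qed
  then show ?thesis unfolding smooth_curve_def
    by (intro exI[of _ "\<lambda>m t. a ^ m *\<^sub>R E m (a * t)"]) (simp add: E)
qed

definition glue :: "(int \<Rightarrow> real \<Rightarrow> complex) \<Rightarrow> real \<Rightarrow> complex" where
  "glue g t = g \<lfloor>t\<rfloor> (t - of_int \<lfloor>t\<rfloor>)"

text \<open>On the quarter before \<open>m\<close> the piece \<open>m - 1\<close> is in force, but
  there it coincides with piece \<open>m\<close>. Thus every point of the interval from
  \<open>m\<close> to \<open>m + 1\<close> has an open neighbourhood on which one piece describes
  the curve.\<close>

lemma glue_local:
  assumes "\<And>m s. 3/4 < s \<Longrightarrow> s < 5/4 \<Longrightarrow> g m s = g (m + 1) (s - 1)"
    and "of_int m - 1/4 < t" and "t < of_int m + 1"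
  shows "glue g t = g m (t - of_int m)"
proof (cases "of_int m \<le> t")
  case True
  then have "\<lfloor>t\<rfloor> = m" using assms(3) by linarith
  then show ?thesis by (simp add: glue_def)
next
  case False
  then have f: "\<lfloor>t\<rfloor> = m - 1" using assms(2) by linarith
  have "g (m - 1) (t - of_int (m - 1)) = g m (t - of_int m)"
    using assms(1)[of "t - of_int (m - 1)" "m - 1"] assms(2) False by simp
  then show ?thesis by (simp add: glue_def f)
qed

text \<open>By induction the overlap condition passes to all derivatives of the pieces, so these
  glue as well, and each glued function is locally a single piece.\<close>

lemma smooth_curve_glue:
  assumes sm: "\<And>m. smooth_curve (g m)" and ov: "\<And>m s. 3/4 < s \<Longrightarrow> s < 5/4 \<Longrightarrow> g m s = g (m + 1) (s - 1)"
  shows "smooth_curve (glue g)"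
    and "(glue g has_vector_derivative vector_derivative (g \<lfloor>t\<rfloor>) (at (t - of_int \<lfloor>t\<rfloor>))) (at t)"
proof -
  have "\<forall>m. \<exists>E. E 0 = g m \<and> (\<forall>k t. (E k has_vector_derivative E (Suc k) t) (at t))"
    using sm unfolding smooth_curve_def by blast
  then obtain E where E: "\<And>m. E m 0 = g m" "\<And>m k t. (E m k has_vector_derivative E m (Suc k) t) (at t)"
    by metis
  have ovE: "E m k s = E (m + 1) k (s - 1)" if "3/4 < s" "s < 5/4" for m k s
    using that
  proof (induction k arbitrary: s)
    case 0
    then show ?case using ov by (simp add: E)
  next
    case (Suc k)
    have "((E (m + 1) k \<circ> (\<lambda>s. s - 1)) has_vector_derivative 1 *\<^sub>R E (m + 1) (Suc k) (s - 1)) (at s)"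
      by (rule vector_diff_chain_at) (auto intro!: derivative_eq_intros E(2))
    then have "((E (m + 1) k \<circ> (\<lambda>s. s - 1)) has_vector_derivative E (m + 1) (Suc k) (s - 1)) (at s)" by simp
    then have "(E m k has_vector_derivative E (m + 1) (Suc k) (s - 1)) (at s)"
      by (rule has_vector_derivative_transform_within_open[of _ _ _ "{3/4<..<5/4}"]) (use Suc in auto)
    then show ?case using E(2)[of m k s] vector_derivative_unique_at by blast
  qed
  have D: "(glue (\<lambda>m. E m k) has_vector_derivative glue (\<lambda>m. E m (Suc k)) t) (at t)" for k t
  proof -
    let ?m = "\<lfloor>t\<rfloor>"
    have t: "of_int ?m - 1/4 < t" "t < of_int ?m + 1" by linarith+
    have "((E ?m k \<circ> (\<lambda>t. t - of_int ?m)) has_vector_derivative 1 *\<^sub>R E ?m (Suc k) (t - of_int ?m)) (at t)"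
      by (rule vector_diff_chain_at) (auto intro!: derivative_eq_intros E(2))
    then have "((E ?m k \<circ> (\<lambda>t. t - of_int ?m)) has_vector_derivative E ?m (Suc k) (t - of_int ?m)) (at t)" by simp
    then have "(glue (\<lambda>m. E m k) has_vector_derivative E ?m (Suc k) (t - of_int ?m)) (at t)"
    proof (rule has_vector_derivative_transform_within_open)
      show "t \<in> {of_int ?m - 1/4<..<of_int ?m + 1}" using t by simp
      show "(E ?m k \<circ> (\<lambda>t. t - of_int ?m)) u = glue (\<lambda>m. E m k) u" if "u \<in> {of_int ?m - 1/4<..<of_int ?m + 1}" for u
        using glue_local[of "\<lambda>m. E m k" ?m u] ovE that by simp
    qed simp
    then show ?thesis by (simp add: glue_def)
  qed
  show "smooth_curve (glue g)"
    unfolding smooth_curve_def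
    by (rule exI[of _ "\<lambda>k. glue (\<lambda>m. E m k)"]) (use D in \<open>simp add: E\<close>)
  have "vector_derivative (g \<lfloor>t\<rfloor>) (at (t - of_int \<lfloor>t\<rfloor>)) = E \<lfloor>t\<rfloor> 1 (t - of_int \<lfloor>t\<rfloor>)"
    using E(2)[of "\<lfloor>t\<rfloor>" 0] by (simp add: E vector_derivative_at)
  then show "(glue g has_vector_derivative vector_derivative (g \<lfloor>t\<rfloor>) (at (t - of_int \<lfloor>t\<rfloor>))) (at t)"
    using D[of 0 t] by (simp add: E glue_def)
qed

section \<open>Layers of strands\<close>

text \<open>An edge followed downwards meets the layer upside down.\<close>

fun dual :: "layer \<Rightarrow> layer" where
  "dual (Cap k) = Cup k"
| "dual (Cup k) = Cap k"
| "dual (Cross k) = Cross k"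

fun turns :: "layer \<Rightarrow> nat \<Rightarrow> bool" where
  "turns (Cup k) a \<longleftrightarrow> a = k \<or> a = Suc k"
| "turns _ a \<longleftrightarrow> False"

fun crosses :: "layer \<Rightarrow> nat \<Rightarrow> bool" where
  "crosses (Cross k) a \<longleftrightarrow> a = k \<or> a = Suc k"
| "crosses _ a \<longleftrightarrow> False"

fun move :: "layer \<Rightarrow> nat \<Rightarrow> nat" where
  "move (Cap k) a = (if a < k then a else a + 2)"
| "move (Cross k) a = (if a = k then Suc k else if a = Suc k then k else a)"
| "move (Cup k) a = (if a = k then Suc k else if a = Suc k then k else if a < k then a else a - 2)"

text \<open>Only the strands running from the bottom, at \<open>a\<close>, to the top, at
  \<open>b\<close>, without regard to direction; the ends of a cup or cap are left to
  \<open>move\<close>.\<close>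

fun strand :: "layer \<Rightarrow> nat \<Rightarrow> nat \<Rightarrow> bool" where
  "strand (Cap k) a b \<longleftrightarrow> b = (if a < k then a else a + 2)"
| "strand (Cup k) a b \<longleftrightarrow> a = (if b < k then b else b + 2)"
| "strand (Cross k) a b \<longleftrightarrow> b = (if a = k then Suc k else if a = Suc k then k else a)"

lemma strand_move: "\<not> turns T a \<Longrightarrow> strand T a (move T a)"
  and strand_dual: "\<not> turns (dual T) b \<Longrightarrow> strand T (move (dual T) b) b"
  by (cases T; auto)+

lemma interpolate_less:
  fixes a a' b b' :: nat
  assumes "a < a'" "b < b'" "0 \<le> v" "v \<le> 1"
  shows "real a + (real b - real a) * v < real a' + (real b' - real a') * v"
proof -
  have "(1 - v) * real a \<le> (1 - v) * real a'" "v * real b \<le> v * real b'"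
    using assms by (simp_all add: mult_left_mono)
  moreover have "(1 - v) * real a < (1 - v) * real a' \<or> v * real b < v * real b'"
    using assms by (cases "v = 0") auto
  ultimately have "(1 - v) * real a + v * real b < (1 - v) * real a' + v * real b'" by linarith
  then show ?thesis by (simp add: algebra_simps)
qed

text \<open>Interpolation between two pairs in the same order keeps them in order, so strands can
  meet only if they are exchanged, that is at the middle of a \<open>Cross\<close> layer.\<close>

lemma strand_unique:
  assumes "strand T a b" "strand T a' b'" and v: "0 \<le> v" "v \<le> 1"
    and eq: "real a + (real b - real a) * v = real a' + (real b' - real a') * v"
  shows "a = a' \<and> b = b' \<or> (\<exists>k. T = Cross k \<and> {a, a'} = {k, Suc k} \<and> v = 1/2)"
proof -
  have *: "\<exists>k. T = Cross k \<and> {a, a'} = {k, Suc k} \<and> v = 1/2"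
    if s: "strand T a b" "strand T a' b'" and l: "a < a'"
      and e: "real a + (real b - real a) * v = real a' + (real b' - real a') * v" for a a' b b'
  proof (cases "b < b'")
    case True
    then show ?thesis using interpolate_less[OF l True v] e by simp
  next
    case False
    then obtain k where k: "T = Cross k" "a = k" "a' = Suc k" "b = Suc k" "b' = k"
      using s l by (cases T) (auto split: if_splits)
    then have "v = 1/2" using e by (simp add: algebra_simps)
    then show ?thesis using k by auto
  qed
  have same: "b = b'" if "a = a'" using assms(1,2) that by (cases T) (auto split: if_splits)
  show ?thesis
  proof (cases a a' rule: linorder_cases)
    case less
    then show ?thesis using *[OF assms(1,2) less eq] by blast
  next
    case equal
    then show ?thesis using same by simp
  next
    case greater
    then show ?thesis using *[OF assms(2,1) greater eq[symmetric]] by (auto simp: insert_commute)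
  qed
qed

text \<open>Strands to the left of the cup are vertical. A strand to the right moves two places to
  the left, but up to height 1/2 by at most one place, so it stays at abscissa \<open>k + 1\<close>
  or more. Equality would force the middle of the cup, whose abscissa is
  \<open>k + 1/2\<close>.\<close>

lemma cup_strand_disjoint:
  assumes "strand (Cup k) a b" and "0 \<le> s" "s \<le> 1" and "(c, c') = (k, Suc k) \<or> (c, c') = (Suc k, k)"
    and eq: "real c + (real c' - real c) * lam s = real a + (real b - real a) * lam (kap s)"
  shows False
proof -
  have kp: "kap s \<le> 1/2" using kap_le_half assms by simp
  have lh: "lam (kap s) \<le> 1/2" using lam_mono[OF kp] lam_half by simp
  have c: "real k \<le> real c + (real c' - real c) * lam s" "real c + (real c' - real c) * lam s \<le> real k + 1"
    using assms(4) lam_bounds[of s] by auto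
  show False
  proof (cases "b < k")
    case True
    then have "a = b" using assms(1) by simp
    then show False using eq c True by simp
  next
    case False
    then have "a = b + 2" using assms(1) by simp
    then have e: "real c + (real c' - real c) * lam s = real b + 2 - 2 * lam (kap s)" using eq by simp
    have "real b \<ge> real k" using False by simp
    then have "lam (kap s) = 1/2" and top: "real c + (real c' - real c) * lam s = real k + 1" using e c lh by linarith+
    then have "kap s = 1/2" using lam_eq_half_iff by simp
    then have "(1/2 - s) * (1/2 - lam s) = 0" by (simp add: kap_def field_simps)
    then have "lam s = 1/2" using lam_eq_half_iff[of s] by auto
    then show False using top assms(4) by auto
  qed
qed

lemma cap_strand_disjoint:
  assumes "strand (Cap k) a b" and "0 \<le> s" "s \<le> 1" and "(c, c') = (k, Suc k) \<or> (c, c') = (Suc k, k)"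
    and eq: "real c + (real c' - real c) * lam s = real a + (real b - real a) * lam (1 - kap s)"
  shows False
proof (rule cup_strand_disjoint[OF _ assms(2,3,4)])
  show "strand (Cup k) b a" using assms(1) by simp
  show "real c + (real c' - real c) * lam s = real b + (real a - real b) * lam (kap s)"
    using eq by (simp add: lam_symmetric algebra_simps)
qed

text \<open>For a fixed value of \<open>lam\<close>, \<open>kap\<close> is linear in
  \<open>s\<close> with slope \<open>1 - 2 * lam s\<close>, and the slope vanishes only at
  \<open>s = 1/2\<close>.\<close>

lemma lam_kap_inj: "lam s = lam t \<Longrightarrow> kap s = kap t \<Longrightarrow> s = t"
proof -
  assume e: "lam s = lam t" "kap s = kap t"
  then have "(s - t) * (1 - 2 * lam t) = 0" by (simp add: kap_def algebra_simps)
  then show ?thesis using lam_eq_half_iff[of s] lam_eq_half_iff[of t] e(1) by auto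
qed

type_synonym node = "nat \<times> nat"

lemma rotate_4_cases:
  assumes "length xs = 4" and "xs = [p, q, r, s]"
  shows "rotate m xs = [p, q, r, s] \<or> rotate m xs = [q, r, s, p] \<or> rotate m xs = [r, s, p, q] \<or> rotate m xs = [s, p, q, r]"
proof (induction m)
  case 0
  then show ?case using assms by simp
next
  case (Suc m)
  then show ?case by (elim disjE) (simp_all)
qed

section \<open>Following an edge through one layer\<close>

context flat_map
begin

text \<open>The four rotations correspond to the four ways in which the two strands can run up or
  down through the crossing.\<close>

lemma rotated_vertex:
  assumes "rotate m (vertex i) = [p, q, r, s]"
  obtains "p = ((i, -1), True)" "q = (prv (i, 1), False)" "r = (prv (i, -1), False)" "s = ((i, 1), True)"
  | "p = (prv (i, 1), False)" "q = (prv (i, -1), False)" "r = ((i, 1), True)" "s = ((i, -1), True)"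
  | "p = (prv (i, -1), False)" "q = ((i, 1), True)" "r = ((i, -1), True)" "s = (prv (i, 1), False)"
  | "p = ((i, 1), True)" "q = ((i, -1), True)" "r = (prv (i, 1), False)" "s = (prv (i, -1), False)"
  using rotate_4_cases[of "vertex i", OF _ vertex_def, of m] assms by (auto simp: vertex_def)

text \<open>In \<open>vertex i\<close> the edges entering and leaving the same passage are two
  places apart, hence opposite at the crossing: a strand goes straight on to the next edge of its
  word.\<close>

lemma cross_ends:
  assumes rot: "rotate m (vertex i) = [opp a, b', a', opp b]" and i: "i \<in> I"
  shows "snd a \<Longrightarrow> a' = (nxt (fst a), True)" "snd b \<Longrightarrow> b' = (nxt (fst b), True)"
    and "\<not> snd a' \<Longrightarrow> a = (nxt (fst a'), False)" "\<not> snd b' \<Longrightarrow> b = (nxt (fst b'), False)"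
proof -
  obtain la xa where a: "a = (la, xa)" by (cases a)
  obtain lb xb where b: "b = (lb, xb)" by (cases b)
  have n: "nxt (prv (i, 1)) = (i, 1)" "nxt (prv (i, -1)) = (i, -1)" using i nxt_prv by auto
  have op: "opp (l, x) = (l, \<not> x)" for l x by (simp add: opp_def)
  note R = rotated_vertex[OF rot, unfolded a b op prod.inject]
  show "snd a \<Longrightarrow> a' = (nxt (fst a), True)" "snd b \<Longrightarrow> b' = (nxt (fst b), True)"
    "\<not> snd a' \<Longrightarrow> a = (nxt (fst a'), False)" "\<not> snd b' \<Longrightarrow> b = (nxt (fst b'), False)"
    unfolding a b by (rule R; simp add: n)+
qed

lemma step_up:
  assumes "step T w w'" and "k < length w" and "snd (w ! k)"
  shows "turns T k \<Longrightarrow> move T k < length w \<and> w ! move T k = opp (w ! k)"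
    and "\<not> turns T k \<Longrightarrow> move T k < length w' \<and>
      w' ! move T k = (if crosses T k then nxt (fst (w ! k)) else fst (w ! k), True)"
proof -
  have T: "(turns T k \<longrightarrow> move T k < length w \<and> w ! move T k = opp (w ! k)) \<and>
    (\<not> turns T k \<longrightarrow> move T k < length w' \<and>
      w' ! move T k = (if crosses T k then nxt (fst (w ! k)) else fst (w ! k), True))"
  proof (cases T)
    case (Cap j)
    then obtain A C d where "length A = j" "w = A @ C" "w' = A @ d # opp d # C" using assms(1) by auto
    then show ?thesis using assms(2,3) Cap
      by (auto simp: nth_append Suc_diff_le prod_eq_iff numeral_2_eq_2)
  next
    case (Cup j)
    then obtain A C d where *: "length A = j" "w' = A @ C" "w = A @ d # opp d # C" using assms(1) by auto
    consider "k < j" | "k = j" | "k = Suc j" | "k \<ge> j + 2" by linarith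
    then show ?thesis
    proof cases
      case 4
      then obtain q where "k = j + 2 + q" using le_Suc_ex by blast
      then show ?thesis using * assms(2,3) Cup by (auto simp: nth_append prod_eq_iff)
    qed (use * assms(2,3) Cup in \<open>auto simp: nth_append prod_eq_iff\<close>)
  next
    case (Cross j)
    then obtain A C a b a' b' i m where *: "length A = j" "w = A @ a # b # C" "w' = A @ b' # a' # C" "i \<in> I"
      "rotate m (vertex i) = [opp a, b', a', opp b]" using assms(1) by (auto simp del: split_paired_Ex)
    note ab = cross_ends[OF *(5,4)]
    consider "k < j" | "k = j" | "k = Suc j" | "k \<ge> j + 2" by linarith
    then show ?thesis
    proof cases
      case 4
      then obtain q where "k = j + 2 + q" using le_Suc_ex by blast
      then show ?thesis using * assms(2,3) Cross by (auto simp: nth_append prod_eq_iff)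
    qed (use * assms(2,3) Cross ab in \<open>auto simp: nth_append prod_eq_iff\<close>)
  qed
  then show "turns T k \<Longrightarrow> move T k < length w \<and> w ! move T k = opp (w ! k)"
    and "\<not> turns T k \<Longrightarrow> move T k < length w' \<and>
      w' ! move T k = (if crosses T k then nxt (fst (w ! k)) else fst (w ! k), True)" by blast+
qed

lemma step_down:
  assumes "step T w w'" and "k < length w'" and "\<not> snd (w' ! k)"
  shows "turns (dual T) k \<Longrightarrow> move (dual T) k < length w' \<and> w' ! move (dual T) k = opp (w' ! k)"
    and "\<not> turns (dual T) k \<Longrightarrow> move (dual T) k < length w \<and>
      w ! move (dual T) k = (if crosses T k then nxt (fst (w' ! k)) else fst (w' ! k), False)"
proof -
  have T: "(turns (dual T) k \<longrightarrow> move (dual T) k < length w' \<and> w' ! move (dual T) k = opp (w' ! k)) \<and>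
    (\<not> turns (dual T) k \<longrightarrow> move (dual T) k < length w \<and>
      w ! move (dual T) k = (if crosses T k then nxt (fst (w' ! k)) else fst (w' ! k), False))"
  proof (cases T)
    case (Cup j)
    then obtain A C d where "length A = j" "w' = A @ C" "w = A @ d # opp d # C" using assms(1) by auto
    then show ?thesis using assms(2,3) Cup
      by (auto simp: nth_append Suc_diff_le prod_eq_iff numeral_2_eq_2)
  next
    case (Cap j)
    then obtain A C d where *: "length A = j" "w = A @ C" "w' = A @ d # opp d # C" using assms(1) by auto
    consider "k < j" | "k = j" | "k = Suc j" | "k \<ge> j + 2" by linarith
    then show ?thesis
    proof cases
      case 4
      then obtain q where "k = j + 2 + q" using le_Suc_ex by blast
      then show ?thesis using * assms(2,3) Cap by (auto simp: nth_append prod_eq_iff)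
    qed (use * assms(2,3) Cap in \<open>auto simp: nth_append prod_eq_iff\<close>)
  next
    case (Cross j)
    then obtain A C a b a' b' i m where *: "length A = j" "w = A @ a # b # C" "w' = A @ b' # a' # C" "i \<in> I"
      "rotate m (vertex i) = [opp a, b', a', opp b]" using assms(1) by (auto simp del: split_paired_Ex)
    note ab = cross_ends[OF *(5,4)]
    consider "k < j" | "k = j" | "k = Suc j" | "k \<ge> j + 2" by linarith
    then show ?thesis
    proof cases
      case 4
      then obtain q where "k = j + 2 + q" using le_Suc_ex by blast
      then show ?thesis using * assms(2,3) Cross by (auto simp: nth_append prod_eq_iff)
    qed (use * assms(2,3) Cross ab in \<open>auto simp: nth_append prod_eq_iff\<close>)
  qed
  then show "turns (dual T) k \<Longrightarrow> move (dual T) k < length w' \<and> w' ! move (dual T) k = opp (w' ! k)"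
    and "\<not> turns (dual T) k \<Longrightarrow> move (dual T) k < length w \<and>
      w ! move (dual T) k = (if crosses T k then nxt (fst (w' ! k)) else fst (w' ! k), False)" by blast+
qed

end

section \<open>The curves drawn by a sweep\<close>

locale sweeping = flat_map I nxt prv for I nxt prv +
  fixes ls :: "layer list" and ws :: "dart list list"
  assumes sweep: "sweep ls ws I" and last: "last ws = []"
begin

lemma len: "length ws = Suc (length ls)"
  and first: "ws ! 0 = []"
  and steps: "h < length ls \<Longrightarrow> step (ls ! h) (ws ! h) (ws ! Suc h)"
  and cross_bij: "bij_betw (cross_index ws ls) {h. h < length ls \<and> is_cross (ls ! h)} I"
  using sweep unfolding sweep_def by blast+

lemma last': "ws ! length ls = []"
  using last len last_conv_nth[of ws] by (cases ws) auto

text \<open>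
  The node \<open>(h, k)\<close> is the \<open>k\<close>-th strand at height \<open>h\<close>, drawn at the point with abscissa \<open>k\<close> and ordinate \<open>h\<close>.
\<close>

definition nodes :: "node set" where
  "nodes = {(h, k). h < length ws \<and> k < length (ws ! h)}"

definition lab :: "node \<Rightarrow> dart" where
  "lab x = ws ! fst x ! snd x"

abbreviation up :: "node \<Rightarrow> bool" where
  "up x \<equiv> snd (lab x)"

definition bot :: "node \<Rightarrow> nat" where
  "bot x = (if up x then fst x else fst x - 1)"

text \<open>The layer as seen in the direction of travel, whence the dual for an edge followed
  downwards.\<close>

definition lay :: "node \<Rightarrow> layer" where
  "lay x = (if up x then ls ! fst x else dual (ls ! (fst x - 1)))"

definition turning :: "node \<Rightarrow> bool" where
  "turning x = turns (lay x) (snd x)"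

definition crossing :: "node \<Rightarrow> bool" where
  "crossing x = crosses (lay x) (snd x)"

definition succ :: "node \<Rightarrow> node" where
  "succ x = (if turning x then fst x else if up x then Suc (fst x) else fst x - 1, move (lay x) (snd x))"

text \<open>The formula is meant for all real \<open>s\<close>, since gluing compares pieces
  slightly beyond the unit interval.\<close>

definition piece :: "node \<Rightarrow> real \<Rightarrow> complex" where
  "piece x s = Complex (real (snd x) + (real (snd (succ x)) - real (snd x)) * lam s)
     (real (fst x) + (if up x then 1 else -1) * (if turning x then kap s else s))"

lemma finite_nodes: "finite nodes"
proof -
  have "nodes = (SIGMA h:{..<length ws}. {..<length (ws ! h)})" by (auto simp: nodes_def)
  then show ?thesis by simp
qed

lemma node_up: "x \<in> nodes \<Longrightarrow> up x \<Longrightarrow> fst x < length ls"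
  using len last' by (auto simp: nodes_def less_Suc_eq)

lemma node_pos: "x \<in> nodes \<Longrightarrow> 0 < fst x"
  using first by (cases "fst x") (auto simp: nodes_def)

lemma bot_less: "x \<in> nodes \<Longrightarrow> bot x < length ls"
  using node_up[of x] node_pos[of x] len by (auto simp: bot_def nodes_def)

lemma node_down: "x \<in> nodes \<Longrightarrow> \<not> up x \<Longrightarrow> fst x = Suc (bot x)"
  using node_pos[of x] by (simp add: bot_def)

lemma dual_crosses: "crosses (dual T) k = crosses T k"
  by (cases T) auto

lemma succ_up:
  assumes "x \<in> nodes" "up x"
  shows "succ x \<in> nodes" and "turning x \<Longrightarrow> lab (succ x) = opp (lab x)"
    and "\<not> turning x \<Longrightarrow> lab (succ x) = (if crossing x then nxt (fst (lab x)) else fst (lab x), True)"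
proof -
  obtain h k where x: "x = (h, k)" by (cases x)
  have h: "h < length ls" "k < length (ws ! h)" "snd (ws ! h ! k)"
    using node_up[OF assms] assms by (auto simp: x nodes_def lab_def)
  note S = step_up[OF steps[OF h(1)] h(2,3)]
  have lb: "lab (p, q) = ws ! p ! q" for p q by (simp add: lab_def)
  have l: "lay (h, k) = ls ! h" using h(3) by (simp add: lay_def lab_def)
  show "succ x \<in> nodes" using S h len by (simp add: succ_def nodes_def turning_def l lb x)
  show "turning x \<Longrightarrow> lab (succ x) = opp (lab x)"
    using S(1) by (simp add: succ_def turning_def l lb x)
  show "\<not> turning x \<Longrightarrow> lab (succ x) = (if crossing x then nxt (fst (lab x)) else fst (lab x), True)"
    using S(2) h(3) by (simp add: succ_def turning_def crossing_def l lb x)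
qed

lemma succ_down:
  assumes "x \<in> nodes" "\<not> up x"
  shows "succ x \<in> nodes" and "turning x \<Longrightarrow> lab (succ x) = opp (lab x)"
    and "\<not> turning x \<Longrightarrow> lab (succ x) = (if crossing x then nxt (fst (lab x)) else fst (lab x), False)"
proof -
  obtain h k where x: "x = (Suc h, k)" using node_down[OF assms] by (cases x) auto
  have h: "h < length ls" "k < length (ws ! Suc h)" "\<not> snd (ws ! Suc h ! k)"
    using assms len by (auto simp: x nodes_def lab_def)
  note S = step_down[OF steps[OF h(1)] h(2,3)]
  have lb: "lab (p, q) = ws ! p ! q" for p q by (simp add: lab_def)
  have l: "lay (Suc h, k) = dual (ls ! h)" using h(3) by (simp add: lay_def lab_def)
  show "succ x \<in> nodes" using S h len by (simp add: succ_def nodes_def turning_def l lb x)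
  show "turning x \<Longrightarrow> lab (succ x) = opp (lab x)"
    using S(1) by (simp add: succ_def turning_def l lb x)
  show "\<not> turning x \<Longrightarrow> lab (succ x) = (if crossing x then nxt (fst (lab x)) else fst (lab x), False)"
    using S(2) h(3) by (simp add: succ_def turning_def crossing_def dual_crosses l lb x)
qed

lemma succ_in: "x \<in> nodes \<Longrightarrow> succ x \<in> nodes"
  using succ_up(1) succ_down(1) by blast

lemma succ_dir: "x \<in> nodes \<Longrightarrow> up (succ x) \<longleftrightarrow> (if turning x then \<not> up x else up x)"
  using succ_up(2,3)[of x] succ_down(2,3)[of x] by (cases "up x"; cases "turning x"; simp)

lemma crossing_not_turning: "crossing x \<Longrightarrow> \<not> turning x"
  by (cases "lay x") (auto simp: crossing_def turning_def)

lemma succ_edge: "x \<in> nodes \<Longrightarrow> fst (lab (succ x)) = (if crossing x then nxt (fst (lab x)) else fst (lab x))"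
  using succ_up(2,3)[of x] succ_down(2,3)[of x] crossing_not_turning[of x]
  by (cases "crossing x"; cases "up x"; cases "turning x"; simp)

text \<open>Within a quarter of its ends every piece is a vertical line travelled at unit speed.
  Where the strand turns, \<open>kap\<close> has slope -1 at the end, which matches the reversed
  direction of the next piece.\<close>

lemma piece_overlap:
  assumes "x \<in> nodes" "3/4 < s" "s < 5/4"
  shows "piece x s = piece (succ x) (s - 1)"
proof -
  have "lam s = 1" "kap s = 1 - s" "lam (s - 1) = 0" "kap (s - 1) = s - 1"
    using assms lam_1 lam_0 kap_high kap_low by auto
  moreover have "fst (succ x) = (if turning x then fst x else if up x then Suc (fst x) else fst x - 1)"
    by (simp add: succ_def)
  ultimately show ?thesis
    using succ_dir[OF assms(1)] node_pos[OF assms(1)]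
    by (cases "turning x"; cases "up x") (auto simp: piece_def of_nat_diff)
qed

definition ht :: "node \<Rightarrow> real \<Rightarrow> real" where
  "ht x s = (if up x then (if turning x then kap s else s) else 1 - (if turning x then kap s else s))"

lemma Im_piece: "x \<in> nodes \<Longrightarrow> Im (piece x s) = real (bot x) + ht x s"
  using node_down[of x] by (auto simp: piece_def ht_def bot_def)

lemma ht_bounds: "0 < s \<Longrightarrow> s < 1 \<Longrightarrow> 0 < ht x s \<and> ht x s < 1"
  using kap_pos[of s] kap_le_half[of s] by (auto simp: ht_def)

lemma piece_0: "piece x 0 = Complex (real (snd x)) (real (fst x))"
  by (simp add: piece_def lam_0 kap_low)

text \<open>By the symmetry of \<open>lam\<close>, going down with parameter \<open>s\<close> is
  going up with parameter \<open>1 - s\<close>, so the height \<open>ht\<close> parametrises both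
  directions of the same strand.\<close>

lemma strand_of_node:
  assumes "x \<in> nodes" "\<not> turning x"
  obtains a b where "strand (ls ! bot x) a b" "\<And>s. Re (piece x s) = real a + (real b - real a) * lam (ht x s)"
    "if up x then x = (bot x, a) \<and> succ x = (Suc (bot x), b) else x = (Suc (bot x), b) \<and> succ x = (bot x, a)"
proof (cases "up x")
  case True
  show ?thesis
  proof (rule that[of "snd x" "snd (succ x)"])
    show "strand (ls ! bot x) (snd x) (snd (succ x))"
      using strand_move[of "lay x" "snd x"] assms True by (simp add: turning_def lay_def bot_def succ_def)
  qed (use True assms in \<open>simp_all add: piece_def ht_def bot_def succ_def prod_eq_iff\<close>)
next
  case False
  show ?thesis
  proof (rule that[of "snd (succ x)" "snd x"])
    show "strand (ls ! bot x) (snd (succ x)) (snd x)"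
      using strand_dual[of "ls ! bot x" "snd x"] assms False by (simp add: turning_def lay_def bot_def succ_def)
    show "Re (piece x s) = real (snd (succ x)) + (real (snd x) - real (snd (succ x))) * lam (ht x s)" for s
      using False assms by (simp add: piece_def ht_def lam_symmetric algebra_simps)
  qed (use False assms node_down[OF assms(1) False] in \<open>simp_all add: succ_def prod_eq_iff bot_def\<close>)
qed

lemma turning_node:
  assumes "x \<in> nodes" "turning x"
  obtains k where "ls ! bot x = (if up x then Cup k else Cap k)" "(snd x, snd (succ x)) = (k, Suc k) \<or> (snd x, snd (succ x)) = (Suc k, k)"
    "fst (succ x) = fst x"
proof -
  have "turns (lay x) (snd x)" using assms by (simp add: turning_def)
  then obtain k where k: "lay x = Cup k" "snd x = k \<or> snd x = Suc k" by (cases "lay x") auto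
  have "ls ! bot x = (if up x then Cup k else Cap k)"
    using k(1) by (cases "ls ! bot x") (auto simp: lay_def bot_def split: if_splits)
  moreover have "(snd x, snd (succ x)) = (k, Suc k) \<or> (snd x, snd (succ x)) = (Suc k, k)"
    using k by (auto simp: succ_def)
  ultimately show ?thesis using that assms(2) by (simp add: succ_def)
qed

lemma crossing_of_strand:
  assumes "x \<in> nodes" and "ls ! bot x = Cross k"
    and "if up x then x = (bot x, a) \<and> succ x = (Suc (bot x), b) else x = (Suc (bot x), b) \<and> succ x = (bot x, a)"
    and "strand (Cross k) a b" and "a = k \<or> a = Suc k"
  shows "crossing x"
proof (cases "up x")
  case True
  then have "lay x = Cross k" using assms(2) by (simp add: lay_def bot_def)
  moreover have "snd x = a" using assms(3) True by (metis snd_conv)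
  ultimately show ?thesis using assms(5) by (simp add: crossing_def)
next
  case False
  then have "lay x = dual (Cross k)" using assms(2) by (simp add: lay_def bot_def)
  moreover have "snd x = b" using assms(3) False by (metis snd_conv)
  ultimately show ?thesis using assms(4,5) by (auto simp: crossing_def)
qed

lemma turning_vs_strand:
  assumes x: "x \<in> nodes" "turning x" and y: "y \<in> nodes" "\<not> turning y" and b: "bot x = bot y"
    and s: "0 < s" "s < 1" and t: "0 < t" "t < 1"
    and eq: "piece x s = piece y t"
  shows False
proof -
  obtain k where k: "ls ! bot x = (if up x then Cup k else Cap k)"
    "(snd x, snd (succ x)) = (k, Suc k) \<or> (snd x, snd (succ x)) = (Suc k, k)"
    by (rule turning_node[OF x])
  obtain a c where ac: "strand (ls ! bot y) a c" "\<And>s. Re (piece y s) = real a + (real c - real a) * lam (ht y s)"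
    "if up y then y = (bot y, a) \<and> succ y = (Suc (bot y), c) else y = (Suc (bot y), c) \<and> succ y = (bot y, a)"
    by (rule strand_of_node[OF y]) (rule that; assumption)
  have h: "ht x s = ht y t" using Im_piece[OF x(1), of s] Im_piece[OF y(1), of t] eq b by simp
  have Re: "real (snd x) + (real (snd (succ x)) - real (snd x)) * lam s = real a + (real c - real a) * lam (ht x s)"
  proof -
    have "Re (piece x s) = real (snd x) + (real (snd (succ x)) - real (snd x)) * lam s" by (simp add: piece_def)
    then show ?thesis using ac(2)[of t] unfolding eq h by simp
  qed
  show False
  proof (cases "up x")
    case True
    then have "ht x s = kap s" using x(2) by (simp add: ht_def)
    then show False using cup_strand_disjoint[OF _ _ _ k(2), of a c s] ac(1) k(1) True b s Re by simp
  next
    case False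
    then have "ht x s = 1 - kap s" using x(2) by (simp add: ht_def)
    then show False using cap_strand_disjoint[OF _ _ _ k(2), of a c s] ac(1) k(1) False b s Re by simp
  qed
qed

text \<open>Inner points of a piece have non-integral height, which determines the strip. Within a
  strip, a turning piece avoids all others, since a layer has at most one cap or cup, and strands
  running through meet only in the middle of a \<open>Cross\<close> layer. The end point belongs to
  the next piece, hence the half-open range of parameters.\<close>

theorem piece_injective:
  assumes x: "x \<in> nodes" and y: "y \<in> nodes" and s: "0 \<le> s" "s < 1" and t: "0 \<le> t" "t < 1"
    and eq: "piece x s = piece y t"
  shows "x = y \<and> s = t \<or> x \<noteq> y \<and> crossing x \<and> crossing y \<and> bot x = bot y \<and> s = 1/2 \<and> t = 1/2"
proof -
  have no: False if "x \<in> nodes" "y \<in> nodes" "s = 0" "0 < t" "t < 1" "piece x s = piece y t" for x y s t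
  proof -
    have "real (fst x) = real (bot y) + ht y t"
      using Im_piece[OF that(2), of t] that(3,6) piece_0[of x] by (metis complex.sel(2))
    then have "real (bot y) < real (fst x)" "real (fst x) < real (Suc (bot y))" using ht_bounds[OF that(4,5), of y] by auto
    then have "bot y < fst x" "fst x < Suc (bot y)" by (simp_all only: of_nat_less_iff)
    then show False by simp
  qed
  show ?thesis
  proof (cases "s = 0 \<or> t = 0")
    case True
    then have st: "s = 0" "t = 0" using no[OF x y, of s t] no[OF y x, of t s] s t eq by force+
    then have "x = y" using eq by (simp add: piece_0 prod_eq_iff)
    then show ?thesis using st by simp
  next
    case False
    then have s: "0 < s" "s < 1" and t: "0 < t" "t < 1" using s t by auto
    have hb: "0 < ht x s" "ht x s < 1" "0 < ht y t" "ht y t < 1" using ht_bounds s t by auto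
    have im: "real (bot x) + ht x s = real (bot y) + ht y t" using Im_piece[OF x, of s] Im_piece[OF y, of t] eq by simp
    have b: "bot x = bot y"
    proof -
      have "real (bot x) < real (Suc (bot y))" "real (bot y) < real (Suc (bot x))" using im hb by auto
      then have "bot x < Suc (bot y)" "bot y < Suc (bot x)" by (simp_all only: of_nat_less_iff)
      then show ?thesis by simp
    qed
    have h: "ht x s = ht y t" using im b by simp
    consider "turning x" "turning y" | "turning x \<noteq> turning y" | "\<not> turning x" "\<not> turning y" by blast
    then show ?thesis
    proof cases
      case 1
      obtain k where k: "ls ! bot x = (if up x then Cup k else Cap k)"
        "(snd x, snd (succ x)) = (k, Suc k) \<or> (snd x, snd (succ x)) = (Suc k, k)" "fst (succ x) = fst x"
        by (rule turning_node[OF x 1(1)])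
      obtain l where l: "ls ! bot y = (if up y then Cup l else Cap l)"
        "(snd y, snd (succ y)) = (l, Suc l) \<or> (snd y, snd (succ y)) = (Suc l, l)" "fst (succ y) = fst y"
        by (rule turning_node[OF y 1(2)])
      have kl: "k = l" and ud: "up x = up y" using k(1) l(1) b by (auto split: if_splits)
      have f: "fst x = fst y" using b ud node_down[OF x] node_down[OF y] by (auto simp: bot_def split: if_splits)
      have "snd x = snd y"
      proof (rule ccontr)
        assume "snd x \<noteq> snd y"
        \<comment> \<open>The nodes would be the two ends of one turning strand; but direction is
          reversed from one end to the other, while both nodes have the same direction.\<close>
        then have "succ x = y" using k l kl f by (auto simp: prod_eq_iff)
        then show False using succ_dir[OF x] 1 ud by simp
      qed
      then have xy: "x = y" using f by (simp add: prod_eq_iff)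
      have "kap s = kap t" using h 1 ud by (auto simp: ht_def split: if_splits)
      moreover have "lam s = lam t"
      proof -
        have "Re (piece x s) = Re (piece x t)" using eq xy by simp
        then have "(real (snd (succ x)) - real (snd x)) * (lam s - lam t) = 0" by (simp add: piece_def algebra_simps)
        then show ?thesis using k(2) by auto
      qed
      ultimately show ?thesis using lam_kap_inj xy by blast
    next
      case 2
      then show ?thesis using turning_vs_strand[OF x _ y _ b s t eq] turning_vs_strand[OF y _ x _ b[symmetric] t s eq[symmetric]] by blast
    next
      case 3
      obtain a c where ac: "strand (ls ! bot x) a c" "\<And>s. Re (piece x s) = real a + (real c - real a) * lam (ht x s)"
        "if up x then x = (bot x, a) \<and> succ x = (Suc (bot x), c) else x = (Suc (bot x), c) \<and> succ x = (bot x, a)"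
        by (rule strand_of_node[OF x 3(1)]) (rule that; assumption)
      obtain a' c' where ac': "strand (ls ! bot y) a' c'" "\<And>s. Re (piece y s) = real a' + (real c' - real a') * lam (ht y s)"
        "if up y then y = (bot y, a') \<and> succ y = (Suc (bot y), c') else y = (Suc (bot y), c') \<and> succ y = (bot y, a')"
        by (rule strand_of_node[OF y 3(2)]) (rule that; assumption)
      have Re: "real a + (real c - real a) * lam (ht x s) = real a' + (real c' - real a') * lam (ht x s)"
        using ac(2)[of s] ac'(2)[of t] eq h by simp
      have st: "ht x s = (if up x then s else 1 - s)" "ht y t = (if up y then t else 1 - t)" using 3 by (simp_all add: ht_def)
      from strand_unique[OF ac(1) ac'(1)[folded b] lam_bounds Re]
      show ?thesis
      proof
        assume aa: "a = a' \<and> c = c'"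
        have "up x = up y"
        proof (rule ccontr)
          assume ne: "up x \<noteq> up y"
          then have "succ x = y" using ac(3) ac'(3) aa b by (auto split: if_splits)
          then show False using succ_dir[OF x] 3 ne by simp
        qed
        then have "x = y" using ac(3) ac'(3) aa b by (auto split: if_splits)
        then show ?thesis using st h by (auto split: if_splits)
      next
        assume "\<exists>k. ls ! bot x = Cross k \<and> {a, a'} = {k, Suc k} \<and> lam (ht x s) = 1/2"
        then obtain k where k: "ls ! bot x = Cross k" "{a, a'} = {k, Suc k}" "lam (ht x s) = 1/2" by blast
        then have "ht x s = 1/2" using lam_eq_half_iff by blast
        then have half: "s = 1/2" "t = 1/2" using st h by (auto split: if_splits)
        have aa: "(a = k \<and> a' = Suc k) \<or> (a = Suc k \<and> a' = k)" using k(2) by (auto simp: doubleton_eq_iff)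
        have cx: "crossing x" by (rule crossing_of_strand[OF x k(1) ac(3)]) (use ac(1) k(1) aa in auto)
        have cy: "crossing y" by (rule crossing_of_strand[OF y k(1)[unfolded b] ac'(3)]) (use ac'(1) k(1) b aa in auto)
        have "x \<noteq> y"
        proof
          assume "x = y"
          then have "snd x = snd y" "succ x = succ y" "up x = up y" by auto
          then show False using ac(3) ac'(3) aa ac(1) ac'(1) b k(1) by (auto split: if_splits)
        qed
        then show ?thesis using half cx cy b by blast
      qed
    qed
  qed
qed

text \<open>Two pieces leading to the same node coincide shortly before it, for instance at 9/10,
  which lies between 3/4 and 1; but distinct pieces can meet only at parameter 1/2.\<close>

lemma succ_inj: "inj_on succ nodes"
proof (rule inj_onI)
  fix x y assume xy: "x \<in> nodes" "y \<in> nodes" "succ x = succ y"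
  have "piece x (9/10) = piece y (9/10)"
    using piece_overlap[OF xy(1), of "9/10"] piece_overlap[OF xy(2), of "9/10"] xy(3) by simp
  then show "x = y" using piece_injective[OF xy(1,2), of "9/10" "9/10"] by auto
qed

lemma piece_smooth: "smooth_curve (piece x)"
proof -
  have "smooth_real (\<lambda>s. real (snd x) + (real (snd (succ x)) - real (snd x)) * lam s)"
    by (intro smooth_real_add smooth_real_mult smooth_real_const lam_smooth)
  moreover have "smooth_real (\<lambda>s. real (fst x) + (if up x then 1 else -1) * (if turning x then kap s else s))"
    by (cases "turning x") (simp_all add: smooth_real_add smooth_real_mult smooth_real_const kap_smooth smooth_real_ident)
  ultimately show ?thesis using smooth_curve_Complex by (simp add: piece_def[abs_def])
qed

lemma piece_has_derivative:
  assumes "(lam has_real_derivative d) (at s)" and "(kap has_real_derivative e) (at s)"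
  shows "(piece x has_vector_derivative Complex ((real (snd (succ x)) - real (snd x)) * d)
     ((if up x then 1 else -1) * (if turning x then e else 1))) (at s)"
proof -
  have 1: "((\<lambda>s. real (snd x) + (real (snd (succ x)) - real (snd x)) * lam s) has_real_derivative (real (snd (succ x)) - real (snd x)) * d) (at s)"
    by (rule derivative_eq_intros assms(1) refl | simp)+
  have 2: "((\<lambda>s. real (fst x) + (if up x then 1 else -1) * (if turning x then kap s else s)) has_real_derivative
     (if up x then 1 else -1) * (if turning x then e else 1)) (at s)"
    by (cases "turning x"; cases "up x"; simp) (rule derivative_eq_intros assms(2) refl | simp)+
  show ?thesis unfolding has_vector_derivative_complex_iff using 1 2 by (simp add: piece_def[abs_def])
qed

end

lemma smooth_real_differentiable: "smooth_real f \<Longrightarrow> \<exists>d. (f has_real_derivative d) (at s)"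
  unfolding smooth_real_def by blast

text \<open>At 1/4 and 3/4 linearity is known on one side only, so the derivative is computed as a
  one-sided limit.\<close>

lemma kap_deriv_ends:
  assumes "s \<le> 1/4 \<or> 3/4 \<le> s" and "(kap has_real_derivative e) (at s)"
  shows "e \<noteq> 0"
proof -
  have q: "((\<lambda>u. (kap u - kap s) / (u - s)) \<longlongrightarrow> e) (at s)"
    using assms(2) unfolding has_field_derivative_iff by (simp add: field_simps)
  show ?thesis
  proof (cases "s \<le> 1/4")
    case True
    have "((\<lambda>u. (kap u - kap s) / (u - s)) \<longlongrightarrow> e) (at_left s)"
      by (rule tendsto_mono[OF _ q]) (simp add: at_le)
    moreover have "((\<lambda>u. (kap u - kap s) / (u - s)) \<longlongrightarrow> 1) (at_left s)"
    proof (rule Lim_transform_eventually[OF tendsto_const])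
      show "\<forall>\<^sub>F u in at_left s. 1 = (kap u - kap s) / (u - s)"
        using eventually_at_left_real[of "s - 1" s, simplified]
        by eventually_elim (use True in \<open>simp add: kap_low\<close>)
    qed
    ultimately have "e = 1" using tendsto_unique trivial_limit_at_left_real by blast
    then show ?thesis by simp
  next
    case False
    then have s: "3/4 \<le> s" using assms(1) by simp
    have "((\<lambda>u. (kap u - kap s) / (u - s)) \<longlongrightarrow> e) (at_right s)"
      by (rule tendsto_mono[OF _ q]) (simp add: at_le)
    moreover have "((\<lambda>u. (kap u - kap s) / (u - s)) \<longlongrightarrow> -1) (at_right s)"
    proof (rule Lim_transform_eventually[OF tendsto_const])
      show "\<forall>\<^sub>F u in at_right s. -1 = (kap u - kap s) / (u - s)"
        using eventually_at_right_real[of s "s + 1", simplified]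
        by eventually_elim (use s in \<open>simp add: kap_high field_simps\<close>)
    qed
    ultimately have "e = -1" using tendsto_unique trivial_limit_at_right_real by blast
    then show ?thesis by simp
  qed
qed

section \<open>Velocities of the pieces and the pairs that cross\<close>

context sweeping
begin

text \<open>A strand running through has vertical speed 1 or -1. A turning strand has horizontal
  speed where \<open>lam\<close> has positive derivative, and vertical speed on the outer quarters,
  where \<open>kap\<close> is linear.\<close>

lemma piece_immersion: "x \<in> nodes \<Longrightarrow> vector_derivative (piece x) (at s) \<noteq> 0"
proof -
  assume x: "x \<in> nodes"
  obtain d where d: "(lam has_real_derivative d) (at s)" using smooth_real_differentiable[OF lam_smooth] by blast
  obtain e where e: "(kap has_real_derivative e) (at s)" using smooth_real_differentiable[OF kap_smooth] by blast
  have v: "vector_derivative (piece x) (at s) = Complex ((real (snd (succ x)) - real (snd x)) * d)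
     ((if up x then 1 else -1) * (if turning x then e else 1))"
    by (rule vector_derivative_at[OF piece_has_derivative[OF d e]])
  show ?thesis
  proof (cases "turning x")
    case False
    then show ?thesis unfolding v by (simp add: complex_eq_iff)
  next
    case True
    obtain k where k: "(snd x, snd (succ x)) = (k, Suc k) \<or> (snd x, snd (succ x)) = (Suc k, k)"
      by (rule turning_node[OF x True])
    then have ne: "real (snd (succ x)) - real (snd x) \<noteq> 0" by auto
    have "d \<noteq> 0 \<or> e \<noteq> 0"
    proof (cases "s \<le> 1/4 \<or> 3/4 \<le> s")
      case True
      then show ?thesis using kap_deriv_ends[OF True e] by simp
    next
      case False
      then obtain d' where "d' > 0" "(lam has_real_derivative d') (at s)" using lam_deriv[of s] by auto
      then show ?thesis using DERIV_unique[OF d] by auto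
    qed
    then show ?thesis unfolding v using ne True by (auto simp: complex_eq_iff)
  qed
qed

text \<open>The passage to which the edge at the node leads; at a crossing node it is the passage
  made within this piece.\<close>

definition letter_of :: "node \<Rightarrow> symbol" where
  "letter_of x = nxt (fst (lab x))"

definition vel :: "node \<Rightarrow> complex" where
  "vel x = vector_derivative (piece x) (at (1/2))"

lemma crossing_node_bounds: "x \<in> nodes \<Longrightarrow> crossing x \<Longrightarrow> \<exists>k. ls ! bot x = Cross k \<and> (snd x = k \<or> snd x = Suc k)"
proof -
  assume x: "crossing x"
  then obtain k where k: "lay x = Cross k" "snd x = k \<or> snd x = Suc k" unfolding crossing_def by (cases "lay x") auto
  have "ls ! bot x = Cross k" using k(1) by (cases "ls ! bot x") (auto simp: lay_def bot_def split: if_splits)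
  then show ?thesis using k(2) by blast
qed

lemma vel_eq:
  obtains d where "d > 0" and "\<And>x. crossing x \<Longrightarrow> vel x = Complex ((real (snd (succ x)) - real (snd x)) * d) (if up x then 1 else -1)"
proof -
  obtain d where d: "d > 0" "(lam has_real_derivative d) (at (1/2))" using lam_deriv[of "1/2"] by auto
  obtain e where e: "(kap has_real_derivative e) (at (1/2))" using smooth_real_differentiable[OF kap_smooth] by blast
  show ?thesis
  proof (rule that[OF d(1)])
    fix x assume "crossing x"
    then show "vel x = Complex ((real (snd (succ x)) - real (snd x)) * d) (if up x then 1 else -1)"
      using vector_derivative_at[OF piece_has_derivative[OF d(2) e], of x] crossing_not_turning[of x] by (simp add: vel_def)
  qed
qed

text \<open>The cases are the four rotations of \<open>vertex i\<close>. In each of them the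
  positions and directions of the two strands are known, and the clockwise order of the darts makes
  the velocities of \<open>(i, -1)\<close> and \<open>(i, 1)\<close> a positive basis.\<close>

lemma crossing_pair:
  assumes h: "h < length ls" and T: "ls ! h = Cross k"
  obtains p q where "p \<in> nodes" "q \<in> nodes" "crossing p" "crossing q" "bot p = h" "bot q = h"
    "letter_of p = (cross_index ws ls h, -1)" "letter_of q = (cross_index ws ls h, 1)"
    "\<And>x. x \<in> nodes \<Longrightarrow> crossing x \<Longrightarrow> bot x = h \<Longrightarrow> x = p \<or> x = q"
    "piece p (1/2) = piece q (1/2)" "det2 (vel p) (vel q) > 0"
proof -
  obtain A C a b a' b' i m where S: "length A = k" "ws ! h = A @ a # b # C" "ws ! Suc h = A @ b' # a' # C" "i \<in> I"
    "rotate m (vertex i) = [opp a, b', a', opp b]" using steps[OF h] unfolding T by (auto simp del: split_paired_Ex)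
  have labs: "lab (h, k) = a" "lab (h, Suc k) = b" "lab (Suc h, k) = b'" "lab (Suc h, Suc k) = a'"
    using S by (auto simp: lab_def nth_append)
  have nd: "(h, k) \<in> nodes" "(h, Suc k) \<in> nodes" "(Suc h, k) \<in> nodes" "(Suc h, Suc k) \<in> nodes"
    using S h len by (auto simp: nodes_def)
  have ci: "cross_index ws ls h = i"
  proof -
    have "opp a \<in> set (vertex i)" using S(5) by (metis list.set_intros(1) set_rotate)
    then show ?thesis using head_vertex[OF S(4), of a] S(1,2) T by (simp add: cross_index_def nth_append)
  qed
  have U: "crossing (h, j)" "bot (h, j) = h" "succ (h, j) = (Suc h, if j = k then Suc k else k)"
    if "up (h, j)" "j = k \<or> j = Suc k" for j
    using that T by (auto simp: crossing_def lay_def bot_def succ_def turning_def)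
  have Dn: "crossing (Suc h, j)" "bot (Suc h, j) = h" "succ (Suc h, j) = (h, if j = k then Suc k else k)"
    if "\<not> up (Suc h, j)" "j = k \<or> j = Suc k" for j
    using that T by (auto simp: crossing_def lay_def bot_def succ_def turning_def)
  have cand: "x \<in> {(h, k), (h, Suc k)} \<and> up x \<or> x \<in> {(Suc h, k), (Suc h, Suc k)} \<and> \<not> up x"
    if x: "x \<in> nodes" "crossing x" "bot x = h" for x
  proof -
    have "snd x = k \<or> snd x = Suc k" using crossing_node_bounds[OF x(1,2)] x(3) T by auto
    moreover have "fst x = (if up x then h else Suc h)" using x(3) node_down[OF x(1)] by (auto simp: bot_def)
    ultimately show ?thesis by (cases "up x") (auto simp: prod_eq_iff)
  qed
  obtain d where d: "d > 0" "\<And>x. crossing x \<Longrightarrow> vel x = Complex ((real (snd (succ x)) - real (snd x)) * d) (if up x then 1 else -1)"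
    by (rule vel_eq) (rule that; assumption)
  have n: "nxt (prv (i, 1)) = (i, 1)" "nxt (prv (i, -1)) = (i, -1)" using S(4) nxt_prv by auto
  obtain la xa where a: "a = (la, xa)" by (cases a)
  obtain lb xb where b: "b = (lb, xb)" by (cases b)
  have op: "opp (l, x) = (l, \<not> x)" for l x by (simp add: opp_def)
  note R = rotated_vertex[OF S(5), unfolded a b op prod.inject]
  have half: "piece x (1/2) = Complex (real k + 1/2) (real h + 1/2)"
    if "crossing x" "{snd x, snd (succ x)} = {k, Suc k}" "if up x then fst x = h else fst x = Suc h" for x
    using that crossing_not_turning[of x] by (auto simp: piece_def lam_half doubleton_eq_iff)
  show ?thesis
  proof (rule R)
    assume c: "la = (i, -1) \<and> (\<not> xa) = True" "b' = (prv (i, 1), False)" "a' = (prv (i, -1), False)" "lb = (i, 1) \<and> (\<not> xb) = True"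
    have dn: "\<not> up (Suc h, k)" "\<not> up (Suc h, Suc k)" "\<not> up (h, k)" "\<not> up (h, Suc k)" using labs a b c by simp_all
    note P = Dn[OF dn(2) disjI2[OF refl]] and Q = Dn[OF dn(1) disjI1[OF refl]]
    show ?thesis
    proof (rule that[of "(Suc h, Suc k)" "(Suc h, k)"])
      show "x = (Suc h, Suc k) \<or> x = (Suc h, k)" if "x \<in> nodes" "crossing x" "bot x = h" for x
        using cand[OF that] dn by auto
      show "piece (Suc h, Suc k) (1/2) = piece (Suc h, k) (1/2)" using half[OF P(1)] half[OF Q(1)] P Q dn by (simp add: insert_commute)
      show "det2 (vel (Suc h, Suc k)) (vel (Suc h, k)) > 0" using d(1) d(2)[OF P(1)] d(2)[OF Q(1)] P Q dn by (simp add: det2_def)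
    qed (use nd P Q labs c n ci in \<open>simp_all add: letter_of_def\<close>)
  next
    assume c: "la = prv (i, 1) \<and> (\<not> xa) = False" "b' = (prv (i, -1), False)" "a' = ((i, 1), True)" "lb = (i, -1) \<and> (\<not> xb) = True"
    have dn: "\<not> up (Suc h, k)" "up (Suc h, Suc k)" "up (h, k)" "\<not> up (h, Suc k)" using labs a b c by simp_all
    note P = Dn[OF dn(1) disjI1[OF refl]] and Q = U[OF dn(3) disjI1[OF refl]]
    show ?thesis
    proof (rule that[of "(Suc h, k)" "(h, k)"])
      show "x = (Suc h, k) \<or> x = (h, k)" if "x \<in> nodes" "crossing x" "bot x = h" for x
        using cand[OF that] dn by auto
      show "piece (Suc h, k) (1/2) = piece (h, k) (1/2)" using half[OF P(1)] half[OF Q(1)] P Q dn by (simp add: insert_commute)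
      show "det2 (vel (Suc h, k)) (vel (h, k)) > 0" using d(1) d(2)[OF P(1)] d(2)[OF Q(1)] P Q dn by (simp add: det2_def)
    qed (use nd P Q labs c n ci a in \<open>simp_all add: letter_of_def\<close>)
  next
    assume c: "la = prv (i, -1) \<and> (\<not> xa) = False" "b' = ((i, 1), True)" "a' = ((i, -1), True)" "lb = prv (i, 1) \<and> (\<not> xb) = False"
    have dn: "up (Suc h, k)" "up (Suc h, Suc k)" "up (h, k)" "up (h, Suc k)" using labs a b c by simp_all
    note P = U[OF dn(3) disjI1[OF refl]] and Q = U[OF dn(4) disjI2[OF refl]]
    show ?thesis
    proof (rule that[of "(h, k)" "(h, Suc k)"])
      show "x = (h, k) \<or> x = (h, Suc k)" if "x \<in> nodes" "crossing x" "bot x = h" for x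
        using cand[OF that] dn by auto
      show "piece (h, k) (1/2) = piece (h, Suc k) (1/2)" using half[OF P(1)] half[OF Q(1)] P Q dn by (simp add: insert_commute)
      show "det2 (vel (h, k)) (vel (h, Suc k)) > 0" using d(1) d(2)[OF P(1)] d(2)[OF Q(1)] P Q dn by (simp add: det2_def)
    qed (use nd P Q labs c n ci a b in \<open>simp_all add: letter_of_def\<close>)
  next
    assume c: "la = (i, 1) \<and> (\<not> xa) = True" "b' = ((i, -1), True)" "a' = (prv (i, 1), False)" "lb = prv (i, -1) \<and> (\<not> xb) = False"
    have dn: "up (Suc h, k)" "\<not> up (Suc h, Suc k)" "\<not> up (h, k)" "up (h, Suc k)" using labs a b c by simp_all
    note P = U[OF dn(4) disjI2[OF refl]] and Q = Dn[OF dn(2) disjI2[OF refl]]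
    show ?thesis
    proof (rule that[of "(h, Suc k)" "(Suc h, Suc k)"])
      show "x = (h, Suc k) \<or> x = (Suc h, Suc k)" if "x \<in> nodes" "crossing x" "bot x = h" for x
        using cand[OF that] dn by auto
      show "piece (h, Suc k) (1/2) = piece (Suc h, Suc k) (1/2)" using half[OF P(1)] half[OF Q(1)] P Q dn by (simp add: insert_commute)
      show "det2 (vel (h, Suc k)) (vel (Suc h, Suc k)) > 0" using d(1) d(2)[OF P(1)] d(2)[OF Q(1)] P Q dn by (simp add: det2_def)
    qed (use nd P Q labs c n ci b in \<open>simp_all add: letter_of_def\<close>)
  qed
qed

lemma letter_of_bij: "bij_betw letter_of {x \<in> nodes. crossing x} (I \<times> {1, -1})"
proof -
  have layer: "bot x < length ls \<and> (\<exists>k. ls ! bot x = Cross k)" if "x \<in> nodes" "crossing x" for x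
    using crossing_node_bounds[OF that] bot_less[OF that(1)] by blast
  have ciI: "cross_index ws ls h \<in> I" if "h < length ls" "ls ! h = Cross k" for h k
    using cross_bij that by (auto simp: bij_betw_def)
  have cinj: "h = h'" if "h < length ls" "ls ! h = Cross k" "h' < length ls" "ls ! h' = Cross k'"
    "cross_index ws ls h = cross_index ws ls h'" for h h' k k'
    using inj_onD[OF bij_betw_imp_inj_on[OF cross_bij] that(5)] that by simp
  have fst_let: "fst (letter_of x) = cross_index ws ls (bot x) \<and> letter_of x \<in> I \<times> {1, -1}" if x: "x \<in> nodes" "crossing x" for x
  proof -
    obtain k where k: "bot x < length ls" "ls ! bot x = Cross k" using layer[OF x] by blast
    show ?thesis
    proof (rule crossing_pair[OF k])
      fix p q assume *: "letter_of p = (cross_index ws ls (bot x), -1)" "letter_of q = (cross_index ws ls (bot x), 1)"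
        "\<And>y. y \<in> nodes \<Longrightarrow> crossing y \<Longrightarrow> bot y = bot x \<Longrightarrow> y = p \<or> y = q"
      have "x = p \<or> x = q" using *(3)[OF x refl] .
      then show ?thesis using *(1,2) ciI[OF k] by auto
    qed
  qed
  show ?thesis
    unfolding bij_betw_def
  proof
    show "inj_on letter_of {x \<in> nodes. crossing x}"
    proof (rule inj_onI)
      fix x y assume "x \<in> {x \<in> nodes. crossing x}" "y \<in> {x \<in> nodes. crossing x}" and e: "letter_of x = letter_of y"
      then have x: "x \<in> nodes" "crossing x" and y: "y \<in> nodes" "crossing y" by auto
      obtain k where k: "bot x < length ls" "ls ! bot x = Cross k" using layer[OF x] by blast
      obtain k' where k': "bot y < length ls" "ls ! bot y = Cross k'" using layer[OF y] by blast
      have b: "bot x = bot y" using cinj[OF k k'] fst_let[OF x] fst_let[OF y] e by simp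
      show "x = y"
      proof (rule crossing_pair[OF k])
        fix p q assume *: "letter_of p = (cross_index ws ls (bot x), -1)" "letter_of q = (cross_index ws ls (bot x), 1)"
          "\<And>z. z \<in> nodes \<Longrightarrow> crossing z \<Longrightarrow> bot z = bot x \<Longrightarrow> z = p \<or> z = q"
        have "x = p \<or> x = q" "y = p \<or> y = q" using *(3)[OF x refl] *(3)[OF y b[symmetric]] by auto
        then show "x = y" using *(1,2) e by auto
      qed
    qed
    show "letter_of ` {x \<in> nodes. crossing x} = I \<times> {1, -1}"
    proof
      show "letter_of ` {x \<in> nodes. crossing x} \<subseteq> I \<times> {1, -1}" using fst_let by blast
      show "I \<times> {1, -1} \<subseteq> letter_of ` {x \<in> nodes. crossing x}"
      proof
        fix m assume m: "m \<in> I \<times> {1, -1 :: int}"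
        then have "fst m \<in> cross_index ws ls ` {h. h < length ls \<and> is_cross (ls ! h)}" using cross_bij by (auto simp: bij_betw_def)
        then obtain h where h: "h < length ls" "is_cross (ls ! h)" "cross_index ws ls h = fst m" by auto
        then obtain k where k: "ls ! h = Cross k" by (cases "ls ! h") auto
        show "m \<in> letter_of ` {x \<in> nodes. crossing x}"
        proof (rule crossing_pair[OF h(1) k])
          fix p q assume *: "p \<in> nodes" "q \<in> nodes" "crossing p" "crossing q"
            "letter_of p = (cross_index ws ls h, -1)" "letter_of q = (cross_index ws ls h, 1)"
          have "m = letter_of p \<or> m = letter_of q" using m h(3) * by (cases m) auto
          then show ?thesis using * by blast
        qed
      qed
    qed
  qed
qed

lemma crossing_partner:
  assumes x: "x \<in> nodes" "crossing x" and y: "y \<in> nodes" "crossing y"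
  shows "bot x = bot y \<longleftrightarrow> fst (letter_of x) = fst (letter_of y)"
    and "fst (letter_of x) = fst (letter_of y) \<Longrightarrow> piece x (1/2) = piece y (1/2)"
    and "letter_of x = (i, -1) \<Longrightarrow> letter_of y = (i, 1) \<Longrightarrow> det2 (vel x) (vel y) > 0"
proof -
  obtain k where k: "bot x < length ls" "ls ! bot x = Cross k" using crossing_node_bounds[OF x] bot_less[OF x(1)] by blast
  obtain p q where pq: "p \<in> nodes" "q \<in> nodes" "crossing p" "crossing q" "bot p = bot x" "bot q = bot x"
    "letter_of p = (cross_index ws ls (bot x), -1)" "letter_of q = (cross_index ws ls (bot x), 1)"
    "\<And>z. z \<in> nodes \<Longrightarrow> crossing z \<Longrightarrow> bot z = bot x \<Longrightarrow> z = p \<or> z = q"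
    "piece p (1/2) = piece q (1/2)" "det2 (vel p) (vel q) > 0"
    by (rule crossing_pair[OF k]) (rule that; assumption)
  have inj: "a = b" if "a \<in> nodes" "crossing a" "b \<in> nodes" "crossing b" "letter_of a = letter_of b" for a b
    using inj_onD[OF bij_betw_imp_inj_on[OF letter_of_bij] that(5)] that by simp
  have yl: "letter_of y \<in> I \<times> {1, -1}" using letter_of_bij y by (auto simp: bij_betw_def)
  have xpq: "x = p \<or> x = q" using pq(9)[OF x refl] .
  show iff: "bot x = bot y \<longleftrightarrow> fst (letter_of x) = fst (letter_of y)"
  proof
    assume "bot x = bot y"
    then have "y = p \<or> y = q" using pq(9)[OF y] by simp
    then show "fst (letter_of x) = fst (letter_of y)" using xpq pq(7,8) by auto
  next
    assume "fst (letter_of x) = fst (letter_of y)"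
    then have "letter_of y = letter_of p \<or> letter_of y = letter_of q" using xpq pq(7,8) yl by (cases "letter_of y") auto
    then have "y = p \<or> y = q" using inj[OF y pq(1,3)] inj[OF y pq(2,4)] by blast
    then show "bot x = bot y" using pq(5,6) by auto
  qed
  show "piece x (1/2) = piece y (1/2)" if "fst (letter_of x) = fst (letter_of y)"
  proof -
    have "y = p \<or> y = q" using pq(9)[OF y] iff that by simp
    then show ?thesis using xpq pq(10) by auto
  qed
  show "det2 (vel x) (vel y) > 0" if "letter_of x = (i, -1)" "letter_of y = (i, 1)"
  proof -
    have "y = p \<or> y = q" using pq(9)[OF y] iff that by simp
    then have "x = p" "y = q" using xpq that pq(7,8) by auto
    then show ?thesis using pq(11) by simp
  qed
qed

section \<open>Orbits of \<open>succ\<close> and the words they read\<close>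

lemma succ_pow_in: "x \<in> nodes \<Longrightarrow> (succ ^^ i) x \<in> nodes"
  by (induction i) (auto simp: succ_in)

lemma succ_pow_inj: "x \<in> nodes \<Longrightarrow> y \<in> nodes \<Longrightarrow> (succ ^^ i) x = (succ ^^ i) y \<Longrightarrow> x = y"
proof (induction i)
  case (Suc i)
  then have "succ ((succ ^^ i) x) = succ ((succ ^^ i) y)" by simp
  then have "(succ ^^ i) x = (succ ^^ i) y" using inj_onD[OF succ_inj] succ_pow_in Suc.prems by blast
  then show ?case using Suc by simp
qed simp

lemma succ_pow_diff:
  assumes "x \<in> nodes" "i < j" "(succ ^^ i) x = (succ ^^ j) x"
  shows "(succ ^^ (j - i)) x = x"
proof -
  have "(succ ^^ i) ((succ ^^ (j - i)) x) = (succ ^^ i) x"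
    using assms(2,3) by (simp flip: funpow_add[unfolded o_def, THEN fun_cong])
  then show ?thesis using succ_pow_inj[OF succ_pow_in[OF assms(1)] assms(1)] by blast
qed

lemma succ_return: "x \<in> nodes \<Longrightarrow> \<exists>n>0. (succ ^^ n) x = x"
proof -
  assume x: "x \<in> nodes"
  have "\<not> inj_on (\<lambda>i. (succ ^^ i) x) UNIV"
  proof
    assume "inj_on (\<lambda>i. (succ ^^ i) x) UNIV"
    then have "finite (UNIV :: nat set)"
      by (rule inj_on_finite[OF _ _ finite_nodes]) (use succ_pow_in[OF x] in auto)
    then show False by simp
  qed
  then obtain i j where ij: "(succ ^^ i) x = (succ ^^ j) x" "i \<noteq> j" by (auto simp: inj_on_def)
  show ?thesis
  proof (cases "i < j")
    case True
    then show ?thesis using succ_pow_diff[OF x True ij(1)] by (intro exI[of _ "j - i"]) simp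
  next
    case False
    then have "j < i" using ij(2) by simp
    then show ?thesis using succ_pow_diff[OF x _ ij(1)[symmetric]] by (intro exI[of _ "i - j"]) simp
  qed
qed

lemma nxt_pow_word:
  assumes "u \<noteq> []" and "map nxt u = rotate1 u"
  shows "(nxt ^^ n) (u ! 0) = u ! (n mod length u)"
proof (induction n)
  case (Suc n)
  have l: "n mod length u < length u" using assms(1) by simp
  have "nxt (u ! (n mod length u)) = map nxt u ! (n mod length u)" using l by simp
  also have "\<dots> = u ! (Suc (n mod length u) mod length u)" unfolding assms(2) using l by (simp add: nth_rotate1)
  finally show ?case using Suc by (simp add: mod_Suc_eq)
qed simp

text \<open>Start at the node that makes the passage \<open>u ! 0\<close> and follow
  \<open>succ\<close> until the first return. The crossings met read iterates of \<open>nxt\<close>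
  from \<open>u ! 0\<close> on; their number is a positive multiple of the length of
  \<open>u\<close>, and by injectivity of \<open>letter_of\<close> not a larger one than the length
  itself.\<close>

theorem component_orbit:
  assumes u: "u \<noteq> []" "distinct u" "set u \<subseteq> I \<times> {1, -1}" "map nxt u = rotate1 u"
  obtains z L js where "L > 0" "\<And>i. z i \<in> nodes" "\<And>i. z (Suc i) = succ (z i)" "z L = z 0" "inj_on z {..<L}"
    "sorted js" "distinct js" "set js = {i. i < L \<and> crossing (z i)}" "map (\<lambda>i. letter_of (z i)) js = u" "crossing (z 0)"
proof -
  let ?r = "length u"
  have "u ! 0 \<in> I \<times> {1, -1}" using u(1,3) nth_mem[of 0 u] by auto
  then have "u ! 0 \<in> letter_of ` {x \<in> nodes. crossing x}" using bij_betw_imp_surj_on[OF letter_of_bij] by simp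
  then obtain x0 where x0: "x0 \<in> nodes" "crossing x0" "letter_of x0 = u ! 0" by auto
  define z where "z i = (succ ^^ i) x0" for i
  define L where "L = (LEAST n. n > 0 \<and> (succ ^^ n) x0 = x0)"
  have L: "L > 0" "z L = x0" using LeastI_ex[OF succ_return[OF x0(1)]] by (simp_all add: L_def z_def)
  have Lmin: "\<not> (n > 0 \<and> z n = x0)" if "n < L" for n using not_less_Least[of n "\<lambda>n. n > 0 \<and> (succ ^^ n) x0 = x0"] that by (simp add: L_def z_def)
  have zn: "z i \<in> nodes" "z (Suc i) = succ (z i)" for i using succ_pow_in[OF x0(1)] by (simp_all add: z_def)
  have z0: "z 0 = x0" by (simp add: z_def)
  have inj: "inj_on z {..<L}"
  proof -
    have "False" if "i < j" "j < L" "z i = z j" for i j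
    proof -
      have "j - i < L" "0 < j - i" using that(1,2) by auto
      moreover have "z (j - i) = x0" using succ_pow_diff[OF x0(1) that(1)] that(3) by (simp add: z_def)
      ultimately show False using Lmin by blast
    qed
    then show ?thesis by (intro inj_onI) (metis lessThan_iff linorder_neqE_nat)
  qed
  define J where "J n = filter (\<lambda>i. crossing (z i)) [0..<n]" for n
  \<comment> \<open>Invariant along the orbit: the crossings met so far read the iterates in order,
    and the current edge leads to the next one.\<close>
  have track: "map (\<lambda>i. letter_of (z i)) (J (Suc n)) = map (\<lambda>q. (nxt ^^ q) (u ! 0)) [0..<length (J (Suc n))] \<and>
     nxt (fst (lab (z (Suc n)))) = (nxt ^^ length (J (Suc n))) (u ! 0)" for n
  proof (induction n)
    case 0
    have "fst (lab (z 1)) = letter_of x0" using succ_edge[OF x0(1)] x0(2) zn(2)[of 0] z0 by (simp add: letter_of_def)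
    then show ?case using x0 by (simp add: J_def z0)
  next
    case (Suc n)
    show ?case
    proof (cases "crossing (z (Suc n))")
      case True
      have J: "J (Suc (Suc n)) = J (Suc n) @ [Suc n]" using True by (simp add: J_def)
      have lt: "letter_of (z (Suc n)) = (nxt ^^ length (J (Suc n))) (u ! 0)" using Suc by (simp add: letter_of_def)
      have "fst (lab (z (Suc (Suc n)))) = letter_of (z (Suc n))"
        using succ_edge[OF zn(1)[of "Suc n"]] True zn(2)[of "Suc n"] by (simp add: letter_of_def)
      then show ?thesis using Suc lt unfolding J by simp
    next
      case False
      have J: "J (Suc (Suc n)) = J (Suc n)" using False by (simp add: J_def)
      have "fst (lab (z (Suc (Suc n)))) = fst (lab (z (Suc n)))"
        using succ_edge[OF zn(1)[of "Suc n"]] False zn(2)[of "Suc n"] by simp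
      then show ?thesis using Suc unfolding J by simp
    qed
  qed
  obtain L' where L': "L = Suc L'" using L(1) by (cases L) auto
  define C where "C = length (J L)"
  have T: "map (\<lambda>i. letter_of (z i)) (J L) = map (\<lambda>q. u ! (q mod ?r)) [0..<C]" "nxt (fst (lab (z L))) = u ! (C mod ?r)"
    using track[of L'] nxt_pow_word[OF u(1,4)] by (simp_all add: L' C_def)
  \<comment> \<open>After a full period the next letter is again the first one, which makes
    \<open>C\<close> a multiple of \<open>?r\<close>.\<close>
  have "u ! (C mod ?r) = u ! 0" using T(2) L(2) x0(3) by (simp add: letter_of_def)
  then have Cr: "C mod ?r = 0" using nth_eq_iff_index_eq[OF u(2), of "C mod ?r" 0] u(1) by simp
  have J0: "J L = 0 # tl (J L)" unfolding J_def L' using x0 z0 by (simp add: upt_conv_Cons del: upt_Suc)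
  then have C1: "C \<ge> 1" unfolding C_def by (metis One_nat_def Suc_leI length_Cons zero_less_Suc)
  have nth: "letter_of (z (J L ! q)) = u ! (q mod ?r)" if "q < C" for q
    using arg_cong[OF T(1), of "\<lambda>l. l ! q"] that by (simp add: C_def)
  have sJ: "set (J L) = {i. i < L \<and> crossing (z i)}" by (auto simp: J_def)
  have dJ: "distinct (J L)" "sorted (J L)" by (simp_all add: J_def sorted_wrt_filter)
  have "\<not> ?r < C"
  proof
    assume rC: "?r < C"
    have m: "J L ! ?r \<in> set (J L)" using rC by (simp add: C_def)
    have "letter_of (z (J L ! ?r)) = letter_of x0" using nth[OF rC] x0(3) by simp
    then have "z (J L ! ?r) = x0"
      using inj_onD[OF bij_betw_imp_inj_on[OF letter_of_bij]] m sJ zn(1) x0 by blast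
    moreover have "J L ! ?r \<noteq> 0"
    proof
      assume "J L ! ?r = 0"
      then have "J L ! ?r = J L ! 0" using J0 by (metis nth_Cons_0)
      moreover have "?r < length (J L)" "0 < length (J L)" using rC C1 unfolding C_def by linarith+
      ultimately have "?r = 0" using nth_eq_iff_index_eq[OF dJ(1)] by blast
      then show False using u(1) by simp
    qed
    ultimately show False using Lmin[of "J L ! ?r"] m sJ by simp
  qed
  then have "C = ?r" using Cr C1 by (metis dvd_imp_le le_antisym linorder_not_less mod_0_imp_dvd not_one_le_zero zero_less_iff_neq_zero)
  moreover have "map (\<lambda>q. u ! (q mod ?r)) [0..<?r] = u" by (rule nth_equalityI) simp_all
  ultimately have "map (\<lambda>i. letter_of (z i)) (J L) = u" using T(1) by simp
  then show ?thesis using that[of L z "J L"] L zn z0 inj dJ sJ x0 by simp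
qed

end

section \<open>The diagram drawn by a sweep\<close>

text \<open>
  \<open>z j\<close> walks along component \<open>j\<close> with period \<open>per j\<close>, and \<open>js j\<close> are the times of its passages
  through crossings.
\<close>

locale realization = sweeping I nxt prv ls ws for I nxt prv ls ws +
  fixes us :: "symbol list list" and e :: "nat \<Rightarrow> sign"
    and z :: "nat \<Rightarrow> nat \<Rightarrow> node" and per :: "nat \<Rightarrow> nat" and js :: "nat \<Rightarrow> nat list"
  assumes dist: "distinct (concat us)" and all_letters: "set (concat us) = I \<times> {1, -1}"
    and per_pos: "j < length us \<Longrightarrow> per j > 0"
    and z_nodes: "j < length us \<Longrightarrow> z j i \<in> nodes"
    and z_succ: "j < length us \<Longrightarrow> z j (Suc i) = succ (z j i)"
    and z_per: "j < length us \<Longrightarrow> z j (per j) = z j 0"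
    and z_inj: "j < length us \<Longrightarrow> inj_on (z j) {..<per j}"
    and js_sorted: "j < length us \<Longrightarrow> sorted (js j)" and js_distinct: "j < length us \<Longrightarrow> distinct (js j)"
    and js_set: "j < length us \<Longrightarrow> set (js j) = {i. i < per j \<and> crossing (z j i)}"
    and js_word: "j < length us \<Longrightarrow> map (\<lambda>i. letter_of (z j i)) (js j) = us ! j"
    and z_start: "j < length us \<Longrightarrow> crossing (z j 0)"
begin

lemma z_add_per: "j < length us \<Longrightarrow> z j (i + per j) = z j i"
  by (induction i) (auto simp: z_succ z_per)

lemma z_mod: "j < length us \<Longrightarrow> z j (i mod per j) = z j i"
proof -
  assume j: "j < length us"
  have "z j (a + b * per j) = z j a" for a b
    by (induction b) (use z_add_per[OF j] in \<open>auto simp: add.assoc[symmetric] add.commute[of "per j"]\<close>)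
  from this[of "i mod per j" "i div per j"] show ?thesis by (simp add: mod_div_mult_eq)
qed

text \<open>Indices are taken modulo the period because \<open>glue\<close> expects a piece for
  every integer.\<close>

definition seg :: "nat \<Rightarrow> int \<Rightarrow> real \<Rightarrow> complex" where
  "seg j m = piece (z j (nat (m mod int (per j))))"

lemma seg_overlap:
  assumes "j < length us" "3/4 < s" "s < 5/4"
  shows "seg j m s = seg j (m + 1) (s - 1)"
proof -
  let ?L = "int (per j)"
  have L: "?L > 0" using per_pos[OF assms(1)] by simp
  define i where "i = nat (m mod ?L)"
  have i: "m mod ?L = int i" using L by (simp add: i_def)
  have "(m + 1) mod ?L = int (Suc i) mod ?L" by (metis i mod_add_left_eq of_nat_Suc add.commute)
  then have "nat ((m + 1) mod ?L) = nat (int (Suc i mod per j))" by (simp only: zmod_int)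
  then have "nat ((m + 1) mod ?L) = Suc i mod per j" by (simp only: nat_int)
  then have "z j (nat ((m + 1) mod ?L)) = succ (z j i)" using z_mod[OF assms(1)] z_succ[OF assms(1)] by simp
  then show ?thesis using piece_overlap[OF z_nodes[OF assms(1)] assms(2,3)] by (simp add: seg_def i_def)
qed

definition cv :: "nat \<Rightarrow> real \<Rightarrow> complex" where
  "cv j t = glue (seg j) (real (per j) * t)"

definition nd :: "nat \<Rightarrow> real \<Rightarrow> node" where
  "nd j t = z j (nat (\<lfloor>real (per j) * t\<rfloor> mod int (per j)))"

definition fr :: "nat \<Rightarrow> real \<Rightarrow> real" where
  "fr j t = real (per j) * t - of_int \<lfloor>real (per j) * t\<rfloor>"

lemma cv_piece: "cv j t = piece (nd j t) (fr j t)"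
  by (simp add: cv_def glue_def seg_def nd_def fr_def)

lemma cv_smooth: "j < length us \<Longrightarrow> smooth_curve (cv j)"
  unfolding cv_def[abs_def]
  by (intro smooth_curve_scale smooth_curve_glue(1) seg_overlap) (simp_all add: seg_def piece_smooth)

lemma nd_nodes: "j < length us \<Longrightarrow> nd j t \<in> nodes"
  by (simp add: nd_def z_nodes)

lemma cv_derivative:
  assumes j: "j < length us"
  shows "(cv j has_vector_derivative real (per j) *\<^sub>R vector_derivative (piece (nd j t)) (at (fr j t))) (at t)"
proof -
  have "((glue (seg j) \<circ> (\<lambda>t. real (per j) * t)) has_vector_derivative
    real (per j) *\<^sub>R vector_derivative (seg j \<lfloor>real (per j) * t\<rfloor>) (at (real (per j) * t - of_int \<lfloor>real (per j) * t\<rfloor>))) (at t)"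
  proof (rule vector_diff_chain_at)
    show "((\<lambda>t. real (per j) * t) has_vector_derivative real (per j)) (at t)" by (auto intro!: derivative_eq_intros)
    show "(glue (seg j) has_vector_derivative
       vector_derivative (seg j \<lfloor>real (per j) * t\<rfloor>) (at (real (per j) * t - of_int \<lfloor>real (per j) * t\<rfloor>))) (at (real (per j) * t))"
      by (rule smooth_curve_glue(2)) (simp_all add: seg_def piece_smooth seg_overlap[OF j, unfolded seg_def])
  qed
  then show ?thesis by (simp add: cv_def[abs_def] o_def seg_def nd_def fr_def)
qed

lemma cv_periodic:
  assumes j: "j < length us"
  shows "cv j (t + 1) = cv j t"
proof -
  have f: "\<lfloor>real (per j) * (t + 1)\<rfloor> = \<lfloor>real (per j) * t\<rfloor> + int (per j)"
    by (simp add: distrib_left)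
  have "nd j (t + 1) = nd j t" unfolding nd_def f by simp
  moreover have "fr j (t + 1) = fr j t" unfolding fr_def f by (simp add: distrib_left)
  ultimately show ?thesis by (simp add: cv_piece)
qed

lemma unit_time:
  assumes j: "j < length us" and t: "0 \<le> t" "t < 1"
  obtains i where "i < per j" "nd j t = z j i" "fr j t = real (per j) * t - real i" "\<lfloor>real (per j) * t\<rfloor> = int i"
proof -
  have L: "real (per j) > 0" using per_pos[OF j] by simp
  have a: "0 \<le> real (per j) * t" "real (per j) * t < real (per j)" using t L by simp_all
  define i where "i = nat \<lfloor>real (per j) * t\<rfloor>"
  have i: "\<lfloor>real (per j) * t\<rfloor> = int i" using a(1) by (simp add: i_def)
  have "int i < int (per j)" using a(2) unfolding i[symmetric] by (simp add: floor_less_iff)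
  then have "i < per j" by simp
  then show ?thesis using that[of i] i by (simp add: nd_def fr_def)
qed

lemma fr_bounds: "0 \<le> fr j t" "fr j t < 1"
  unfolding fr_def by linarith+

lemma letter_in_word: "j < length us \<Longrightarrow> crossing (z j i) \<Longrightarrow> letter_of (z j i) \<in> set (us ! j)"
proof -
  assume j: "j < length us" and c: "crossing (z j i)"
  have "i mod per j \<in> set (js j)" using js_set[OF j] c z_mod[OF j] per_pos[OF j] by simp
  then have "letter_of (z j (i mod per j)) \<in> set (map (\<lambda>i. letter_of (z j i)) (js j))" by simp
  then show ?thesis unfolding js_word[OF j] z_mod[OF j] .
qed

lemma word_unique:
  assumes "j < length us" "j' < length us" "m \<in> set (us ! j)" "m \<in> set (us ! j')"
  shows "j = j'"
proof (rule ccontr)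
  assume ne: "j \<noteq> j'"
  have *: False if "j < j'" "j' < length us" "m \<in> set (us ! j)" "m \<in> set (us ! j')" for j j'
  proof -
    have "us = take j' us @ us ! j' # drop (Suc j') us" using that by (simp add: id_take_nth_drop)
    then have "distinct (concat (take j' us) @ us ! j' @ concat (drop (Suc j') us))" using dist by (metis concat.simps(2) concat_append)
    moreover have "us ! j \<in> set (take j' us)" using that by (auto simp: in_set_conv_nth intro!: exI[of _ j])
    ultimately show False using that by auto
  qed
  show False using *[of j j'] *[of j' j] ne assms by linarith
qed

text \<open>Two orbits with a common node run together from there on. The first then reaches its own
  starting node, a crossing whose letter would lie in both words.\<close>

lemma z_same_word:
  assumes j: "j < length us" "j' < length us" and eq: "z j i = z j' i'"
  shows "j = j'"
proof -
  have shift: "z j (i + n) = z j' (i' + n)" for n by (induction n) (use eq z_succ j in simp_all)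
  \<comment> \<open>\<open>i * per j\<close> is a multiple of the period that is at least
    \<open>i\<close>, so this many further steps lead from \<open>z j i\<close> back to the
    start.\<close>
  have "i + i * (per j - 1) = i * per j" using per_pos[OF j(1)] by (cases "per j") simp_all
  then have "z j (i + i * (per j - 1)) = z j 0" using z_mod[OF j(1), of "i * per j"] by simp
  then have *: "z j' (i' + i * (per j - 1)) = z j 0" using shift by simp
  have "letter_of (z j 0) \<in> set (us ! j)" using letter_in_word[OF j(1) z_start[OF j(1)]] .
  moreover have "letter_of (z j 0) \<in> set (us ! j')"
    using letter_in_word[OF j(2), of "i' + i * (per j - 1)"] z_start[OF j(1)] unfolding * by simp
  ultimately show ?thesis using word_unique[OF j] by blast
qed

lemma nd_fr_inj:
  assumes j: "j < length us" "j' < length us" and t: "0 \<le> t" "t < 1" "0 \<le> t'" "t' < 1"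
    and eq: "nd j t = nd j' t'" "fr j t = fr j' t'"
  shows "j = j' \<and> t = t'"
proof -
  obtain i where i: "i < per j" "nd j t = z j i" "fr j t = real (per j) * t - real i" by (rule unit_time[OF j(1) t(1,2)])
  obtain i' where i': "i' < per j'" "nd j' t' = z j' i'" "fr j' t' = real (per j') * t' - real i'" by (rule unit_time[OF j(2) t(3,4)])
  have jj: "j = j'" using z_same_word[OF j] eq(1) i(2) i'(2) by simp
  have "i = i'" using inj_onD[OF z_inj[OF j(1)]] i i' eq(1) jj by simp
  then have "real (per j) * t = real (per j) * t'" using i(3) i'(3) eq(2) jj by simp
  then show ?thesis using jj per_pos[OF j(1)] by simp
qed

definition X :: "(nat \<times> real) set" where
  "X = {(j, t). j < length us \<and> 0 \<le> t \<and> t < 1 \<and> crossing (nd j t) \<and> fr j t = 1/2}"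

definition lt :: "nat \<times> real \<Rightarrow> symbol" where
  "lt b = letter_of (nd (fst b) (snd b))"

definition pnt :: "nat \<times> real \<Rightarrow> complex" where
  "pnt b = cv (fst b) (snd b)"

lemma js_times:
  assumes j: "j < length us"
  shows "{t. (j, t) \<in> X} = (\<lambda>i. (real i + 1/2) / real (per j)) ` set (js j)"
    and "i \<in> set (js j) \<Longrightarrow> lt (j, (real i + 1/2) / real (per j)) = letter_of (z j i)"
proof -
  have L: "real (per j) > 0" using per_pos[OF j] by simp
  have at: "nd j ((real i + 1/2) / real (per j)) = z j i \<and> fr j ((real i + 1/2) / real (per j)) = 1/2" if "i < per j" for i
  proof -
    have e: "real (per j) * ((real i + 1/2) / real (per j)) = real i + 1/2" using L by simp
    have f: "\<lfloor>real i + 1/2\<rfloor> = int i" by linarith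
    show ?thesis unfolding nd_def fr_def e f using that by simp
  qed
  show "{t. (j, t) \<in> X} = (\<lambda>i. (real i + 1/2) / real (per j)) ` set (js j)"
  proof
    show "{t. (j, t) \<in> X} \<subseteq> (\<lambda>i. (real i + 1/2) / real (per j)) ` set (js j)"
    proof
      fix t assume "t \<in> {t. (j, t) \<in> X}"
      then have t: "0 \<le> t" "t < 1" "crossing (nd j t)" "fr j t = 1/2" by (auto simp: X_def)
      obtain i where i: "i < per j" "nd j t = z j i" "fr j t = real (per j) * t - real i" by (rule unit_time[OF j t(1,2)])
      then have "i \<in> set (js j)" using js_set[OF j] t(3) by simp
      moreover have "t = (real i + 1/2) / real (per j)" using i(3) t(4) L by (simp add: field_simps)
      ultimately show "t \<in> (\<lambda>i. (real i + 1/2) / real (per j)) ` set (js j)" by blast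
    qed
    show "(\<lambda>i. (real i + 1/2) / real (per j)) ` set (js j) \<subseteq> {t. (j, t) \<in> X}"
    proof
      fix t assume "t \<in> (\<lambda>i. (real i + 1/2) / real (per j)) ` set (js j)"
      then obtain i where i: "i < per j" "crossing (z j i)" "t = (real i + 1/2) / real (per j)" using js_set[OF j] by auto
      have "real i + 1/2 < real (per j)" using i(1) by linarith
      then have "0 \<le> t" "t < 1" using L i(3) by simp_all
      then show "t \<in> {t. (j, t) \<in> X}" using at[OF i(1)] i j by (simp add: X_def)
    qed
  qed
  show "i \<in> set (js j) \<Longrightarrow> lt (j, (real i + 1/2) / real (per j)) = letter_of (z j i)"
    using at js_set[OF j] by (simp add: lt_def)
qed

lemma lt_bij: "bij_betw lt X (I \<times> {1, -1})"
  unfolding bij_betw_def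
proof
  show "inj_on lt X"
  proof (rule inj_onI)
    fix b c assume bc: "b \<in> X" "c \<in> X" "lt b = lt c"
    obtain j t where b: "b = (j, t)" by (cases b)
    obtain j' t' where c: "c = (j', t')" by (cases c)
    have B: "j < length us" "0 \<le> t" "t < 1" "crossing (nd j t)" "fr j t = 1/2" using bc(1) by (auto simp: X_def b)
    have C: "j' < length us" "0 \<le> t'" "t' < 1" "crossing (nd j' t')" "fr j' t' = 1/2" using bc(2) by (auto simp: X_def c)
    have "nd j t = nd j' t'"
      using inj_onD[OF bij_betw_imp_inj_on[OF letter_of_bij]] bc(3) B C nd_nodes by (simp add: lt_def b c)
    then show "b = c" using nd_fr_inj[OF B(1) C(1) B(2,3) C(2,3)] B(5) C(5) by (simp add: b c)
  qed
  show "lt ` X = I \<times> {1, -1}"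
  proof
    show "lt ` X \<subseteq> I \<times> {1, -1}"
    proof
      fix m assume "m \<in> lt ` X"
      then obtain j t where jt: "(j, t) \<in> X" "m = lt (j, t)" by auto
      then have "nd j t \<in> {x \<in> nodes. crossing x}" using nd_nodes by (auto simp: X_def)
      then show "m \<in> I \<times> {1, -1}" using bij_betw_imp_surj_on[OF letter_of_bij] jt(2) by (auto simp: lt_def)
    qed
    show "I \<times> {1, -1} \<subseteq> lt ` X"
    proof
      fix m assume "m \<in> I \<times> {1, -1 :: int}"
      then have "m \<in> set (concat us)" using all_letters by simp
      then obtain u where "u \<in> set us" "m \<in> set u" by auto
      then obtain j where j: "j < length us" "m \<in> set (us ! j)" by (metis in_set_conv_nth)
      then obtain i where i: "i \<in> set (js j)" "m = letter_of (z j i)" unfolding js_word[OF j(1), symmetric] by auto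
      have "(j, (real i + 1/2) / real (per j)) \<in> X" using js_times(1)[OF j(1)] i(1) by blast
      then show "m \<in> lt ` X" using js_times(2)[OF j(1) i(1)] i(2) by (metis image_eqI)
    qed
  qed
qed

lemma X_props: "b \<in> X \<Longrightarrow> fst b < length us \<and> 0 \<le> snd b \<and> snd b < 1 \<and> crossing (nd (fst b) (snd b)) \<and>
    nd (fst b) (snd b) \<in> nodes \<and> fr (fst b) (snd b) = 1/2 \<and> lt b \<in> I \<times> {1, -1}"
  using nd_nodes bij_betw_imp_surj_on[OF lt_bij] by (auto simp: X_def)

lemma pnt_eq_iff:
  assumes b: "fst b < length us" "0 \<le> snd b" "snd b < 1" and c: "fst c < length us" "0 \<le> snd c" "snd c < 1" and ne: "b \<noteq> c"
  shows "pnt b = pnt c \<longleftrightarrow> b \<in> X \<and> c \<in> X \<and> fst (lt b) = fst (lt c)"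
proof
  assume p: "pnt b = pnt c"
  have eq: "piece (nd (fst b) (snd b)) (fr (fst b) (snd b)) = piece (nd (fst c) (snd c)) (fr (fst c) (snd c))"
    using p by (simp add: pnt_def cv_piece)
  have "\<not> (nd (fst b) (snd b) = nd (fst c) (snd c) \<and> fr (fst b) (snd b) = fr (fst c) (snd c))"
    using nd_fr_inj[OF b(1) c(1) b(2,3) c(2,3)] ne by (auto simp: prod_eq_iff)
  then have *: "crossing (nd (fst b) (snd b))" "crossing (nd (fst c) (snd c))" "bot (nd (fst b) (snd b)) = bot (nd (fst c) (snd c))"
    "fr (fst b) (snd b) = 1/2" "fr (fst c) (snd c) = 1/2"
    using piece_injective[OF nd_nodes[OF b(1)] nd_nodes[OF c(1)] fr_bounds fr_bounds eq] by blast+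
  then have "b \<in> X" "c \<in> X" using b c by (simp_all add: X_def case_prod_beta)
  moreover have "fst (lt b) = fst (lt c)"
    using crossing_partner(1)[OF nd_nodes[OF b(1)] *(1) nd_nodes[OF c(1)] *(2)] *(3) by (simp add: lt_def)
  ultimately show "b \<in> X \<and> c \<in> X \<and> fst (lt b) = fst (lt c)" by simp
next
  assume *: "b \<in> X \<and> c \<in> X \<and> fst (lt b) = fst (lt c)"
  then have fr: "fr (fst b) (snd b) = 1/2" "fr (fst c) (snd c) = 1/2" using X_props by blast+
  show "pnt b = pnt c"
    unfolding pnt_def cv_piece fr
    by (rule crossing_partner(2)) (use * X_props[of b] X_props[of c] in \<open>simp_all add: lt_def\<close>)
qed

definition br :: "symbol \<Rightarrow> nat \<times> real" where
  "br m = inv_into X lt m"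

lemma br: "m \<in> I \<times> {1, -1} \<Longrightarrow> br m \<in> X \<and> lt (br m) = m"
  using bij_betw_imp_surj_on[OF lt_bij] by (metis br_def f_inv_into_f inv_into_into)

lemma br_lt: "b \<in> X \<Longrightarrow> br (lt b) = b"
  using bij_betw_imp_inj_on[OF lt_bij] by (simp add: br_def inv_into_f_f)

definition num :: "complex \<Rightarrow> nat" where
  "num p = (THE i. i \<in> I \<and> pnt (br (i, 1)) = p)"

lemma pnt_br: "i \<in> I \<Longrightarrow> pnt (br (i, -1)) = pnt (br (i, 1))"
proof -
  assume i: "i \<in> I"
  have m: "(i, 1) \<in> I \<times> {1, -1}" "(i, -1) \<in> I \<times> {1, -1 :: int}" using i by auto
  have ne: "br (i, -1) \<noteq> br (i, 1)" using br[OF m(1)] br[OF m(2)] by (metis prod.inject one_neq_neg_one)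
  show ?thesis
    using pnt_eq_iff[of "br (i, -1)" "br (i, 1)"] X_props[of "br (i, -1)"] X_props[of "br (i, 1)"] br[OF m(1)] br[OF m(2)] ne
    by simp
qed

lemma pnt_br_inj: "i \<in> I \<Longrightarrow> i' \<in> I \<Longrightarrow> pnt (br (i, 1)) = pnt (br (i', 1)) \<Longrightarrow> i = i'"
proof -
  assume i: "i \<in> I" "i' \<in> I" "pnt (br (i, 1)) = pnt (br (i', 1))"
  have m: "(i, 1) \<in> I \<times> {1, -1 :: int}" "(i', 1) \<in> I \<times> {1, -1 :: int}" using i by auto
  show "i = i'"
  proof (cases "br (i, 1) = br (i', 1)")
    case True
    then have "lt (br (i, 1)) = lt (br (i', 1))" by simp
    then show ?thesis using br[OF m(1)] br[OF m(2)] by simp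
  next
    case False
    then show ?thesis
      using pnt_eq_iff[of "br (i, 1)" "br (i', 1)"] X_props[of "br (i, 1)"] X_props[of "br (i', 1)"] br[OF m(1)] br[OF m(2)] i(3)
      by simp
  qed
qed

lemma num_pnt: "i \<in> I \<Longrightarrow> num (pnt (br (i, 1))) = i"
  unfolding num_def by (rule the_equality) (auto intro: pnt_br_inj)

text \<open>The curves are determined by the normalised symbols alone. The over-branch is the one
  with the superscript that \<open>lsym\<close> assigns to the letter \<open>Over\<close>, and with
  this choice the crossing sign comes out as \<open>e i\<close>.\<close>

definition D :: diagram where
  "D = \<lparr>ncomp = length us, curve = cv, over_branch = \<lambda>p. br (num p, - sign_val (e (num p)))\<rparr>"

lemma D_simps: "ncomp D = length us" "curve D = cv" "over_branch D p = br (num p, - sign_val (e (num p)))"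
  by (simp_all add: D_def)

lemma branches_D: "branches D p = {b. fst b < length us \<and> 0 \<le> snd b \<and> snd b < 1 \<and> pnt b = p}"
  by (auto simp: branches_def D_simps pnt_def)

lemma branches_crossing:
  assumes i: "i \<in> I"
  shows "branches D (pnt (br (i, 1))) = {br (i, 1), br (i, -1)}" "br (i, 1) \<noteq> br (i, -1)"
proof -
  have m: "(i, 1) \<in> I \<times> {1, -1}" "(i, -1) \<in> I \<times> {1, -1 :: int}" using i by auto
  show ne: "br (i, 1) \<noteq> br (i, -1)" using br[OF m(1)] br[OF m(2)] by (metis prod.inject one_neq_neg_one)
  show "branches D (pnt (br (i, 1))) = {br (i, 1), br (i, -1)}"
  proof
    show "{br (i, 1), br (i, -1)} \<subseteq> branches D (pnt (br (i, 1)))"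
      using X_props[of "br (i, 1)"] X_props[of "br (i, -1)"] br[OF m(1)] br[OF m(2)] pnt_br[OF i] by (simp add: branches_D)
    show "branches D (pnt (br (i, 1))) \<subseteq> {br (i, 1), br (i, -1)}"
    proof
      fix c assume c: "c \<in> branches D (pnt (br (i, 1)))"
      show "c \<in> {br (i, 1), br (i, -1)}"
      proof (cases "c = br (i, 1)")
        case False
        then have "c \<in> X" "fst (lt c) = i"
          using pnt_eq_iff[of c "br (i, 1)"] c X_props[of "br (i, 1)"] br[OF m(1)] by (auto simp: branches_D)
        then have "lt c = (i, 1) \<or> lt c = (i, -1)" using X_props[of c] by (cases "lt c") auto
        then show ?thesis using br_lt[OF \<open>c \<in> X\<close>] by auto
      qed simp
    qed
  qed
qed

lemma crossings_D: "crossings D = (\<lambda>i. pnt (br (i, 1))) ` I"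
proof
  show "(\<lambda>i. pnt (br (i, 1))) ` I \<subseteq> crossings D"
    using branches_crossing unfolding crossings_def by blast
  show "crossings D \<subseteq> (\<lambda>i. pnt (br (i, 1))) ` I"
  proof
    fix p assume "p \<in> crossings D"
    then obtain a b where ab: "a \<in> branches D p" "b \<in> branches D p" "a \<noteq> b" unfolding crossings_def by blast
    then have a: "a \<in> X" "pnt a = p" using pnt_eq_iff[of a b] by (auto simp: branches_D)
    obtain i s where isd: "lt a = (i, s)" by (cases "lt a")
    then have i: "i \<in> I" "s = 1 \<or> s = -1" using X_props[OF a(1)] by auto
    have "a = br (i, s)" using br_lt[OF a(1)] isd by simp
    then have "p = pnt (br (i, 1))" using i pnt_br[OF i(1)] a(2) by auto
    then show "p \<in> (\<lambda>i. pnt (br (i, 1))) ` I" using i by blast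
  qed
qed

lemma tangent_D: "b \<in> X \<Longrightarrow> tangent D b = real (per (fst b)) *\<^sub>R vel (nd (fst b) (snd b))"
proof -
  assume b: "b \<in> X"
  have fr: "fr (fst b) (snd b) = 1/2" using X_props[OF b] by blast
  show ?thesis
    using X_props[OF b] vector_derivative_at[OF cv_derivative[of "fst b" "snd b"]] unfolding fr
    by (simp add: tangent_def D_simps vel_def)
qed

lemma det2_scale: "det2 (r *\<^sub>R u) (s *\<^sub>R v) = r * s * det2 u v"
  by (simp add: det2_def algebra_simps)

lemma det2_swap: "det2 v u = - det2 u v"
  by (simp add: det2_def)

lemma det2_crossing:
  assumes i: "i \<in> I"
  shows "det2 (tangent D (br (i, -1))) (tangent D (br (i, 1))) > 0"
proof -
  have m: "(i, 1) \<in> I \<times> {1, -1}" "(i, -1) \<in> I \<times> {1, -1 :: int}" using i by auto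
  note P = X_props[of "br (i, 1)"] and N = X_props[of "br (i, -1)"]
  have "det2 (vel (nd (fst (br (i, -1))) (snd (br (i, -1))))) (vel (nd (fst (br (i, 1))) (snd (br (i, 1))))) > 0"
    by (rule crossing_partner(3)[where i = i]) (use P N br[OF m(1)] br[OF m(2)] in \<open>simp_all add: lt_def\<close>)
  then show ?thesis
    using br[OF m(1)] br[OF m(2)] P N per_pos by (simp add: tangent_D det2_scale)
qed

lemma sign_cases: "sign_val s = 1 \<and> s = Plus \<or> sign_val s = -1 \<and> s = Minus"
  by (cases s) auto

lemma link_D: "link_diagram D"
  unfolding link_diagram_def
proof (intro conjI allI impI ballI)
  fix j assume "j < ncomp D"
  then have j: "j < length us" by (simp add: D_simps)
  show "smooth_curve (curve D j)" using cv_smooth[OF j] by (simp add: D_simps)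
  show "curve D j (t + 1) = curve D j t" for t using cv_periodic[OF j] by (simp add: D_simps)
  show "vector_derivative (curve D j) (at t) \<noteq> 0" for t
    using vector_derivative_at[OF cv_derivative[OF j, of t]] per_pos[OF j] piece_immersion[OF nd_nodes[OF j]]
    by (simp add: D_simps)
next
  show "finite (crossings D)" using fin by (simp add: crossings_D)
next
  fix p assume "p \<in> crossings D"
  then obtain i where i: "i \<in> I" "p = pnt (br (i, 1))" by (auto simp: crossings_D)
  note B = branches_crossing[OF i(1), folded i(2)]
  show "card (branches D p) = 2" using B by simp
  show "det2 (tangent D a) (tangent D b) \<noteq> 0" if "a \<in> branches D p" "b \<in> branches D p" "a \<noteq> b" for a b
  proof -
    have "a = br (i, 1) \<and> b = br (i, -1) \<or> a = br (i, -1) \<and> b = br (i, 1)" using that B by auto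
    then show ?thesis using det2_crossing[OF i(1)] det2_swap[of "tangent D (br (i, 1))" "tangent D (br (i, -1))"] by auto
  qed
  show "over_branch D p \<in> branches D p"
  proof -
    have "num p = i" using num_pnt[OF i(1)] i(2) by simp
    then show ?thesis unfolding D_simps B(1) using sign_cases[of "e i"] by auto
  qed
qed

lemma letter_D:
  assumes b: "b \<in> X"
  shows "lsym e (branch_letter D num b) = lt b"
    and "branch_letter D num b \<in> Over ` I \<union> (\<lambda>i. Under i (e i)) ` I"
proof -
  obtain i s where isd: "lt b = (i, s)" by (cases "lt b")
  have i: "i \<in> I" and s: "s = 1 \<or> s = -1" using X_props[OF b] isd by auto
  have m: "(i, 1) \<in> I \<times> {1, -1}" "(i, -1) \<in> I \<times> {1, -1 :: int}" using i by auto
  have bb: "b = br (i, s)" using br_lt[OF b] isd by simp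
  define p where "p = pnt (br (i, 1))"
  have p: "pnt b = p" using s bb pnt_br[OF i] by (auto simp: p_def)
  have n: "num p = i" using num_pnt[OF i] by (simp add: p_def)
  have ov: "over_branch D p = br (i, - sign_val (e i))" by (simp add: D_simps n)
  have un: "under_branch D p = br (i, sign_val (e i))"
    unfolding under_branch_def branches_crossing(1)[OF i, folded p_def] ov
    by (rule the_equality) (use sign_cases[of "e i"] branches_crossing(2)[OF i] in auto)
  have sg: "crossing_sign D p = e i"
    unfolding crossing_sign_def ov un
    using sign_cases[of "e i"] det2_crossing[OF i] det2_swap[of "tangent D (br (i, 1))" "tangent D (br (i, -1))"] by auto
  have bl: "branch_letter D num b = (if b = over_branch D p then Over i else Under i (e i))"
    using p by (simp add: branch_letter_def Let_def D_simps(2) pnt_def n sg)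
  have "b = over_branch D p \<longleftrightarrow> s = - sign_val (e i)"
  proof
    assume "b = over_branch D p"
    then have "lt b = lt (br (i, - sign_val (e i)))" using ov by simp
    moreover have "(i, - sign_val (e i)) \<in> I \<times> {1, -1}" using i sign_cases[of "e i"] by auto
    ultimately show "s = - sign_val (e i)" using br isd by simp
  qed (use bb ov in simp)
  then show "lsym e (branch_letter D num b) = lt b" using bl isd s sign_cases[of "e i"] by auto
  show "branch_letter D num b \<in> Over ` I \<union> (\<lambda>i. Under i (e i)) ` I" using bl i by auto
qed

theorem words_D:
  assumes j: "j < length us"
  shows "map (lsym e) (component_word D num j) = us ! j"
    and "set (component_word D num j) \<subseteq> Over ` I \<union> (\<lambda>i. Under i (e i)) ` I"
proof -
  have set: "{t. 0 \<le> t \<and> t < 1 \<and> curve D j t \<in> crossings D} = {t. (j, t) \<in> X}"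
  proof (rule Collect_cong)
    fix t
    show "0 \<le> t \<and> t < 1 \<and> curve D j t \<in> crossings D \<longleftrightarrow> (j, t) \<in> X"
    proof
      assume a: "0 \<le> t \<and> t < 1 \<and> curve D j t \<in> crossings D"
      then obtain i where i: "i \<in> I" "pnt (j, t) = pnt (br (i, 1))" by (auto simp: crossings_D D_simps pnt_def)
      then have "(j, t) \<in> branches D (pnt (br (i, 1)))" using a j by (simp add: branches_D)
      moreover have "(i, 1) \<in> I \<times> {1, -1}" "(i, -1) \<in> I \<times> {1, -1 :: int}" using i by auto
      ultimately show "(j, t) \<in> X" using branches_crossing(1)[OF i(1)] br by (metis insertE singletonD)
    next
      assume x: "(j, t) \<in> X"
      obtain i s where isd: "lt (j, t) = (i, s)" by (cases "lt (j, t)")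
      have i: "i \<in> I" and s: "s = 1 \<or> s = -1" using X_props[OF x] isd by auto
      have "(j, t) = br (i, s)" using br_lt[OF x] isd by simp
      then have "cv j t = pnt (br (i, 1))" using s pnt_br[OF i] by (metis fst_conv pnt_def snd_conv)
      then show "0 \<le> t \<and> t < 1 \<and> curve D j t \<in> crossings D" using X_props[OF x] i by (auto simp: crossings_D D_simps)
    qed
  qed
  have L: "real (per j) > 0" using per_pos[OF j] by simp
  let ?f = "\<lambda>i. (real i + 1/2) / real (per j)"
  have "sorted (map ?f (js j))"
    unfolding sorted_map using js_sorted[OF j] by (rule sorted_wrt_mono_rel[rotated]) (use L in \<open>simp add: divide_right_mono\<close>)
  moreover have "distinct (map ?f (js j))"
    using js_distinct[OF j] L by (auto simp: distinct_map inj_on_def)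
  ultimately have "sorted_list_of_set (set (map ?f (js j))) = map ?f (js j)"
    by (rule sorted_list_of_set.idem_if_sorted_distinct)
  then have "sorted_list_of_set {t. (j, t) \<in> X} = map ?f (js j)" using js_times(1)[OF j] by simp
  then have cw: "component_word D num j = map (\<lambda>i. branch_letter D num (j, ?f i)) (js j)"
    unfolding component_word_def set by simp
  have "map (lsym e) (component_word D num j) = map (\<lambda>i. lsym e (branch_letter D num (j, ?f i))) (js j)" by (simp add: cw)
  also have "\<dots> = map (\<lambda>i. letter_of (z j i)) (js j)"
  proof (rule map_cong[OF refl])
    fix i assume i: "i \<in> set (js j)"
    have "(j, ?f i) \<in> X" using js_times(1)[OF j] i by blast
    then show "lsym e (branch_letter D num (j, ?f i)) = letter_of (z j i)"
      using letter_D(1) js_times(2)[OF j i] by simp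
  qed
  finally show "map (lsym e) (component_word D num j) = us ! j" using js_word[OF j] by simp
  show "set (component_word D num j) \<subseteq> Over ` I \<union> (\<lambda>i. Under i (e i)) ` I"
    unfolding cw using js_times(1)[OF j] letter_D(2) by auto
qed

lemma num_bij: "bij_betw num (crossings D) I"
  unfolding crossings_D
  by (rule bij_betw_byWitness[where f' = "\<lambda>i. pnt (br (i, 1))"]) (auto simp: num_pnt)

end

section \<open>The theorem\<close>

text \<open>Rotating each word separately gives a second list of all letters of the same length;
  \<open>f\<close> sends each entry of the first list to the entry of the second in the same
  position. Equal word lengths allow the concatenation to be taken apart again.\<close>

lemma cyclic_successor:
  assumes "distinct (concat us)"
  obtains f where "\<And>u. u \<in> set us \<Longrightarrow> map f u = rotate1 u" and "f ` set (concat us) = set (concat us)" and "inj_on f (set (concat us))"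
proof -
  let ?v = "concat us" and ?w = "concat (map rotate1 us)"
  have len: "length ?v = length ?w" by (induction us) auto
  define f where "f x = the (map_of (zip ?v ?w) x)" for x
  have fv: "map f ?v = ?w"
  proof (rule nth_equalityI)
    show "map f ?v ! i = ?w ! i" if "i < length (map f ?v)" for i
      using map_of_zip_nth[OF len assms, of i] that len by (simp add: f_def)
  qed (use len in simp)
  then have "concat (map (map f) us) = concat (map rotate1 us)" by (simp add: map_concat)
  then have "map (map f) us = map rotate1 us"
    by (rule concat_injective) (auto simp: set_zip)
  then have word: "map f u = rotate1 u" if "u \<in> set us" for u using that by (metis map_eq_conv)
  have "set ?w = set ?v" by (induction us) auto
  then have img: "f ` set ?v = set ?v" using fv by (metis set_map)
  then have "inj_on f (set ?v)" by (intro eq_card_imp_inj_on) simp_all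
  then show ?thesis using that word img by blast
qed

lemma cyclic_word_closed:
  assumes f: "map f u = rotate1 u" and step: "\<And>y. y \<in> set u \<Longrightarrow> Q y \<Longrightarrow> Q (f y)"
    and "x \<in> set u" "Q x" "y \<in> set u"
  shows "Q y"
proof -
  obtain k l where k: "k < length u" "u ! k = x" and l: "l < length u" "u ! l = y"
    using assms(3,5) by (meson in_set_conv_nth)
  have "Q (u ! ((k + n) mod length u))" for n
  proof (induction n)
    case 0
    then show ?case using k assms(4) by simp
  next
    case (Suc n)
    let ?m = "(k + n) mod length u"
    have m: "?m < length u" using k by (intro mod_less_divisor) linarith
    have "f (u ! ?m) = map f u ! ?m" using m by simp
    also have "\<dots> = u ! (Suc ?m mod length u)" unfolding f using m by (simp add: nth_rotate1)
    finally show ?case using step[OF nth_mem[OF m] Suc] by (simp add: mod_Suc_eq)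
  qed
  \<comment> \<open>So many steps lead from position \<open>k\<close> to position \<open>l\<close>
    modulo the length, whichever of the two is larger.\<close>
  from this[of "l + length u - k"] show ?thesis using k l by simp
qed

lemma fst_lsym: "fst (lsym e x) = letter_index x"
  by (cases x) auto

lemma inj_on_lsym: "inj_on (lsym e) (Over ` I \<union> (\<lambda>i. Under i (e i)) ` I)"
proof -
  have "sign_val s \<noteq> - sign_val s" for s by (cases s) auto
  then show ?thesis by (auto simp: inj_on_def)
qed

lemma lsym_image: "lsym e ` (Over ` I \<union> (\<lambda>i. Under i (e i)) ` I) = I \<times> {1, -1}"
proof -
  have s: "{- sign_val s, sign_val s} = {1, -1}" for s by (cases s) auto
  have "lsym e ` (Over ` I \<union> (\<lambda>i. Under i (e i)) ` I) = (\<Union>i\<in>I. {i} \<times> {- sign_val (e i), sign_val (e i)})"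
    by (auto simp: image_Un image_image)
  then show ?thesis unfolding s by auto
qed

lemma letters_mset: "letters (mset ps) = mset (concat ps)"
  by (induction ps) auto

lemma gauss_paragraph_well:
  assumes "gauss_paragraph n P"
  obtains e where "well e {1..n} P"
proof
  define e where "e i = (if count (letters P) (Under i Plus) = 1 then Plus else Minus)" for i
  have ind: "letter_index x \<in> {1..n}" if "count (letters P) x \<noteq> 0" for x
    using assms that unfolding gauss_paragraph_def indices_def by (meson count_eq_zero_iff image_subset_iff)
  have ov: "count (letters P) (Over i) = 1" "count (letters P) (Under i Plus) + count (letters P) (Under i Minus) = 1"
    if "i \<in> {1..n}" for i using assms that unfolding gauss_paragraph_def by blast+
  have "count (letters P) x = of_bool (x \<in> Over ` {1..n} \<union> (\<lambda>i. Under i (e i)) ` {1..n})" for x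
  proof (cases "letter_index x \<in> {1..n}")
    case False
    then have "x \<notin> Over ` {1..n} \<union> (\<lambda>i. Under i (e i)) ` {1..n}" by auto
    then show ?thesis using False ind by auto
  next
    case True
    show ?thesis
    proof (cases x)
      case (Over i)
      then show ?thesis using True ov by auto
    next
      case (Under i s)
      have "count (letters P) (Under i s) = of_bool (s = e i)"
        using ov(2)[of i] True Under by (cases s) (auto simp: e_def)
      then show ?thesis using True Under by auto
    qed
  qed
  then show "well e {1..n} P" by (simp add: well_def)
qed

theorem planar_realizable:
  assumes P: "well e {1..n} P" and n: "n \<ge> 1" and ns: "\<not> splittable P" and pl: "planar (flat e P) {1..n}"
  shows "\<exists>D. link_diagram D \<and> ncomp D = size P \<and> encodes P D"
proof -
  define I where "I = {1..n}"
  define L where "L = Over ` I \<union> (\<lambda>i. Under i (e i)) ` I"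
  obtain ps where ps: "mset ps = P" using ex_mset by blast
  define us where "us = map (map (lsym e)) ps"
  have cnt: "count (mset (concat ps)) x = of_bool (x \<in> L)" for x
    using P unfolding well_def letters_mset[symmetric] ps L_def I_def by blast
  have setp: "set (concat ps) = L"
    using well_letters[OF P] unfolding letters_mset[symmetric] ps[symmetric] set_mset_mset[symmetric] L_def I_def by blast
  have distp: "distinct (concat ps)"
    unfolding distinct_count_atmost_1 using cnt setp by (simp only: of_bool_def) simp
  have inj: "inj_on (lsym e) L" unfolding L_def by (rule inj_on_lsym)
  have cu: "concat us = map (lsym e) (concat ps)" by (simp add: us_def map_concat)
  have dist: "distinct (concat us)" using distp inj setp unfolding cu distinct_map by simp
  have setu: "set (concat us) = I \<times> {1, -1}" unfolding cu set_map setp unfolding L_def by (rule lsym_image)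
  obtain nxt where nxt: "\<And>u. u \<in> set us \<Longrightarrow> map nxt u = rotate1 u" "nxt ` (I \<times> {1, -1}) = I \<times> {1, -1}" "inj_on nxt (I \<times> {1, -1})"
    using cyclic_successor[OF dist] unfolding setu by metis
  define prv where "prv = inv_into (I \<times> {1, -1}) nxt"
  interpret flat_map I nxt prv
  proof
    show "finite I" by (simp add: I_def)
    show "nxt m \<in> I \<times> {1, -1}" if "m \<in> I \<times> {1, -1}" for m using nxt(2) that by blast
    show "prv m \<in> I \<times> {1, -1}" if "m \<in> I \<times> {1, -1}" for m
      using that unfolding prv_def by (metis nxt(2) inv_into_into)
    show "nxt (prv m) = m" if "m \<in> I \<times> {1, -1}" for m
      using that unfolding prv_def by (metis nxt(2) f_inv_into_f)
    show "prv (nxt m) = m" if "m \<in> I \<times> {1, -1}" for m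
      unfolding prv_def by (rule inv_into_f_f[OF nxt(3) that])
  qed
  have word_letters: "set u \<subseteq> I \<times> {1, -1}" if "u \<in> set us" for u using setu that by auto
  \<comment> \<open>An empty word has no index and could be split off, as \<open>n \<ge> 1\<close>
    guarantees another word.\<close>
  have nonempty: "u \<noteq> []" if u: "u \<in> set us" for u
  proof
    assume "u = []"
    then have "[] \<in># P" using u ps by (auto simp: us_def)
    then obtain B where B: "P = add_mset [] B" by (metis insert_DiffM)
    have "Over 1 \<in> L" using n by (auto simp: L_def I_def)
    then have "letters P \<noteq> {#}" using well_letters[OF P] unfolding L_def I_def by force
    then have "B \<noteq> {#}" using B by auto
    moreover have "P = {#[]#} + B" using B by simp
    moreover have "indices {#[]#} = {}" by (simp add: indices_def)
    ultimately show False using ns unfolding splittable_def by (metis add_mset_not_empty empty_iff)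
  qed
  \<comment> \<open>A set of crossings closed under \<open>nxt\<close> contains, with one index of a
    word, all of its indices. A proper nonempty such set would therefore split the
    paragraph.\<close>
  have conn: "R = I" if R: "R \<subseteq> I" "R \<noteq> {}" "\<And>m. m \<in> R \<times> {1, -1} \<Longrightarrow> fst (nxt m) \<in> R" for R
  proof (rule ccontr)
    assume "R \<noteq> I"
    define A where "A = filter_mset (\<lambda>u. \<exists>x\<in>set u. letter_index x \<in> R) P"
    define B where "B = filter_mset (\<lambda>u. \<not> (\<exists>x\<in>set u. letter_index x \<in> R)) P"
    have PAB: "P = A + B" by (simp add: A_def B_def multiset_partition)
    have closed: "letter_index y \<in> R" if u: "u \<in># P" and xy: "x \<in> set u" "letter_index x \<in> R" "y \<in> set u" for u x y
    proof -
      have v: "map (lsym e) u \<in> set us" using u ps by (auto simp: us_def)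
      have "fst (lsym e y) \<in> R"
      proof (rule cyclic_word_closed[OF nxt(1)[OF v]])
        fix m assume "m \<in> set (map (lsym e) u)" "fst m \<in> R"
        then have "m \<in> R \<times> {1, -1}" using word_letters[OF v] by (cases m) auto
        then show "fst (nxt m) \<in> R" by (rule R(3))
      next
        show "lsym e x \<in> set (map (lsym e) u)" "fst (lsym e x) \<in> R" "lsym e y \<in> set (map (lsym e) u)"
          using xy by (simp_all add: fst_lsym)
      qed
      then show ?thesis by (simp add: fst_lsym)
    qed
    have has: "\<exists>u\<in>#P. Over i \<in> set u" if "i \<in> I" for i
    proof -
      have "Over i \<in># letters P" using well_letters[OF P] that by (auto simp: I_def)
      then show ?thesis by (simp add: in_letters_iff)
    qed
    obtain i where i: "i \<in> R" using R(2) by blast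
    obtain u where u: "u \<in># P" "Over i \<in> set u" using has R(1) i by blast
    then have "u \<in># A" using i by (auto simp: A_def intro!: bexI[of _ "Over i"])
    obtain i' where i': "i' \<in> I" "i' \<notin> R" using R(1) \<open>R \<noteq> I\<close> by blast
    obtain v where v: "v \<in># P" "Over i' \<in> set v" using has i'(1) by blast
    then have "v \<in># B" using closed[OF v(1) _ _ v(2)] i'(2) by (auto simp: B_def)
    have "indices A \<subseteq> R"
    proof
      fix k assume "k \<in> indices A"
      then obtain y where "y \<in># letters A" and y: "letter_index y = k" unfolding indices_letters by blast
      then obtain u where u: "u \<in># A" "y \<in> set u" unfolding in_letters_iff by blast
      then obtain x where "u \<in># P" "x \<in> set u" "letter_index x \<in> R" unfolding A_def by auto
      then show "k \<in> R" using closed u(2) y by blast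
    qed
    moreover have "indices B \<inter> R = {}"
    proof (rule equals0I)
      fix k assume k: "k \<in> indices B \<inter> R"
      then have "k \<in> indices B" by blast
      then obtain y where "y \<in># letters B" and y: "letter_index y = k" unfolding indices_letters by blast
      then obtain u where "u \<in># B" "y \<in> set u" unfolding in_letters_iff by blast
      then show False using k y unfolding B_def by auto
    qed
    ultimately have "\<forall>i\<in>indices P. i \<notin> indices A \<or> i \<notin> indices B" by blast
    moreover have "A \<noteq> {#}" "B \<noteq> {#}" using \<open>u \<in># A\<close> \<open>v \<in># B\<close> by auto
    ultimately show False using ns PAB unfolding splittable_def by blast
  qed
  have fl: "flow (flat e P) I (\<lambda>m. c (prv m)) c"
    if "\<And>i. i \<in> I \<Longrightarrow> c (i, 1) + c (i, -1) = c (prv (i, 1)) + c (prv (i, -1))" for c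
    unfolding flow_def
  proof (intro conjI ballI)
    fix u assume "u \<in># flat e P"
    then have u: "u \<in> set us" using ps by (auto simp: flat_def us_def)
    have "rotate1 (map (\<lambda>m. c (prv m)) u) = map (\<lambda>m. c (prv m)) (map nxt u)"
      unfolding nxt(1)[OF u] by (simp add: rotate1_map)
    also have "\<dots> = map c u" using word_letters[OF u] prv_nxt by auto
    finally show "cyclic_flow (\<lambda>m. c (prv m)) c u" by (simp add: cyclic_flow_def)
  qed (rule that)
  have one: "1 \<in> I" using n by (simp add: I_def)
  have "reach [] I"
  proof (rule reach_all)
    show "flat_word (vertex 1) (I - {1})"
    proof (rule flat_word_of_planar[OF one])
      show "inter I (\<lambda>m. c (prv m)) c (\<lambda>m. d (prv m)) d = 0"
        if "\<And>i. i \<in> I \<Longrightarrow> c (i, 1) + c (i, -1) = c (prv (i, 1)) + c (prv (i, -1))"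
          "\<And>i. i \<in> I \<Longrightarrow> d (i, 1) + d (i, -1) = d (prv (i, 1)) + d (prv (i, -1))" for c d
        using pl fl[OF that(1)] fl[OF that(2)] unfolding planar_def I_def by blast
    qed
    show "1 \<in> I" by (rule one)
    show "R = I" if "R \<subseteq> I" "R \<noteq> {}" "\<And>m. m \<in> R \<times> {1, -1} \<Longrightarrow> fst (nxt m) \<in> R" for R
      by (rule conn) (use that in auto)
  qed
  then obtain ls ws where sw: "sweep ls ws I" "last ws = []" unfolding reach_def by blast
  interpret sweeping I nxt prv ls ws by unfold_locales (rule sw)+
  define orbit where "orbit u z per js \<longleftrightarrow> per > 0 \<and> (\<forall>i. z i \<in> nodes) \<and> (\<forall>i. z (Suc i) = succ (z i)) \<and>
     z per = z 0 \<and> inj_on z {..<per} \<and> sorted js \<and> distinct js \<and> set js = {i. i < per \<and> crossing (z i)} \<and>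
     map (\<lambda>i. letter_of (z i)) js = u \<and> crossing (z 0)" for u z per js
  have "\<exists>t. orbit (us ! j) (fst t) (fst (snd t)) (snd (snd t))" if j: "j < length us" for j
  proof -
    let ?u = "us ! j"
    have u: "?u \<in> set us" using j by simp
    have d: "distinct ?u" using dist u by (simp add: distinct_concat_iff)
    show ?thesis
    proof (rule component_orbit[OF nonempty[OF u] d word_letters[OF u] nxt(1)[OF u]])
      fix z per js
      assume "per > 0" "\<And>i. z i \<in> nodes" "\<And>i. z (Suc i) = succ (z i)" "z per = z 0" "inj_on z {..<per}"
        "sorted js" "distinct js" "set js = {i. i < per \<and> crossing (z i)}" "map (\<lambda>i. letter_of (z i)) js = ?u" "crossing (z 0)"
      then have "orbit ?u z per js" unfolding orbit_def by (intro conjI allI)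
      then show ?thesis by (intro exI[of _ "(z, per, js)"]) (simp only: fst_conv snd_conv)
    qed
  qed
  then obtain t where t: "\<And>j. j < length us \<Longrightarrow> orbit (us ! j) (fst (t j)) (fst (snd (t j))) (snd (snd (t j)))"
    by metis
  note t = t[unfolded orbit_def]
  interpret realization I nxt prv ls ws us e "\<lambda>j. fst (t j)" "\<lambda>j. fst (snd (t j))" "\<lambda>j. snd (snd (t j))"
    by unfold_locales (use dist setu t in \<open>blast+\<close>)
  have len: "length us = length ps" by (simp add: us_def)
  have words: "component_word D num j = ps ! j" if j: "j < length ps" for j
  proof -
    have "map (lsym e) (component_word D num j) = map (lsym e) (ps ! j)"
      using words_D(1)[of j] j by (simp add: us_def)
    moreover have "inj_on (lsym e) (set (component_word D num j) \<union> set (ps ! j))"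
    proof (rule inj_on_subset[OF inj])
      have "set (ps ! j) \<subseteq> L" using setp nth_mem[OF j] by auto
      then show "set (component_word D num j) \<union> set (ps ! j) \<subseteq> L" using words_D(2)[of j] j len unfolding L_def by simp
    qed
    ultimately show ?thesis by (simp add: inj_on_map_eq_map)
  qed
  have "image_mset (component_word D num) (mset_set {..<ncomp D}) = mset (map (component_word D num) [0..<length ps])"
    by (simp add: D_simps len lessThan_atLeast0)
  also have "map (component_word D num) [0..<length ps] = ps" by (rule nth_equalityI) (simp_all add: words)
  finally have img: "image_mset (component_word D num) (mset_set {..<ncomp D}) = P" using ps by simp
  have "cyclic_eq x x" for x :: "letter list" unfolding cyclic_eq_def by (rule exI[of _ 0]) simp
  then have "rel_mset cyclic_eq P P" by (rule multiset.rel_refl)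
  moreover have "card (crossings D) = n" using bij_betw_same_card[OF num_bij] by (simp add: I_def)
  ultimately have "encodes P D" unfolding encodes_def using num_bij img by (intro exI[of _ num]) (simp add: I_def)
  moreover have "ncomp D = size P" using D_simps(1) len ps by auto
  ultimately show ?thesis using link_D by blast
qed

theorem theorem3p6:
  fixes n :: nat and P :: "letter list multiset" and W :: "symbol list"
  assumes "n \<ge> 1"
    and "gauss_paragraph n P"
    and "\<not> splittable P"
    and "associated_gauss_code P W"
  shows "(\<exists>D. link_diagram D \<and> ncomp D = size P \<and> encodes P D) \<longleftrightarrow>
    (\<forall>i\<in>{1..n}. \<forall>j\<in>{1..n}. code_alpha W i = 0 \<and> code_beta W i j = 0)"
proof -
  obtain e0 where "well e0 {1..n} P" using gauss_paragraph_well[OF assms(2)] .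
  moreover obtain w where "merge_step\<^sup>*\<^sup>* P {#w#}" "cyclic_eq (map (to_symbol w) w) W"
    using assms(4) unfolding associated_gauss_code_def by blast
  ultimately obtain e where e: "well e {1..n} P"
    and *: "planar (flat e P) {1..n} \<longleftrightarrow> (\<forall>i\<in>{1..n}. \<forall>j\<in>{1..n}. code_alpha W i = 0 \<and> code_beta W i j = 0)"
    using planar_iff_code by blast
  show ?thesis
    unfolding *[symmetric] using diagram_planar[OF _ _ e] planar_realizable[OF e assms(1,3)] by blast
qed

end
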